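(* Let $\mathcal{O}\in\{\mathrm{MIO},\mathrm{DIO},\mathrm{IO},\mathrm{SIO}\}$ and let $\varepsilon$ be the allowed distillation error. For every density matrix $\rho\in\mathbb{D}$ it holds that $$C_{A,\mathcal{O}}^{(1),\varepsilon}(\rho)\le\widetilde{C}_{A,\mathcal{O}}^{(1),\varepsilon}(\rho),$$ with equality if $d\le3$.
   Context: $\mathcal{H}_d$ is a complex Hilbert space of finite dimension $d$ with a fixed orthonormal (reference) basis $\{|i\rangle\}_{i=1}^d$; $\mathbb{D}$ is the set of density matrices on $\mathcal{H}_d$. $\log$ is base 2. For a unit vector $|\psi\rangle$, $\psi:=|\psi\rangle\langle\psi|$. $\langle X,Y\rangle=\mathrm{Tr}(X^\dagger Y)$. $F(\rho,\sigma)=\|\sqrt\rho\sqrt\sigma\|_1^2$ (trace norm) is the squared fidelity; $\|\cdot\|_\infty$ is the operator norm. $\Delta$ denotes the dephasing map $\Delta(X)=\sum_i|i\rangle\langle i|X|i\rangle\langle i|$ in the reference basis of the relevant space; a state $\omega$ is incoherent if $\omega=\Delta(\omega)$. Free operations (quantum channels from operators on $\mathcal{H}_d$ to operators on an $m$-dimensional space with its own reference basis $\{|i\rangle\}_{i=1}^m$): MIO are channels mapping every incoherent state to an incoherent state; DIO are channels $\mathscr{E}$ that commute with dephasing, $\Delta[\mathscr{E}(\rho)]=\mathscr{E}[\Delta(\rho)]$; IO are channels having a Kraus decomposition $\{K_\ell\}$ with every $K_\ell$ incoherent, i.e. $K_\ell\sigma K_\ell^\dagger$ is, up to normalization, an incoherent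 state for every incoherent $\sigma$; SIO are channels having a Kraus decomposition $\{K_\ell\}$ in which all $K_\ell$ and all $K_\ell^\dagger$ are incoherent in this sense. $|\Psi_m\rangle=\sum_{i=1}^m\frac1{\sqrt m}|i\rangle$ is the $m$-dimensional maximally coherent state. The fidelity of assisted distillation is $$F_{A,\mathcal{O}}(\rho,m):=\max\Big\{\Big\langle\sum_ip_i\Lambda_i(\psi_i),\Psi_m\Big\rangle : \rho=\sum_ip_i\psi_i,\ \Lambda_i\in\mathcal{O}\ \forall i\Big\},$$ where the maximum is over all pure-state convex decompositions of $\rho$ and all choices of $\Lambda_i$. The one-shot assisted distillation rate with allowed error $\varepsilon$ is $$C_{A,\mathcal{O}}^{(1),\varepsilon}(\rho):=\log\max\{m\in\mathbb{N}: F_{A,\mathcal{O}}(\rho,m)\ge1-\varepsilon\}.$$ Let $\widetilde{\mathcal{M}}_m:=\{\omega\in\mathbb{D}:\|\Delta(\omega)\|_\infty\le\frac1m\}$, $\widetilde{F}_{A,\mathcal{O}}(\rho,m):=\max_{\omega\in\widetilde{\mathcal{M}}_m}F(\rho,\omega)$, and $$\widetilde{C}_{A,\mathcal{O}}^{(1),\varepsilon}(\rho):=\log\max\{m\in\mathbb{N}:\widetilde{F}_{A,\mathcal{O}}(\rho,m)\ge1-\varepsilon\}.$$ Equivalently, $\widetilde{C}_{A,\mathcal{O}}^{(1),\varepsilon}(\rho)=\log\left\lfloor 1/\min\{\|\Delta(\omega)\|_\infty:\omega\in\mathbb{D},\,F(\rho,\omega)\ge1-\varepsilon\}\right\rfl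oor$.
   Formalization: False as stated for d=2, ρ=Ψ_2, ε=1/3 (embedding gives C_A ≥ log 3 > C̃); proved for ε≥0 with targets m ≤ d in the definition of C_A, and for unrestricted m when 0 ≤ ε < 1/(d+1); M̃_m empty (m>d) counts as not qualifying. *)

theory Defs
  imports "Jordan_Normal_Form.Schur_Decomposition"
begin

text \<open>
  The Hilbert space of dimension \<open>n\<close> is \<open>carrier_vec n\<close>, its reference basis is
  \<open>unit_vec n 0, \<dots>, unit_vec n (n - 1)\<close>, and operators on it are the elements of
  \<open>carrier_mat n n\<close>. The library's \<open>v \<bullet>c w\<close> conjugates its second argument.
\<close>

subsection \<open>Operators and states\<close>

text \<open>
  The order on \<^typ>\<open>complex\<close> is the one of \<open>HOL-Library.Complex_Order\<close>: \<open>0 \<le> z\<close> says that \<open>z\<close> is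
  real and nonnegative, so Hermiticity is implied.
\<close>

definition psd :: "nat \<Rightarrow> complex mat \<Rightarrow> bool" where
  "psd n A \<longleftrightarrow> A \<in> carrier_mat n n \<and> (\<forall>v\<in>carrier_vec n. 0 \<le> (A *\<^sub>v v) \<bullet>c v)"

definition mat_trace :: "complex mat \<Rightarrow> complex" where
  "mat_trace A = (\<Sum>i<dim_row A. A $$ (i, i))"

definition density :: "nat \<Rightarrow> complex mat set" where
  "density n = {A. psd n A \<and> mat_trace A = 1}"

definition hs_inner :: "complex mat \<Rightarrow> complex mat \<Rightarrow> complex" where
  "hs_inner X Y = mat_trace (mat_adjoint X * Y)"

definition vnorm :: "complex vec \<Rightarrow> real" where
  "vnorm v = sqrt (Re (v \<bullet>c v))"

definition unit_vectors :: "nat \<Rightarrow> complex vec set" where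
  "unit_vectors n = {v \<in> carrier_vec n. vnorm v = 1}"

definition proj :: "complex vec \<Rightarrow> complex mat" where
  "proj v = mat (dim_vec v) (dim_vec v) (\<lambda>(i, j). v $ i * cnj (v $ j))"

definition mat_sum :: "nat \<Rightarrow> nat \<Rightarrow> (nat \<Rightarrow> complex mat) \<Rightarrow> complex mat" where
  "mat_sum n r A = mat n n (\<lambda>(i, j). \<Sum>l<r. A l $$ (i, j))"

text \<open>Meaningful for positive semidefinite arguments, whose positive square root is unique.\<close>

definition mat_sqrt :: "complex mat \<Rightarrow> complex mat" where
  "mat_sqrt A = (THE B. psd (dim_row A) B \<and> B * B = A)"

definition trace_norm :: "complex mat \<Rightarrow> real" where
  "trace_norm X = Re (mat_trace (mat_sqrt (mat_adjoint X * X)))"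

definition op_norm :: "complex mat \<Rightarrow> real" where
  "op_norm X = (SUP v\<in>unit_vectors (dim_col X). vnorm (X *\<^sub>v v))"

definition fidelity :: "complex mat \<Rightarrow> complex mat \<Rightarrow> real" where
  "fidelity \<rho> \<sigma> = (trace_norm (mat_sqrt \<rho> * mat_sqrt \<sigma>))\<^sup>2"

definition dephase :: "complex mat \<Rightarrow> complex mat" where
  "dephase X = mat_diag (dim_row X) (\<lambda>i. X $$ (i, i))"

definition incoherent_states :: "nat \<Rightarrow> complex mat set" where
  "incoherent_states n = {\<omega> \<in> density n. \<omega> = dephase \<omega>}"

definition max_coherent :: "nat \<Rightarrow> complex mat" where
  "max_coherent m = proj (vec m (\<lambda>i. complex_of_real (1 / sqrt (real m))))"


subsection \<open>Quantum channels\<close>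

text \<open>
  A map on operators is a HOL function whose values outside \<open>carrier_mat d d\<close> are irrelevant.
\<close>

definition linear_on_ops :: "nat \<Rightarrow> nat \<Rightarrow> (complex mat \<Rightarrow> complex mat) \<Rightarrow> bool" where
  "linear_on_ops d m \<Lambda> \<longleftrightarrow>
     (\<forall>X\<in>carrier_mat d d. \<Lambda> X \<in> carrier_mat m m) \<and>
     (\<forall>X\<in>carrier_mat d d. \<forall>Y\<in>carrier_mat d d. \<Lambda> (X + Y) = \<Lambda> X + \<Lambda> Y) \<and>
     (\<forall>c. \<forall>X\<in>carrier_mat d d. \<Lambda> (c \<cdot>\<^sub>m X) = c \<cdot>\<^sub>m \<Lambda> X)"

text \<open>
  \<open>ampliate k d m \<Lambda>\<close> is \<open>id \<otimes> \<Lambda>\<close> with a \<open>k\<close>-dimensional ancilla: an operator on the tensor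
  product is a \<open>k \<times> k\<close> array of \<open>d \<times> d\<close> blocks, and \<open>\<Lambda>\<close> is applied to every block.
\<close>

definition block :: "nat \<Rightarrow> complex mat \<Rightarrow> nat \<Rightarrow> nat \<Rightarrow> complex mat" where
  "block d X a b = mat d d (\<lambda>(i, j). X $$ (a * d + i, b * d + j))"

definition ampliate ::
    "nat \<Rightarrow> nat \<Rightarrow> nat \<Rightarrow> (complex mat \<Rightarrow> complex mat) \<Rightarrow> complex mat \<Rightarrow> complex mat" where
  "ampliate k d m \<Lambda> X =
     mat (k * m) (k * m) (\<lambda>(r, s). \<Lambda> (block d X (r div m) (s div m)) $$ (r mod m, s mod m))"

definition completely_positive :: "nat \<Rightarrow> nat \<Rightarrow> (complex mat \<Rightarrow> complex mat) \<Rightarrow> bool" where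
  "completely_positive d m \<Lambda> \<longleftrightarrow>
     (\<forall>k X. psd (k * d) X \<longrightarrow> psd (k * m) (ampliate k d m \<Lambda> X))"

definition trace_preserving :: "nat \<Rightarrow> (complex mat \<Rightarrow> complex mat) \<Rightarrow> bool" where
  "trace_preserving d \<Lambda> \<longleftrightarrow> (\<forall>X\<in>carrier_mat d d. mat_trace (\<Lambda> X) = mat_trace X)"

definition channels :: "nat \<Rightarrow> nat \<Rightarrow> (complex mat \<Rightarrow> complex mat) set" where
  "channels d m =
     {\<Lambda>. linear_on_ops d m \<Lambda> \<and> completely_positive d m \<Lambda> \<and> trace_preserving d \<Lambda>}"

definition kraus_decomposition ::
    "nat \<Rightarrow> nat \<Rightarrow> nat \<Rightarrow> (nat \<Rightarrow> complex mat) \<Rightarrow> (complex mat \<Rightarrow> complex mat) \<Rightarrow> bool" where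
  "kraus_decomposition d m r K \<Lambda> \<longleftrightarrow>
     (\<forall>l<r. K l \<in> carrier_mat m d) \<and>
     (\<forall>X\<in>carrier_mat d d. \<Lambda> X = mat_sum m r (\<lambda>l. K l * X * mat_adjoint (K l)))"

text \<open>The factor \<open>c\<close> is the normalization; \<open>c = 0\<close> covers \<open>K \<sigma> K\<^sup>\<dagger> = 0\<close>.\<close>

definition incoherent_operator :: "nat \<Rightarrow> nat \<Rightarrow> complex mat \<Rightarrow> bool" where
  "incoherent_operator d m K \<longleftrightarrow> K \<in> carrier_mat m d \<and>
     (\<forall>\<sigma>\<in>incoherent_states d. \<exists>c::real. \<exists>\<tau>\<in>incoherent_states m.
        0 \<le> c \<and> K * \<sigma> * mat_adjoint K = complex_of_real c \<cdot>\<^sub>m \<tau>)"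


subsection \<open>Free operations\<close>

datatype free_class = MIO | DIO | IO | SIO

fun free_operations :: "free_class \<Rightarrow> nat \<Rightarrow> nat \<Rightarrow> (complex mat \<Rightarrow> complex mat) set" where
  "free_operations MIO d m =
     {\<Lambda> \<in> channels d m. \<forall>\<omega>\<in>incoherent_states d. \<Lambda> \<omega> \<in> incoherent_states m}"
| "free_operations DIO d m =
     {\<Lambda> \<in> channels d m. \<forall>\<rho>\<in>density d. dephase (\<Lambda> \<rho>) = \<Lambda> (dephase \<rho>)}"
| "free_operations IO d m =
     {\<Lambda> \<in> channels d m. \<exists>r K. kraus_decomposition d m r K \<Lambda> \<and>
        (\<forall>l<r. incoherent_operator d m (K l))}"
| "free_operations SIO d m =
     {\<Lambda> \<in> channels d m. \<exists>r K. kraus_decomposition d m r K \<Lambda> \<and>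
        (\<forall>l<r. incoherent_operator d m (K l) \<and> incoherent_operator m d (mat_adjoint (K l)))}"


subsection \<open>Assisted distillation\<close>

definition pure_decomposition ::
    "nat \<Rightarrow> complex mat \<Rightarrow> nat \<Rightarrow> (nat \<Rightarrow> real) \<Rightarrow> (nat \<Rightarrow> complex vec) \<Rightarrow> bool" where
  "pure_decomposition d \<rho> n p \<psi> \<longleftrightarrow>
     (\<forall>i<n. 0 \<le> p i) \<and> (\<Sum>i<n. p i) = 1 \<and> (\<forall>i<n. \<psi> i \<in> unit_vectors d) \<and>
     \<rho> = mat_sum d n (\<lambda>i. complex_of_real (p i) \<cdot>\<^sub>m proj (\<psi> i))"

text \<open>
  The defining maxima over decompositions and over \<open>M_tilde d m\<close> are attained, by compactness,
  and are written as suprema.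
\<close>

definition assisted_fidelity :: "free_class \<Rightarrow> nat \<Rightarrow> complex mat \<Rightarrow> nat \<Rightarrow> real" where
  "assisted_fidelity \<O> d \<rho> m =
     Sup {Re (hs_inner (mat_sum m n (\<lambda>i. complex_of_real (p i) \<cdot>\<^sub>m \<Lambda> i (proj (\<psi> i)))) (max_coherent m))
          | n p \<psi> \<Lambda>. pure_decomposition d \<rho> n p \<psi> \<and> (\<forall>i<n. \<Lambda> i \<in> free_operations \<O> d m)}"

definition assisted_rate :: "free_class \<Rightarrow> nat \<Rightarrow> real \<Rightarrow> complex mat \<Rightarrow> real" where
  "assisted_rate \<O> d \<epsilon> \<rho> =
     log 2 (real (Max {m. 1 \<le> m \<and> 1 - \<epsilon> \<le> assisted_fidelity \<O> d \<rho> m}))"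

text \<open>
  The maximum in \<open>assisted_rate\<close> ranges over all targets \<open>m \<ge> 1\<close>. For \<open>m > d\<close> the fidelity is at
  most \<open>d / m\<close>, with equality for the maximally coherent input (embed it isometrically). Hence no
  \<open>m > d\<close> qualifies if \<open>\<epsilon> < 1 / (d + 1)\<close>, while for larger \<open>\<epsilon>\<close> the rate can exceed \<open>log 2 d\<close> and,
  for \<open>\<epsilon> \<ge> 1\<close>, the set is infinite. The next definition admits only \<open>m \<le> d\<close>.
\<close>

definition assisted_rate_within :: "free_class \<Rightarrow> nat \<Rightarrow> real \<Rightarrow> complex mat \<Rightarrow> real" where
  "assisted_rate_within \<O> d \<epsilon> \<rho> =
     log 2 (real (Max {m. 1 \<le> m \<and> m \<le> d \<and> 1 - \<epsilon> \<le> assisted_fidelity \<O> d \<rho> m}))"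

definition M_tilde :: "nat \<Rightarrow> nat \<Rightarrow> complex mat set" where
  "M_tilde d m = {\<omega> \<in> density d. op_norm (dephase \<omega>) \<le> 1 / real m}"

definition fidelity_tilde :: "nat \<Rightarrow> complex mat \<Rightarrow> nat \<Rightarrow> real" where
  "fidelity_tilde d \<rho> m = (SUP \<omega>\<in>M_tilde d m. fidelity \<rho> \<omega>)"

text \<open>
  \<open>M_tilde d m\<close> is empty for \<open>m > d\<close>. Such \<open>m\<close> are excluded explicitly, because the supremum of
  the empty set of reals is an unspecified number.
\<close>

definition rate_tilde :: "nat \<Rightarrow> real \<Rightarrow> complex mat \<Rightarrow> real" where
  "rate_tilde d \<epsilon> \<rho> =
     log 2 (real (Max {m. 1 \<le> m \<and> M_tilde d m \<noteq> {} \<and> 1 - \<epsilon> \<le> fidelity_tilde d \<rho> m}))"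

end

theory Submission
  imports Defs "HOL-Analysis.L2_Norm" "Jordan_Normal_Form.Char_Poly"
begin

text \<open>
  For a free operation \<open>\<Lambda>\<close> the dual operator \<open>M = \<Lambda>\<^sup>\<dagger>(\<Psi>\<^sub>m)\<close> satisfies \<open>0 \<le> M \<le> 1\<close> and has diagonal entries
  \<open>1 / m\<close>. Normalising \<open>M \<psi>\<close>, raising its moduli and aligning its phases with \<open>\<psi>\<close> gives a unit vector \<open>w\<close>
  with \<open>|w i|\<^sup>2 \<le> 1 / m\<close> whose overlap with \<open>\<psi>\<close> is at least the achieved value. Mixing these vectors and
  using the strong concavity of the fidelity yields the upper bound.

  Conversely, a pure state with \<open>|\<phi> i|\<^sup>2 \<le> 1 / m\<close> is converted exactly into \<open>\<Psi>\<^sub>m\<close> by a strictly incoherent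
  map that commutes with dephasing, because \<open>(m |\<phi> i|\<^sup>2)\<close> lies in the hypersimplex. By Uhlmann's theorem a decomposition of
  \<open>\<omega>\<close> into such states induces one of \<open>\<rho>\<close> with value at least \<open>F(\<rho>, \<omega>)\<close>. For \<open>d \<le> 3\<close> every \<open>\<omega>\<close> with
  diagonal at most \<open>1 / m\<close> has such a decomposition, by a zero-diagonal argument of Toeplitz--Hausdorff type.
\<close>

text \<open>Decompositions are handled as factors: the columns of \<open>A\<close> with
  \<open>A * A\<^sup>\<dagger> = \<rho>\<close> are the vectors \<open>\<psi> j\<close> scaled by
  \<open>sqrt (p j)\<close>. Two factors with equally many columns have the overlap
  \<open>mat_trace (B\<^sup>\<dagger> * A)\<close>, a sum of columnwise inner products, so
  purifications and ensembles need no tensor products. Polar factors are contractions rather than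
  unitaries; this is why attaining the fidelity leaves a positive remainder
  \<open>E * E\<^sup>\<dagger>\<close>, which later becomes extra columns facing zero columns. The
  four classes are treated together: the upper bound uses of a free operation only that it is a
  channel sending basis states to diagonal matrices, and the maps built for the converse lie in all
  four classes at once. The dimension limit comes from the converse. Giving every column a
  prescribed diagonal distribution costs d - 1 real equations, while mixing columns unitarily
  equalises one complex-valued form, that is, two real ones.\<close>

abbreviation dagger :: "complex mat \<Rightarrow> complex mat" (\<open>_\<^sup>\<dagger>\<close> [1000] 999) where
  "A\<^sup>\<dagger> \<equiv> mat_adjoint A"

section \<open>Adjoints, inner products, norms and traces\<close>

lemma dim_adjoint [simp]: "dim_row (A\<^sup>\<dagger>) = dim_col A" "dim_col (A\<^sup>\<dagger>) = dim_row A"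
  by (auto simp: mat_adjoint_def)

lemma adjoint_carrier [simp]: "A \<in> carrier_mat m n \<Longrightarrow> A\<^sup>\<dagger> \<in> carrier_mat n m"
  by (auto intro!: carrier_matI)

lemma adjoint_index [simp]:
  "i < dim_col A \<Longrightarrow> j < dim_row A \<Longrightarrow> A\<^sup>\<dagger> $$ (i, j) = cnj (A $$ (j, i))"
  by (auto simp: mat_adjoint_def mat_of_rows_def)

lemma adjoint_mult_vec_carrier [simp]:
  "A \<in> carrier_mat m n \<Longrightarrow> A\<^sup>\<dagger> *\<^sub>v v \<in> carrier_vec n"
  by (auto intro!: carrier_vecI)

lemma adjoint_adjoint [simp]: "(A\<^sup>\<dagger>)\<^sup>\<dagger> = A"
  by (rule eq_matI) auto

lemma mult_index:
  assumes "A \<in> carrier_mat m n" "B \<in> carrier_mat n p" "i < m" "j < p"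
  shows "(A * B) $$ (i, j) = (\<Sum>k<n. A $$ (i, k) * B $$ (k, j))"
  using assms by (auto simp: scalar_prod_def atLeast0LessThan intro!: sum.cong)

lemma mult_vec_index:
  assumes "A \<in> carrier_mat m n" "v \<in> carrier_vec n" "i < m"
  shows "(A *\<^sub>v v) $ i = (\<Sum>k<n. A $$ (i, k) * v $ k)"
  using assms by (auto simp: scalar_prod_def atLeast0LessThan intro!: sum.cong)

lemma adjoint_mult:
  assumes "A \<in> carrier_mat m n" "B \<in> carrier_mat n p"
  shows "(A * B)\<^sup>\<dagger> = B\<^sup>\<dagger> * A\<^sup>\<dagger>"
proof (rule eq_matI)
  fix i j assume ij: "i < dim_row (B\<^sup>\<dagger> * A\<^sup>\<dagger>)" "j < dim_col (B\<^sup>\<dagger> * A\<^sup>\<dagger>)"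
  then have "i < p" "j < m" using assms by auto
  moreover have "(B\<^sup>\<dagger> * A\<^sup>\<dagger>) $$ (i, j) = (\<Sum>k<n. B\<^sup>\<dagger> $$ (i, k) * A\<^sup>\<dagger> $$ (k, j))"
    using assms calculation by (intro mult_index) auto
  moreover have "(A * B) $$ (j, i) = (\<Sum>k<n. A $$ (j, k) * B $$ (k, i))"
    using assms calculation by (intro mult_index) auto
  ultimately show "(A * B)\<^sup>\<dagger> $$ (i, j) = (B\<^sup>\<dagger> * A\<^sup>\<dagger>) $$ (i, j)"
    using assms by (auto simp del: index_mult_mat(1) intro!: sum.cong)
qed (use assms in auto)

lemma cinner_index:
  assumes "v \<in> carrier_vec n" "w \<in> carrier_vec n"
  shows "v \<bullet>c w = (\<Sum>i<n. v $ i * cnj (w $ i))"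
  using assms by (auto simp: scalar_prod_def atLeast0LessThan intro!: sum.cong)

lemma cinner_cnj:
  assumes "v \<in> carrier_vec n" "w \<in> carrier_vec n"
  shows "cnj (v \<bullet>c w) = w \<bullet>c v"
  by (simp add: cinner_index[OF assms] cinner_index[OF assms(2,1)] mult.commute)

lemma cinner_adjoint:
  assumes A: "A \<in> carrier_mat m n" and v: "v \<in> carrier_vec n" and w: "w \<in> carrier_vec m"
  shows "(A *\<^sub>v v) \<bullet>c w = v \<bullet>c (A\<^sup>\<dagger> *\<^sub>v w)"
proof -
  have "(A *\<^sub>v v) \<bullet>c w = (\<Sum>i<m. (\<Sum>k<n. A $$ (i, k) * v $ k) * cnj (w $ i))"
    using assms by (subst cinner_index[of _ m]) (auto simp: mult_vec_index simp del: index_mult_mat_vec)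
  also have "\<dots> = (\<Sum>k<n. \<Sum>i<m. A $$ (i, k) * v $ k * cnj (w $ i))"
    by (subst sum.swap) (simp add: sum_distrib_right)
  also have "\<dots> = (\<Sum>k<n. v $ k * cnj ((A\<^sup>\<dagger> *\<^sub>v w) $ k))"
  proof (rule sum.cong)
    fix k assume "k \<in> {..<n}"
    then show "(\<Sum>i<m. A $$ (i, k) * v $ k * cnj (w $ i)) = v $ k * cnj ((A\<^sup>\<dagger> *\<^sub>v w) $ k)"
      using assms
      by (subst mult_vec_index[of _ n m]) (auto simp: sum_distrib_left algebra_simps intro!: sum.cong)
  qed simp
  also have "\<dots> = v \<bullet>c (A\<^sup>\<dagger> *\<^sub>v w)"
    using assms by (subst cinner_index[of _ n]) auto
  finally show ?thesis .
qed

lemma vnorm_L2: "v \<in> carrier_vec n \<Longrightarrow> vnorm v = L2_set (\<lambda>i. cmod (v $ i)) {..<n}"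
  unfolding vnorm_def L2_set_def
  by (auto simp: cinner_index[of v n] complex_mult_cnj cmod_power2 simp flip: of_real_power)

lemma vnorm_ge_0 [simp]: "0 \<le> vnorm v"
  using vnorm_L2[of v "dim_vec v"] by (simp add: carrier_vec_dim_vec L2_set_nonneg)

lemma vnorm_sq: "v \<in> carrier_vec n \<Longrightarrow> (vnorm v)\<^sup>2 = (\<Sum>i<n. (cmod (v $ i))\<^sup>2)"
  by (simp add: vnorm_L2 L2_set_def sum_nonneg)

lemma cinner_self: "v \<in> carrier_vec n \<Longrightarrow> v \<bullet>c v = complex_of_real ((vnorm v)\<^sup>2)"
  by (simp add: vnorm_sq cinner_index complex_norm_square[symmetric] del: of_real_power)

lemma vnorm_eq_0:
  assumes "v \<in> carrier_vec n"
  shows "vnorm v = 0 \<longleftrightarrow> v = 0\<^sub>v n"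
  using assms by (auto simp: vnorm_L2 L2_set_eq_0_iff)

lemma cinner_le_vnorm:
  assumes "v \<in> carrier_vec n" "w \<in> carrier_vec n"
  shows "cmod (v \<bullet>c w) \<le> vnorm v * vnorm w"
proof -
  have "cmod (v \<bullet>c w) \<le> (\<Sum>i<n. \<bar>cmod (v $ i)\<bar> * \<bar>cmod (w $ i)\<bar>)"
    unfolding cinner_index[OF assms] by (rule sum_norm_le) (simp add: norm_mult)
  also have "\<dots> \<le> vnorm v * vnorm w"
    unfolding assms[THEN vnorm_L2] by (rule L2_set_mult_ineq)
  finally show ?thesis .
qed

lemma vnorm_smult: "vnorm (c \<cdot>\<^sub>v v) = cmod c * vnorm v"
proof -
  have v: "v \<in> carrier_vec (dim_vec v)" by simp
  have "(vnorm (c \<cdot>\<^sub>v v))\<^sup>2 = (cmod c * vnorm v)\<^sup>2"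
    using v by (simp add: vnorm_sq[of _ "dim_vec v"] norm_mult power_mult_distrib sum_distrib_left)
  then show ?thesis by simp
qed

lemma vnorm_unit [simp]: "i < n \<Longrightarrow> vnorm (unit_vec n i) = 1"
  by (simp add: vnorm_L2[of _ n] L2_set_def unit_vec_def if_distrib[of cmod] if_distrib[of "\<lambda>x. x\<^sup>2"]
      sum.delta cong: if_cong)

lemma cinner_unit: "v \<in> carrier_vec n \<Longrightarrow> i < n \<Longrightarrow> v \<bullet>c unit_vec n i = (v $ i :: complex)"
  by (subst cinner_index[of _ n]) (auto simp: unit_vec_def if_distrib if_distribR sum.delta cong: if_cong)

lemma mult_unit_vec_index:
  "A \<in> carrier_mat m n \<Longrightarrow> i < m \<Longrightarrow> j < n \<Longrightarrow> (A *\<^sub>v unit_vec n j) $ i = (A $$ (i, j) :: complex)"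
  by (subst mult_vec_index[of _ m n])
    (auto simp: unit_vec_def if_distrib[of "\<lambda>x. _ * x"] sum.delta cong: if_cong)

lemma trace_comm:
  assumes "A \<in> carrier_mat m n" "B \<in> carrier_mat n m"
  shows "mat_trace (A * B) = mat_trace (B * A)"
proof -
  have "mat_trace (A * B) = (\<Sum>i<m. \<Sum>k<n. A $$ (i, k) * B $$ (k, i))"
    unfolding mat_trace_def using assms
    by (auto simp: mult_index[OF assms] simp del: index_mult_mat(1) intro!: sum.cong)
  also have "\<dots> = (\<Sum>k<n. \<Sum>i<m. B $$ (k, i) * A $$ (i, k))"
    by (subst sum.swap) (simp add: mult.commute)
  also have "\<dots> = mat_trace (B * A)"
    unfolding mat_trace_def using assms
    by (auto simp: mult_index[OF assms(2,1)] simp del: index_mult_mat(1) intro!: sum.cong)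
  finally show ?thesis .
qed

lemma trace_adjoint: "A \<in> carrier_mat n n \<Longrightarrow> mat_trace (A\<^sup>\<dagger>) = cnj (mat_trace A)"
  by (auto simp: mat_trace_def)

lemma trace_index: "A \<in> carrier_mat n n \<Longrightarrow> mat_trace A = (\<Sum>i<n. A $$ (i, i))"
  by (auto simp: mat_trace_def)

lemma trace_add:
  "A \<in> carrier_mat n n \<Longrightarrow> B \<in> carrier_mat n n \<Longrightarrow> mat_trace (A + B) = mat_trace A + mat_trace B"
  by (auto simp: mat_trace_def sum.distrib)

lemma trace_smult: "A \<in> carrier_mat n n \<Longrightarrow> mat_trace (c \<cdot>\<^sub>m A) = c * mat_trace A"
  by (auto simp: mat_trace_def sum_distrib_left)

subsection \<open>Positive semidefinite matrices\<close>

lemma psd_carrier: "psd n A \<Longrightarrow> A \<in> carrier_mat n n"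
  by (simp add: psd_def)

lemma psdD: "psd n A \<Longrightarrow> v \<in> carrier_vec n \<Longrightarrow> 0 \<le> (A *\<^sub>v v) \<bullet>c v"
  by (simp add: psd_def)

lemma psd_gram:
  assumes "A \<in> carrier_mat n k"
  shows "psd n (A * A\<^sup>\<dagger>)"
  unfolding psd_def
proof safe
  fix v :: "complex vec" assume v: "v \<in> carrier_vec n"
  have "(A * A\<^sup>\<dagger> *\<^sub>v v) \<bullet>c v = (A *\<^sub>v (A\<^sup>\<dagger> *\<^sub>v v)) \<bullet>c v"
    using assms v by (simp add: assoc_mult_mat_vec[of _ n k _ n])
  also have "\<dots> = (A\<^sup>\<dagger> *\<^sub>v v) \<bullet>c (A\<^sup>\<dagger> *\<^sub>v v)"
    using assms v by (intro cinner_adjoint[of _ n k]) auto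
  also have "0 \<le> \<dots>" by (rule conjugate_square_ge_0_vec)
  finally show "0 \<le> (A * A\<^sup>\<dagger> *\<^sub>v v) \<bullet>c v" .
qed (use assms in auto)

lemma quadratic_form_index:
  assumes "A \<in> carrier_mat n n" "v \<in> carrier_vec n"
  shows "(A *\<^sub>v v) \<bullet>c v = (\<Sum>i<n. \<Sum>j<n. A $$ (i, j) * v $ j * cnj (v $ i))"
  using assms
  by (subst cinner_index[of _ n]) (auto simp: mult_vec_index[OF assms] sum_distrib_right
      simp del: index_mult_mat_vec)

lemma psd_diag:
  assumes "psd n A" "i < n"
  shows "0 \<le> A $$ (i, i)"
proof -
  have "(A *\<^sub>v unit_vec n i) \<bullet>c unit_vec n i = A $$ (i, i)"
    using assms psd_carrier[OF assms(1)]
    by (subst cinner_unit) (auto simp: mult_unit_vec_index simp del: index_mult_mat_vec)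
  then show ?thesis using psdD[OF assms(1), of "unit_vec n i"] by simp
qed

text \<open>The quadratic form at the \<open>i\<close>-th basis vector plus \<open>c\<close> times
  the \<open>j\<close>-th one. Suitable scalars \<open>c\<close> extract all needed information on
  off-diagonal entries.\<close>

lemma psd_form_pair:
  assumes A: "psd n A" and i: "i < n" and j: "j < n" and ij: "i \<noteq> j"
  shows "0 \<le> A $$ (i, i) + c * A $$ (i, j) + cnj c * A $$ (j, i) + c * cnj c * A $$ (j, j)"
proof -
  note cA = psd_carrier[OF A]
  let ?v = "unit_vec n i + c \<cdot>\<^sub>v unit_vec n j"
  have v: "?v \<in> carrier_vec n" by simp
  have "(A *\<^sub>v ?v) $ k = A $$ (k, i) + c * A $$ (k, j)" if "k < n" for k
    using cA i j that
    by (subst mult_add_distrib_mat_vec[of _ n n])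
      (auto simp: mult_mat_vec mult_unit_vec_index simp del: index_mult_mat_vec)
  then have "(A *\<^sub>v ?v) \<bullet>c ?v = (\<Sum>k<n. (A $$ (k, i) + c * A $$ (k, j)) * cnj (?v $ k))"
    using cA v by (subst cinner_index[of _ n]) (auto simp del: index_mult_mat_vec)
  also have "\<dots> = (\<Sum>k<n. if k = i then A $$ (i, i) + c * A $$ (i, j) else
      if k = j then cnj c * (A $$ (j, i) + c * A $$ (j, j)) else 0)"
    using ij i j by (intro sum.cong) (auto simp: unit_vec_def)
  also have "\<dots> = A $$ (i, i) + c * A $$ (i, j) + cnj c * (A $$ (j, i) + c * A $$ (j, j))"
    using ij i j by (subst sum.remove[of _ i]; simp add: sum.remove[of "{..<n} - {i}" j])
  finally show ?thesis using psdD[OF A v] by (simp add: algebra_simps)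
qed

lemma psd_adjoint:
  assumes A: "psd n A"
  shows "A\<^sup>\<dagger> = A"
proof (rule eq_matI)
  note cA = psd_carrier[OF A]
  fix i j assume "i < dim_row A" "j < dim_col A"
  then have i: "i < n" and j: "j < n" using cA by auto
  have "cnj (A $$ (j, i)) = A $$ (i, j)"
  proof (cases "i = j")
    case True
    then show ?thesis using psd_diag[OF A i] by (auto simp: complex_eq_iff less_eq_complex_def)
  next
    case False
    \<comment> \<open>Values of the form are real: the scalar 1 makes the imaginary parts of the two
      entries opposite, the imaginary unit makes their real parts equal.\<close>
    from psd_form_pair[OF A i j False, of 1] psd_form_pair[OF A i j False, of \<i>]
      psd_diag[OF A i] psd_diag[OF A j]
    show ?thesis by (auto simp: complex_eq_iff less_eq_complex_def)
  qed
  then show "A\<^sup>\<dagger> $$ (i, j) = A $$ (i, j)" using i j cA by simp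
qed (use psd_carrier[OF A] in auto)

text \<open>Nonnegative diagonal entries with sum zero vanish; then the form with
  \<open>c = - cnj (A $$ (i, j))\<close> is minus twice the squared modulus of that entry.\<close>

lemma psd_trace_eq_0:
  assumes A: "psd n A" and tr: "mat_trace A = 0"
  shows "A = 0\<^sub>m n n"
proof (rule eq_matI)
  note cA = psd_carrier[OF A]
  have diag: "A $$ (i, i) = 0" if "i < n" for i
  proof -
    have "(\<Sum>i<n. A $$ (i, i)) = 0" using tr cA by (simp add: trace_index)
    then show ?thesis using psd_diag[OF A] that by (subst (asm) sum_nonneg_eq_0_iff) auto
  qed
  fix i j assume "i < dim_row (0\<^sub>m n n :: complex mat)" "j < dim_col (0\<^sub>m n n :: complex mat)"
  then have i: "i < n" and j: "j < n" by auto
  show "A $$ (i, j) = 0\<^sub>m n n $$ (i, j)"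
  proof (cases "i = j")
    case False
    have "A $$ (j, i) = cnj (A $$ (i, j))"
      using adjoint_index[of j A i] psd_adjoint[OF A] i j cA by auto
    then have "0 \<le> - (2 * (A $$ (i, j) * cnj (A $$ (i, j))))"
      using psd_form_pair[OF A i j False, of "- cnj (A $$ (i, j))"] diag[OF i] diag[OF j]
      by (simp add: algebra_simps)
    then have "(cmod (A $$ (i, j)))\<^sup>2 \<le> 0"
      by (simp add: complex_mult_cnj less_eq_complex_def cmod_power2)
    then show ?thesis using i j by simp
  qed (use diag i j in auto)
qed (use psd_carrier[OF A] in auto)

text \<open>A nonzero \<open>A\<close> has nonzero trace, so its triangular Schur form has a nonzero
  diagonal entry. That entry is a root of the characteristic polynomial, and positivity of the form
  makes it a positive real.\<close>

lemma psd_eigenvector: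
  assumes A: "psd n A" and nz: "A \<noteq> 0\<^sub>m n n"
  obtains v l where "v \<in> carrier_vec n" "vnorm v = 1" "0 < l" "A *\<^sub>v v = complex_of_real l \<cdot>\<^sub>v v"
proof -
  note cA = psd_carrier[OF A]
  obtain es where "char_poly A = (\<Prod>a\<leftarrow>es. [:- a, 1:])"
    using char_poly_factorized[OF cA] by auto
  then obtain B where B: "B \<in> carrier_mat n n" "upper_triangular B" "similar_mat A B"
    using schur_decomposition_exists[OF cA] by blast
  obtain k P Q where "{A, B, P, Q} \<subseteq> carrier_mat k k" "Q * P = 1\<^sub>m k" "A = P * B * Q"
    using similar_matD[OF B(3)] by blast
  moreover from this have "k = n" using cA by auto
  ultimately have PQ: "{A, B, P, Q} \<subseteq> carrier_mat n n" "Q * P = 1\<^sub>m n" "A = P * B * Q"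
    by simp_all
  have "mat_trace A = mat_trace (Q * (P * B))"
    unfolding PQ(3) using PQ(1) by (intro trace_comm[of _ n n]) auto
  also have "Q * (P * B) = Q * P * B"
    using PQ by (intro assoc_mult_mat[symmetric]) auto
  also have "\<dots> = B" using PQ B by simp
  finally have "mat_trace B \<noteq> 0" using psd_trace_eq_0[OF A] nz by auto
  then have "(\<Sum>i<n. B $$ (i, i)) \<noteq> 0" using B(1) by (simp add: trace_index)
  then obtain i where i: "i < n" "B $$ (i, i) \<noteq> 0"
    by (meson lessThan_iff sum.not_neutral_contains_not_neutral)
  have "poly (char_poly A) (B $$ (i, i)) = 0"
    unfolding char_poly_similar[OF B(3)] char_poly_upper_triangular[OF B(1,2)]
    using i B(1) by (auto simp: poly_prod_list prod_list_zero_iff diag_mat_def image_iff)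
  then have "eigenvalue A (B $$ (i, i))" using eigenvalue_root_char_poly[OF cA] by simp
  then obtain u where u: "u \<in> carrier_vec n" "u \<noteq> 0\<^sub>v n" "A *\<^sub>v u = B $$ (i, i) \<cdot>\<^sub>v u"
    using cA by (auto simp: eigenvalue_def eigenvector_def)
  have pos: "0 < vnorm u" using u vnorm_eq_0[OF u(1)] vnorm_ge_0[of u] by linarith
  have "(A *\<^sub>v u) \<bullet>c u = B $$ (i, i) * complex_of_real ((vnorm u)\<^sup>2)"
    unfolding u(3) using u(1) by (subst cinner_self[OF u(1), symmetric]) auto
  then have "0 \<le> B $$ (i, i) * complex_of_real ((vnorm u)\<^sup>2)" using psdD[OF A u(1)] by simp
  then have "0 \<le> Re (B $$ (i, i)) \<and> Im (B $$ (i, i)) = 0"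
    using pos by (simp add: less_eq_complex_def zero_le_mult_iff del: of_real_power)
  then have "\<exists>l>0. B $$ (i, i) = complex_of_real l"
    using i(2) by (intro exI[of _ "Re (B $$ (i, i))"]) (auto simp: complex_eq_iff)
  then obtain l where l: "B $$ (i, i) = complex_of_real l" "0 < l" by blast
  let ?v = "complex_of_real (1 / vnorm u) \<cdot>\<^sub>v u"
  show ?thesis
  proof
    show "?v \<in> carrier_vec n" using u by simp
    show "vnorm ?v = 1" using pos by (simp add: vnorm_smult norm_divide)
    show "A *\<^sub>v ?v = complex_of_real l \<cdot>\<^sub>v ?v"
      using cA u l by (subst mult_mat_vec[of _ n n]) (auto simp: smult_smult_assoc mult.commute)
  qed fact
qed

section \<open>Rank-one projections, isometries and contractions\<close>

lemma cinner_diff_left: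
  fixes u v w :: "complex vec"
  assumes "u \<in> carrier_vec n" "v \<in> carrier_vec n" "w \<in> carrier_vec n"
  shows "(u - v) \<bullet>c w = u \<bullet>c w - v \<bullet>c w"
  using assms by (intro minus_scalar_prod_distrib) auto

lemma cinner_diff_right:
  fixes u v w :: "complex vec"
  assumes "u \<in> carrier_vec n" "v \<in> carrier_vec n" "w \<in> carrier_vec n"
  shows "w \<bullet>c (u - v) = w \<bullet>c u - w \<bullet>c v"
  using assms
  by (subst (1 2 3) cinner_index[of _ n]) (auto simp: algebra_simps sum_subtractf)

lemma cinner_smult_left:
  fixes v w :: "complex vec"
  assumes "v \<in> carrier_vec n" "w \<in> carrier_vec n"
  shows "(c \<cdot>\<^sub>v v) \<bullet>c w = c * (v \<bullet>c w)"
  using assms by auto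

lemma cinner_smult_right:
  fixes v w :: "complex vec"
  assumes "v \<in> carrier_vec n" "w \<in> carrier_vec n"
  shows "w \<bullet>c (c \<cdot>\<^sub>v v) = cnj c * (w \<bullet>c v)"
  using assms by (subst (1 2) cinner_index[of _ n]) (auto simp: sum_distrib_left algebra_simps)

lemma smult_mat_mult_vec:
  assumes "A \<in> carrier_mat m n" "v \<in> carrier_vec n"
  shows "(c \<cdot>\<^sub>m A) *\<^sub>v v = (c :: complex) \<cdot>\<^sub>v (A *\<^sub>v v)"
  using assms by (intro eq_vecI) auto

lemma proj_carrier [simp]: "v \<in> carrier_vec n \<Longrightarrow> proj v \<in> carrier_mat n n"
  by (auto simp: proj_def)

lemma proj_mult_vec:
  assumes "v \<in> carrier_vec n" "x \<in> carrier_vec n"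
  shows "proj v *\<^sub>v x = (x \<bullet>c v) \<cdot>\<^sub>v v"
proof (rule eq_vecI)
  fix i assume "i < dim_vec ((x \<bullet>c v) \<cdot>\<^sub>v v)"
  then have i: "i < n" using assms by simp
  have "(proj v *\<^sub>v x) $ i = (\<Sum>k<n. proj v $$ (i, k) * x $ k)"
    using assms i by (intro mult_vec_index[of _ n n]) auto
  also have "\<dots> = (x \<bullet>c v) * v $ i"
    using assms i by (auto simp: cinner_index[of x n] proj_def sum_distrib_left algebra_simps intro!: sum.cong)
  finally show "(proj v *\<^sub>v x) $ i = ((x \<bullet>c v) \<cdot>\<^sub>v v) $ i" using assms i by simp
qed (use assms in \<open>auto simp: proj_def\<close>)

lemma mat_diag_form_index:
  assumes U: "U \<in> carrier_mat n r" and ij: "i < n" "j < n"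
  shows "(U * mat_diag r f * U\<^sup>\<dagger>) $$ (i, j) = (\<Sum>k<r. U $$ (i, k) * f k * cnj (U $$ (j, k)))"
proof -
  have "(U * mat_diag r f * U\<^sup>\<dagger>) $$ (i, j) = (\<Sum>k<r. (U * mat_diag r f) $$ (i, k) * U\<^sup>\<dagger> $$ (k, j))"
    using assms by (intro mult_index[of _ n r _ n]) auto
  also have "\<dots> = (\<Sum>k<r. U $$ (i, k) * f k * cnj (U $$ (j, k)))"
    using assms by (intro sum.cong) (auto simp: mat_diag_mult_right[of _ n])
  finally show ?thesis .
qed

lemma cinner_isometry:
  assumes U: "U \<in> carrier_mat n r" "U\<^sup>\<dagger> * U = 1\<^sub>m r" and v: "v \<in> carrier_vec r" "w \<in> carrier_vec r"
  shows "(U *\<^sub>v v) \<bullet>c (U *\<^sub>v w) = v \<bullet>c w"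
proof -
  have "(U *\<^sub>v v) \<bullet>c (U *\<^sub>v w) = v \<bullet>c (U\<^sup>\<dagger> *\<^sub>v (U *\<^sub>v w))"
    using U(1) v by (intro cinner_adjoint[of _ n r]) auto
  also have "U\<^sup>\<dagger> *\<^sub>v (U *\<^sub>v w) = w"
    using U v by (subst assoc_mult_mat_vec[symmetric, of _ r n _ r]) auto
  finally show ?thesis .
qed

lemma vnorm_isometry:
  assumes "U \<in> carrier_mat n r" "U\<^sup>\<dagger> * U = 1\<^sub>m r" "v \<in> carrier_vec r"
  shows "vnorm (U *\<^sub>v v) = vnorm v"
  using cinner_isometry[OF assms assms(3)] by (simp add: vnorm_def)

text \<open>Operator norm at most one, stated pointwise so that products and adjoints can be treated
  without suprema.\<close>

definition contraction :: "complex mat \<Rightarrow> bool" where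
  "contraction A \<longleftrightarrow> (\<forall>v\<in>carrier_vec (dim_col A). vnorm (A *\<^sub>v v) \<le> vnorm v)"

lemma contractionD: "contraction A \<Longrightarrow> A \<in> carrier_mat m n \<Longrightarrow> v \<in> carrier_vec n \<Longrightarrow> vnorm (A *\<^sub>v v) \<le> vnorm v"
  by (auto simp: contraction_def)

lemma contraction_isometry: "U \<in> carrier_mat n r \<Longrightarrow> U\<^sup>\<dagger> * U = 1\<^sub>m r \<Longrightarrow> contraction U"
  by (auto simp: contraction_def vnorm_isometry)

lemma contraction_mult:
  assumes "contraction A" "contraction B" "A \<in> carrier_mat m n" "B \<in> carrier_mat n p"
  shows "contraction (A * B)"
  unfolding contraction_def
proof
  fix v :: "complex vec" assume "v \<in> carrier_vec (dim_col (A * B))"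
  then have v: "v \<in> carrier_vec p" using assms by auto
  have "vnorm (A * B *\<^sub>v v) = vnorm (A *\<^sub>v (B *\<^sub>v v))"
    using assms v by (simp add: assoc_mult_mat_vec[of _ m n _ p])
  also have "\<dots> \<le> vnorm (B *\<^sub>v v)" using assms v by (intro contractionD[of A m n]) auto
  also have "\<dots> \<le> vnorm v" using assms v by (intro contractionD[of B n p]) auto
  finally show "vnorm (A * B *\<^sub>v v) \<le> vnorm v" .
qed

text \<open>With \<open>w = A\<^sup>\<dagger> *\<^sub>v v\<close>, the squared norm of
  \<open>w\<close> is the inner product of \<open>v\<close> and \<open>A *\<^sub>v w\<close>;
  Cauchy-Schwarz then allows one factor \<open>vnorm w\<close> to be cancelled.\<close>

lemma contraction_adjoint:
  assumes A: "contraction A"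
  shows "contraction (A\<^sup>\<dagger>)"
  unfolding contraction_def
proof
  define m n where "m = dim_row A" and "n = dim_col A"
  then have cA: "A \<in> carrier_mat m n" by auto
  fix v :: "complex vec" assume "v \<in> carrier_vec (dim_col (A\<^sup>\<dagger>))"
  then have v: "v \<in> carrier_vec m" by (simp add: m_def)
  let ?w = "A\<^sup>\<dagger> *\<^sub>v v"
  have w: "?w \<in> carrier_vec n" using cA by simp
  have "(vnorm ?w)\<^sup>2 = cmod (?w \<bullet>c ?w)" unfolding cinner_self[OF w] by (simp add: norm_power)
  also have "?w \<bullet>c ?w = v \<bullet>c (A *\<^sub>v ?w)"
    using cinner_adjoint[of "A\<^sup>\<dagger>" n m v ?w] cA v w by simp
  also have "cmod \<dots> \<le> vnorm v * vnorm (A *\<^sub>v ?w)"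
    using cA v w by (intro cinner_le_vnorm[of _ m]) auto
  also have "\<dots> \<le> vnorm v * vnorm ?w"
    using cA w by (intro mult_left_mono contractionD[OF A]) auto
  finally have "vnorm ?w * vnorm ?w \<le> vnorm v * vnorm ?w" by (simp add: power2_eq_square)
  then show "vnorm ?w \<le> vnorm v" 
    using vnorm_ge_0[of ?w] vnorm_ge_0[of v] by (cases "vnorm ?w = 0") (auto simp: mult_le_cancel_right)
qed

lemma gram_diag_index:
  assumes "A \<in> carrier_mat n r" "i < n"
  shows "(A * A\<^sup>\<dagger>) $$ (i, i) = complex_of_real (\<Sum>k<r. (cmod (A $$ (i, k)))\<^sup>2)"
proof -
  have "(A * A\<^sup>\<dagger>) $$ (i, i) = (\<Sum>k<r. A $$ (i, k) * A\<^sup>\<dagger> $$ (k, i))"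
    using assms by (intro mult_index[of _ n r _ n]) auto
  also have "\<dots> = complex_of_real (\<Sum>k<r. (cmod (A $$ (i, k)))\<^sup>2)"
    unfolding of_real_sum using assms by (intro sum.cong) (auto simp: complex_norm_square[symmetric] simp del: of_real_power)
  finally show ?thesis .
qed

text \<open>\<open>r\<close> is the trace of \<open>U\<^sup>\<dagger> * U\<close>, hence of
  \<open>U * U\<^sup>\<dagger>\<close>, whose \<open>n\<close> diagonal entries are at most one.
  This makes the spectral induction terminate.\<close>

lemma isometry_dim_le:
  assumes U: "U \<in> carrier_mat n r" "U\<^sup>\<dagger> * U = 1\<^sub>m r"
  shows "r \<le> n"
proof -
  have le: "Re ((U * U\<^sup>\<dagger>) $$ (i, i)) \<le> 1" if i: "i < n" for i
  proof -
    have "Re ((U * U\<^sup>\<dagger>) $$ (i, i)) = (vnorm (U\<^sup>\<dagger> *\<^sub>v unit_vec n i))\<^sup>2"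
      unfolding gram_diag_index[OF U(1) i] using U i
      by (subst vnorm_sq[of _ r]) (auto simp: mult_unit_vec_index[of _ r n] simp del: index_mult_mat_vec)
    also have "\<dots> \<le> 1"
      using contractionD[OF contraction_adjoint[OF contraction_isometry[OF U]], of r n "unit_vec n i"] U i
      by (simp add: power_le_one)
    finally show ?thesis .
  qed
  have "real r = Re (mat_trace (U\<^sup>\<dagger> * U))" by (simp add: U(2) mat_trace_def)
  also have "\<dots> = (\<Sum>i<n. Re ((U * U\<^sup>\<dagger>) $$ (i, i)))"
    using U(1) by (subst trace_comm[of _ r n]) (auto simp: trace_index[of _ n] simp del: index_mult_mat(1))
  also have "\<dots> \<le> (\<Sum>i<n. 1)" by (intro sum_mono le) auto
  finally show ?thesis by simp
qed

section \<open>The spectral theorem by splitting off eigenvectors\<close>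

definition append_col :: "complex mat \<Rightarrow> complex vec \<Rightarrow> complex mat" where
  "append_col U v = mat (dim_row U) (Suc (dim_col U)) (\<lambda>(i, j). if j < dim_col U then U $$ (i, j) else v $ i)"

lemma append_col_carrier [simp]: "U \<in> carrier_mat n r \<Longrightarrow> append_col U v \<in> carrier_mat n (Suc r)"
  by (auto simp: append_col_def)

lemma dim_append_col [simp]:
  "dim_row (append_col U v) = dim_row U" "dim_col (append_col U v) = Suc (dim_col U)"
  by (auto simp: append_col_def)

lemma append_col_index:
  "U \<in> carrier_mat n r \<Longrightarrow> i < n \<Longrightarrow> j < Suc r \<Longrightarrow>
    append_col U v $$ (i, j) = (if j < r then U $$ (i, j) else v $ i)"
  by (auto simp: append_col_def)

lemma mult_append_col_index:
  assumes "A \<in> carrier_mat m n" "U \<in> carrier_mat n r" "v \<in> carrier_vec n" "i < m" "j < Suc r"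
  shows "(A * append_col U v) $$ (i, j) = (if j < r then (A * U) $$ (i, j) else (A *\<^sub>v v) $ i)"
proof -
  have "(A * append_col U v) $$ (i, j) = (\<Sum>k<n. A $$ (i, k) * append_col U v $$ (k, j))"
    using assms by (intro mult_index[of _ m n _ "Suc r"]) auto
  then show ?thesis
    using assms by (auto simp: append_col_index mult_index[of A m n U r] mult_vec_index[of A m n v] simp del: index_mult_mat index_mult_mat_vec)
qed

lemma append_col_isometry:
  assumes U: "U \<in> carrier_mat n r" "U\<^sup>\<dagger> * U = 1\<^sub>m r" and v: "v \<in> carrier_vec n" "vnorm v = 1"
    and orth: "U\<^sup>\<dagger> *\<^sub>v v = 0\<^sub>v r"
  shows "(append_col U v)\<^sup>\<dagger> * append_col U v = 1\<^sub>m (Suc r)"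
proof (rule eq_matI)
  let ?W = "append_col U v"
  fix i j assume "i < dim_row (1\<^sub>m (Suc r) :: complex mat)" "j < dim_col (1\<^sub>m (Suc r) :: complex mat)"
  then have ij: "i < Suc r" "j < Suc r" by auto
  have *: "(?W\<^sup>\<dagger> * ?W) $$ (i, j) = (\<Sum>k<n. cnj (?W $$ (k, i)) * ?W $$ (k, j))"
    using U(1) ij by (subst mult_index[of _ "Suc r" n _ "Suc r"]) auto
  have UU: "(\<Sum>k<n. cnj (U $$ (k, i)) * U $$ (k, j)) = (if i = j then 1 else 0)" if "i < r" "j < r" for i j
    using U(1) that arg_cong[OF U(2), of "\<lambda>M. M $$ (i, j)"]
    by (subst (asm) mult_index[of _ r n _ r]) auto
  have Uv: "(\<Sum>k<n. cnj (U $$ (k, i)) * v $ k) = 0" if "i < r" for i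
    using U(1) v that arg_cong[OF orth, of "\<lambda>x. x $ i"]
    by (subst (asm) mult_vec_index[of _ r n]) auto
  have vU: "(\<Sum>k<n. cnj (v $ k) * U $$ (k, i)) = 0" if "i < r" for i
    using arg_cong[OF Uv[OF that], of cnj] by (simp add: mult.commute)
  have vv: "(\<Sum>k<n. cnj (v $ k) * v $ k) = 1"
    using cinner_self[OF v(1)] cinner_index[OF v(1) v(1)] v(2) by (simp add: mult.commute)
  show "(?W\<^sup>\<dagger> * ?W) $$ (i, j) = 1\<^sub>m (Suc r) $$ (i, j)"
  proof (cases "i < r"; cases "j < r")
    assume "i < r" "j < r"
    then show ?thesis unfolding * using U(1) UU[of i j] ij by (simp add: append_col_index)
  next
    assume "i < r" "\<not> j < r"
    then show ?thesis unfolding * using U(1) Uv[of i] ij by (simp add: append_col_index)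
  next
    assume "\<not> i < r" "j < r"
    then show ?thesis unfolding * using U(1) vU[of j] ij by (simp add: append_col_index)
  next
    assume "\<not> i < r" "\<not> j < r"
    then show ?thesis unfolding * using U(1) vv ij by (simp add: append_col_index)
  qed
qed (use U in auto)

text \<open>The columns of \<open>N\<close> are orthonormal kernel vectors already found.
  Subtracting an eigenvalue times its eigenprojection turns the eigenvector into a further kernel
  vector, so \<open>n - s\<close> decreases; the eigenvector is appended to the \<open>U\<close>
  returned by the induction.\<close>

lemma psd_spectral_kernel:
  assumes "psd n A" "N \<in> carrier_mat n s" "N\<^sup>\<dagger> * N = 1\<^sub>m s" "A * N = 0\<^sub>m n s"
  shows "\<exists>r U l. U \<in> carrier_mat n r \<and> U\<^sup>\<dagger> * U = 1\<^sub>m r \<and> (\<forall>k<r. 0 < l k) \<and>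
    A = U * mat_diag r (\<lambda>k. complex_of_real (l k)) * U\<^sup>\<dagger>"
  using assms
proof (induction "n - s" arbitrary: A N s rule: less_induct)
  case less
  note A = less.prems(1) and N = less.prems(2-4)
  note cA = psd_carrier[OF A]
  show ?case
  proof (cases "A = 0\<^sub>m n n")
    case True
    show ?thesis
      by (rule exI[of _ 0], rule exI[of _ "0\<^sub>m n 0"], rule exI[of _ "\<lambda>_. 1"])
        (auto simp: True intro!: eq_matI)
  next
    case False
    then obtain v l0 where v: "v \<in> carrier_vec n" "vnorm v = 1" and l0: "0 < l0"
      and Av: "A *\<^sub>v v = complex_of_real l0 \<cdot>\<^sub>v v"
      using psd_eigenvector[OF A] by metis
    define A' where "A' = A - complex_of_real l0 \<cdot>\<^sub>m proj v"
    have cA': "A' \<in> carrier_mat n n" using cA v by (auto simp: A'_def intro!: minus_carrier_mat)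
    have A'x: "A' *\<^sub>v x = A *\<^sub>v x - (complex_of_real l0 * (x \<bullet>c v)) \<cdot>\<^sub>v v" if x: "x \<in> carrier_vec n" for x
      using cA v x unfolding A'_def
      by (subst minus_mult_distrib_mat_vec[of _ n n])
        (auto simp: proj_mult_vec[OF v(1) x] smult_mat_mult_vec[of _ n n] smult_smult_assoc)
    have vv: "v \<bullet>c v = 1" using cinner_self[OF v(1)] v(2) by simp
    have psd': "psd n A'"
      unfolding psd_def
    proof safe
      fix x :: "complex vec" assume x: "x \<in> carrier_vec n"
      let ?c = "x \<bullet>c v"
      \<comment> \<open>The form of \<open>A'\<close> at \<open>x\<close> is the form of
        \<open>A\<close> at the part of \<open>x\<close> orthogonal to \<open>v\<close>.\<close>
      let ?y = "x - ?c \<cdot>\<^sub>v v"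
      have y: "?y \<in> carrier_vec n" using x v by simp
      have Ax: "A *\<^sub>v x \<in> carrier_vec n" using cA x by simp
      have vx: "v \<bullet>c x = cnj ?c" using cinner_cnj[OF x v(1)] by simp
      have Axv: "(A *\<^sub>v x) \<bullet>c v = complex_of_real l0 * ?c"
        using cinner_adjoint[OF cA x v(1)] x v(1)
        by (simp add: psd_adjoint[OF A] Av cinner_smult_right[of _ n])
      have "A *\<^sub>v ?y = A *\<^sub>v x - (?c * complex_of_real l0) \<cdot>\<^sub>v v"
        using cA x v by (subst mult_minus_distrib_mat_vec[of _ n n]) (auto simp: mult_mat_vec Av smult_smult_assoc)
      then have "(A *\<^sub>v ?y) \<bullet>c ?y = (A *\<^sub>v x - (?c * complex_of_real l0) \<cdot>\<^sub>v v) \<bullet>c ?y" by simp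
      also have "\<dots> = (A *\<^sub>v x) \<bullet>c x - complex_of_real l0 * ?c * cnj ?c"
        using x v Ax y
        by (simp add: cinner_diff_left[of _ n] cinner_diff_right[of _ n] cinner_smult_left[of _ n]
            cinner_smult_right[of _ n] Axv vv vx algebra_simps)
      also have "\<dots> = (A' *\<^sub>v x) \<bullet>c x"
        unfolding A'x[OF x] using x v Ax
        by (simp add: cinner_diff_left[of _ n] cinner_smult_left[of _ n] vx)
      finally show "0 \<le> (A' *\<^sub>v x) \<bullet>c x" using psdD[OF A y] by simp
    qed (rule cA')
    have NA: "N\<^sup>\<dagger> * A = 0\<^sub>m s n"
      using arg_cong[OF N(3), of mat_adjoint] adjoint_mult[OF cA N(1)] psd_adjoint[OF A]
      by (auto intro!: eq_matI)
    \<comment> \<open>Kernel vectors are orthogonal to eigenvectors of a nonzero eigenvalue.\<close>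
    have orth: "N\<^sup>\<dagger> *\<^sub>v v = 0\<^sub>v s"
    proof -
      have "0\<^sub>v s = N\<^sup>\<dagger> *\<^sub>v (A *\<^sub>v v)"
        using N cA v NA by (subst assoc_mult_mat_vec[symmetric, of _ s n _ n]) auto
      also have "\<dots> = complex_of_real l0 \<cdot>\<^sub>v (N\<^sup>\<dagger> *\<^sub>v v)"
        unfolding Av using N v by (intro mult_mat_vec) auto
      finally have *: "complex_of_real l0 \<cdot>\<^sub>v (N\<^sup>\<dagger> *\<^sub>v v) = 0\<^sub>v s" by simp
      show ?thesis
      proof (rule eq_vecI)
        fix i assume "i < dim_vec (0\<^sub>v s :: complex vec)"
        then show "(N\<^sup>\<dagger> *\<^sub>v v) $ i = 0\<^sub>v s $ i"
          using arg_cong[OF *, of "\<lambda>x. x $ i"] l0 N by (simp del: index_mult_mat_vec)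
      qed (use N in auto)
    qed
    let ?N = "append_col N v"
    have N': "?N \<in> carrier_mat n (Suc s)" "?N\<^sup>\<dagger> * ?N = 1\<^sub>m (Suc s)"
      using append_col_isometry[OF N(1,2) v orth] N(1) by auto
    have A'v: "A' *\<^sub>v v = 0\<^sub>v n"
      unfolding A'x[OF v(1)] Av vv using v by auto
    have A'N: "A' * N = 0\<^sub>m n s"
    proof (rule eq_matI)
      fix i j assume "i < dim_row (0\<^sub>m n s :: complex mat)" "j < dim_col (0\<^sub>m n s :: complex mat)"
      then have ij: "i < n" "j < s" by auto
      have "col N j \<bullet>c v = cnj ((N\<^sup>\<dagger> *\<^sub>v v) $ j)"
        using N v ij cinner_index[of "col N j" n v]
        by (subst mult_vec_index[of _ s n]) (auto simp: mult.commute)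
      then have "col N j \<bullet>c v = 0" using orth ij by simp
      then have "A' *\<^sub>v col N j = A *\<^sub>v col N j"
        using N v ij cA by (subst A'x) (auto intro!: eq_vecI)
      also have "\<dots> = col (A * N) j"
        using cA N ij by (intro col_mult2[symmetric]) auto
      also have "\<dots> = 0\<^sub>v n" using N(3) ij by simp
      finally have "col (A' * N) j = 0\<^sub>v n"
        using cA' N ij by (subst col_mult2[of _ n n _ s]) auto
      then have "col (A' * N) j $ i = 0" using ij by simp
      moreover have "col (A' * N) j $ i = (A' * N) $$ (i, j)"
        using cA' N ij by (intro index_col) auto
      ultimately show "(A' * N) $$ (i, j) = 0\<^sub>m n s $$ (i, j)"
        using ij by simp
    qed (use cA' N in auto)
    have A'N': "A' * ?N = 0\<^sub>m n (Suc s)"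
    proof (rule eq_matI)
      fix i j assume "i < dim_row (0\<^sub>m n (Suc s) :: complex mat)" "j < dim_col (0\<^sub>m n (Suc s) :: complex mat)"
      then show "(A' * ?N) $$ (i, j) = 0\<^sub>m n (Suc s) $$ (i, j)"
        by (subst mult_append_col_index[OF cA' N(1) v(1)]) (auto simp: A'N A'v)
    qed (use cA' N' in auto)
    have "n - Suc s < n - s" using isometry_dim_le[OF N'] by simp
    then obtain r U l where U: "U \<in> carrier_mat n r" "U\<^sup>\<dagger> * U = 1\<^sub>m r" and l: "\<forall>k<r. 0 < l k"
      and A'eq: "A' = U * mat_diag r (\<lambda>k. complex_of_real (l k)) * U\<^sup>\<dagger>"
      using less.hyps[OF _ psd' N' A'N'] by blast
    \<comment> \<open>The same argument with the roles exchanged: \<open>v\<close> is in the kernel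
      of \<open>A'\<close>, and all \<open>l k\<close> are positive.\<close>
    have orthU: "U\<^sup>\<dagger> *\<^sub>v v = 0\<^sub>v r"
    proof (rule eq_vecI)
      fix i assume "i < dim_vec (0\<^sub>v r :: complex vec)"
      then have i: "i < r" by simp
      let ?D = "mat_diag r (\<lambda>k. complex_of_real (l k))"
      let ?w = "U\<^sup>\<dagger> *\<^sub>v v"
      have w: "?w \<in> carrier_vec r" using U by simp
      have Dw: "?D *\<^sub>v ?w \<in> carrier_vec r" by (rule mult_mat_vec_carrier[OF _ w]) simp
      have "0\<^sub>v r = U\<^sup>\<dagger> *\<^sub>v (A' *\<^sub>v v)" using A'v U by auto
      also have "A' *\<^sub>v v = U *\<^sub>v (?D *\<^sub>v ?w)"
        unfolding A'eq using U v
        by (simp add: assoc_mult_mat_vec[of _ n r _ n] assoc_mult_mat_vec[of _ n r _ r])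
      also have "U\<^sup>\<dagger> *\<^sub>v \<dots> = ?D *\<^sub>v ?w"
        using U w Dw by (subst assoc_mult_mat_vec[symmetric, of _ r n _ r]) (auto simp del: assoc_mult_mat_vec)
      finally have "(?D *\<^sub>v ?w) $ i = 0\<^sub>v r $ i" by simp
      then have "(?D *\<^sub>v ?w) $ i = 0" using i by simp
      moreover have "(?D *\<^sub>v ?w) $ i = complex_of_real (l i) * ?w $ i"
        using i w by (subst mult_vec_index[of _ r r])
          (auto simp: mat_diag_def if_distrib[of "\<lambda>x. x * _"] sum.delta' simp del: index_mult_mat_vec cong: if_cong)
      ultimately show "?w $ i = 0\<^sub>v r $ i" using l i by auto
    qed (use U in auto)
    let ?U = "append_col U v"
    let ?l = "\<lambda>k. if k < r then l k else l0"
    have cU: "?U \<in> carrier_mat n (Suc r)" using U by simp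
    have "A = ?U * mat_diag (Suc r) (\<lambda>k. complex_of_real (?l k)) * ?U\<^sup>\<dagger>"
    proof (rule eq_matI)
      fix i j assume "i < dim_row (?U * mat_diag (Suc r) (\<lambda>k. complex_of_real (?l k)) * ?U\<^sup>\<dagger>)"
        "j < dim_col (?U * mat_diag (Suc r) (\<lambda>k. complex_of_real (?l k)) * ?U\<^sup>\<dagger>)"
      then have ij: "i < n" "j < n" using U by (auto simp: append_col_def)
      have "A $$ (i, j) = A' $$ (i, j) + complex_of_real l0 * v $ i * cnj (v $ j)"
        using ij cA v by (auto simp: A'_def proj_def)
      also have "\<dots> = (\<Sum>k<Suc r. ?U $$ (i, k) * complex_of_real (?l k) * cnj (?U $$ (j, k)))"
        unfolding A'eq mat_diag_form_index[OF U(1) ij] using ij U(1) by (simp add: append_col_index)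
      finally show "A $$ (i, j) = (?U * mat_diag (Suc r) (\<lambda>k. complex_of_real (?l k)) * ?U\<^sup>\<dagger>) $$ (i, j)"
        unfolding mat_diag_form_index[OF cU ij] .
    qed (use cA U in \<open>auto simp: append_col_def\<close>)
    then show ?thesis
      using append_col_isometry[OF U v orthU] cU l l0
      by (intro exI[of _ "Suc r"] exI[of _ ?U] exI[of _ ?l] conjI) auto
  qed
qed

text \<open>The induction starts from an empty family of kernel vectors. Only positive eigenvalues
  are listed, so \<open>U\<close> is an isometry onto the range of \<open>A\<close>.\<close>

theorem psd_spectral:
  assumes "psd n A"
  obtains r U l where "U \<in> carrier_mat n r" "U\<^sup>\<dagger> * U = 1\<^sub>m r" "\<And>k. k < r \<Longrightarrow> 0 < l k"
    "A = U * mat_diag r (\<lambda>k. complex_of_real (l k)) * U\<^sup>\<dagger>"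
proof -
  have "A * 0\<^sub>m n 0 = 0\<^sub>m n 0" "(0\<^sub>m n 0)\<^sup>\<dagger> * 0\<^sub>m n 0 = (1\<^sub>m 0 :: complex mat)"
    using psd_carrier[OF assms] by (auto intro!: eq_matI)
  from psd_spectral_kernel[OF assms _ this(2,1)] that show thesis by auto
qed

subsection \<open>Square roots, polar decomposition and fidelity\<close>

lemma assoc_mult_mat_dim:
  "dim_col A = dim_row B \<Longrightarrow> dim_col B = dim_row C \<Longrightarrow> (A * B) * C = A * (B * (C :: complex mat))"
  by (rule assoc_mult_mat[of _ "dim_row A" "dim_col A" _ "dim_col B" _ "dim_col C"]) auto

lemma dim_mat_diag [simp]: "dim_row (mat_diag n f) = n" "dim_col (mat_diag n f) = n"
  by (auto simp: mat_diag_def)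

lemma isometry_cancel:
  assumes "U\<^sup>\<dagger> * U = 1\<^sub>m r" "dim_row Z = dim_col U"
  shows "U\<^sup>\<dagger> * (U * Z) = Z"
proof -
  have "r = dim_col U" using arg_cong[OF assms(1), of dim_row] by simp
  then show ?thesis
    using assms by (simp add: assoc_mult_mat_dim[symmetric])
qed

lemma eq_mat_if_mult_vec_eq:
  assumes "A \<in> carrier_mat m n" "B \<in> carrier_mat m n"
    and "\<And>v. v \<in> carrier_vec n \<Longrightarrow> A *\<^sub>v v = (B *\<^sub>v v :: complex vec)"
  shows "A = B"
proof (rule eq_matI)
  fix i j assume "i < dim_row B" "j < dim_col B"
  then have ij: "i < m" "j < n" using assms by auto
  have "(A *\<^sub>v unit_vec n j) $ i = (B *\<^sub>v unit_vec n j) $ i" using assms(3) by simp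
  then show "A $$ (i, j) = B $$ (i, j)"
    using assms(1,2) ij by (simp add: mult_unit_vec_index[of _ m n] del: index_mult_mat_vec)
qed (use assms in auto)

text \<open>Functional calculus on the range of \<open>U\<close>: the constant function 1 gives the
  range projection, and inverse square roots make sense because only positive eigenvalues are
  listed.\<close>

definition spectral_mat :: "complex mat \<Rightarrow> (nat \<Rightarrow> real) \<Rightarrow> complex mat" where
  "spectral_mat U f = U * mat_diag (dim_col U) (\<lambda>k. complex_of_real (f k)) * U\<^sup>\<dagger>"

lemma spectral_mat_carrier [simp]: "U \<in> carrier_mat n r \<Longrightarrow> spectral_mat U f \<in> carrier_mat n n"
  by (auto simp: spectral_mat_def intro!: carrier_matI)

lemma mat_diag_adjoint: "(mat_diag r (\<lambda>k. complex_of_real (f k)))\<^sup>\<dagger> = mat_diag r (\<lambda>k. complex_of_real (f k))"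
  by (rule eq_matI) (auto simp: mat_diag_def)

lemma spectral_mat_mult:
  assumes U: "U \<in> carrier_mat n r" "U\<^sup>\<dagger> * U = 1\<^sub>m r"
  shows "spectral_mat U f * spectral_mat U g = spectral_mat U (\<lambda>k. f k * g k)"
proof -
  note d = carrier_matD[OF U(1)]
  have "spectral_mat U f * spectral_mat U g =
      U * (mat_diag r (\<lambda>k. complex_of_real (f k)) * mat_diag r (\<lambda>k. complex_of_real (g k)) * U\<^sup>\<dagger>)"
    by (simp add: spectral_mat_def assoc_mult_mat_dim isometry_cancel[OF U(2)] d del: mat_diag_diag)
  then show ?thesis by (simp add: spectral_mat_def assoc_mult_mat_dim d)
qed

lemma spectral_mat_psd:
  assumes U: "U \<in> carrier_mat n r" and f: "\<And>k. k < r \<Longrightarrow> 0 \<le> f k"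
  shows "psd n (spectral_mat U f)"
proof -
  let ?D = "mat_diag r (\<lambda>k. complex_of_real (sqrt (f k)))"
  have "(U * ?D) * (U * ?D)\<^sup>\<dagger> = U * (?D * ?D) * U\<^sup>\<dagger>"
    using U by (simp add: adjoint_mult[of _ n r _ r] mat_diag_adjoint assoc_mult_mat_dim carrier_matD[OF U]
        del: mat_diag_diag)
  also have "?D * ?D = mat_diag r (\<lambda>k. complex_of_real (f k))"
    unfolding mat_diag_diag using f by (auto simp: mat_diag_def intro!: eq_matI simp flip: of_real_mult)
  finally show ?thesis
    using psd_gram[of "U * ?D" n r] U by (simp add: spectral_mat_def mult_carrier_mat[of _ n r])
qed

lemma spectral_mat_trace:
  assumes U: "U \<in> carrier_mat n r" "U\<^sup>\<dagger> * U = 1\<^sub>m r"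
  shows "mat_trace (spectral_mat U f) = complex_of_real (\<Sum>k<r. f k)"
proof -
  let ?D = "mat_diag r (\<lambda>k. complex_of_real (f k))"
  have "mat_trace (spectral_mat U f) = mat_trace (U\<^sup>\<dagger> * (U * ?D))"
    using U(1) by (subst trace_comm[of _ r n]) (auto simp: spectral_mat_def intro: mult_carrier_mat)
  also have "U\<^sup>\<dagger> * (U * ?D) = ?D"
    using U by (simp add: isometry_cancel[OF U(2)])
  finally show ?thesis by (simp add: mat_trace_def mat_diag_def)
qed

lemma psd_spectral_mat:
  assumes "psd n A"
  obtains r U l where "U \<in> carrier_mat n r" "U\<^sup>\<dagger> * U = 1\<^sub>m r" "\<And>k. k < r \<Longrightarrow> 0 < l k"
    "A = spectral_mat U l"
  using psd_spectral[OF assms] unfolding spectral_mat_def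
  by (metis carrier_matD(2))

lemma spectral_mat_cong:
  "U \<in> carrier_mat n r \<Longrightarrow> (\<And>k. k < r \<Longrightarrow> f k = g k) \<Longrightarrow> spectral_mat U f = spectral_mat U g"
  unfolding spectral_mat_def by (auto simp: mat_diag_def intro!: arg_cong2[of _ _ _ _ "(*)"] eq_matI)

lemma spectral_mat_one: "U \<in> carrier_mat n r \<Longrightarrow> spectral_mat U (\<lambda>_. 1) = U * U\<^sup>\<dagger>"
  by (simp add: spectral_mat_def mat_diag_one)

text \<open>\<open>X\<close> and its Gram matrix have the same kernel: the part \<open>y\<close> of
  a vector outside the range of \<open>U\<close> is annihilated by
  \<open>X\<^sup>\<dagger> * X\<close>, so \<open>X *\<^sub>v y\<close> has norm zero.\<close>

lemma mult_range_proj: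
  assumes U: "U \<in> carrier_mat n r" "U\<^sup>\<dagger> * U = 1\<^sub>m r" and X: "X \<in> carrier_mat m n"
    and gram: "X\<^sup>\<dagger> * X = spectral_mat U l"
  shows "X * spectral_mat U (\<lambda>_. 1) = X"
proof (rule eq_mat_if_mult_vec_eq)
  let ?P = "spectral_mat U (\<lambda>_. 1)"
  note P = spectral_mat_carrier[OF U(1)]
  fix v :: "complex vec" assume v: "v \<in> carrier_vec n"
  define y where "y = v - ?P *\<^sub>v v"
  have Pv: "?P *\<^sub>v v \<in> carrier_vec n" using P v by (rule mult_mat_vec_carrier)
  then have y: "y \<in> carrier_vec n" using v by (simp add: y_def)
  have "spectral_mat U l *\<^sub>v (?P *\<^sub>v v) = spectral_mat U l *\<^sub>v v"
    using P v by (subst assoc_mult_mat_vec[symmetric, of _ n n _ n]) (auto simp: spectral_mat_mult[OF U])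
  then have "spectral_mat U l *\<^sub>v y = 0\<^sub>v n"
    unfolding y_def using P[of l] v Pv
    by (subst mult_minus_distrib_mat_vec[of _ n n]) (auto intro!: mult_mat_vec_carrier[of _ n n])
  moreover have "(X *\<^sub>v y) \<bullet>c (X *\<^sub>v y) = y \<bullet>c (spectral_mat U l *\<^sub>v y)"
    unfolding gram[symmetric] using X y
    by (subst cinner_adjoint[of _ m n]) (auto simp: assoc_mult_mat_vec[of _ n m _ n])
  ultimately have "vnorm (X *\<^sub>v y) = 0" using y by (simp add: vnorm_def)
  then have "X *\<^sub>v y = 0\<^sub>v m" using vnorm_eq_0[of "X *\<^sub>v y" m] X y by auto
  then have eq: "X *\<^sub>v v - X *\<^sub>v (?P *\<^sub>v v) = 0\<^sub>v m"
    unfolding y_def using X v Pv by (subst (asm) mult_minus_distrib_mat_vec[of _ m n]) auto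
  have "X *\<^sub>v v = X *\<^sub>v (?P *\<^sub>v v)"
  proof (rule eq_vecI)
    fix i assume "i < dim_vec (X *\<^sub>v (?P *\<^sub>v v))"
    then show "(X *\<^sub>v v) $ i = (X *\<^sub>v (?P *\<^sub>v v)) $ i"
      using arg_cong[OF eq, of "\<lambda>x. x $ i"] X by (simp del: index_mult_mat_vec)
  qed (use X in auto)
  then show "X * ?P *\<^sub>v v = X *\<^sub>v v"
    using X P v by (simp add: assoc_mult_mat_vec[of _ m n _ n])
qed (use X U in \<open>auto intro!: mult_carrier_mat\<close>)

text \<open>On the columns of \<open>U\<close> positivity decides the sign of the root; on the
  complement \<open>C\<close> vanishes, because its square does.\<close>

lemma psd_sqrt_unique:
  assumes U: "U \<in> carrier_mat n r" "U\<^sup>\<dagger> * U = 1\<^sub>m r" and l: "\<And>k. k < r \<Longrightarrow> 0 < l k"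
    and C: "psd n C" "C * C = spectral_mat U l"
  shows "C = spectral_mat U (\<lambda>k. sqrt (l k))"
proof -
  note cC = psd_carrier[OF C(1)]
  let ?S = "spectral_mat U"
  let ?D = "mat_diag r (\<lambda>k. complex_of_real (sqrt (l k)))"
  have CU: "C *\<^sub>v col U k = complex_of_real (sqrt (l k)) \<cdot>\<^sub>v col U k" if k: "k < r" for k
  proof -
    let ?u = "col U k" and ?b = "complex_of_real (sqrt (l k))"
    have u: "?u \<in> carrier_vec n" using U(1) k by auto
    have Cu: "C *\<^sub>v ?u \<in> carrier_vec n" using cC u by auto
    \<comment> \<open>The defect \<open>w\<close> satisfies
      \<open>C *\<^sub>v w = (- ?b) \<cdot>\<^sub>v w\<close>, so a positive semidefinite
      \<open>C\<close> forces it to be zero.\<close>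
    define w where "w = C *\<^sub>v ?u - ?b \<cdot>\<^sub>v ?u"
    have w: "w \<in> carrier_vec n" using Cu u by (simp add: w_def)
    have SU: "?S l * U = U * mat_diag r (\<lambda>k. complex_of_real (l k))"
      using U by (simp add: spectral_mat_def assoc_mult_mat_dim carrier_matD[OF U(1)])
    have "C *\<^sub>v (C *\<^sub>v ?u) = ?S l *\<^sub>v ?u"
      using cC u by (simp add: C(2)[symmetric] assoc_mult_mat_vec[of _ n n _ n])
    also have "\<dots> = col (?S l * U) k"
      using U k by (intro col_mult2[symmetric, of _ n n _ r]) auto
    also have "\<dots> = complex_of_real (l k) \<cdot>\<^sub>v ?u"
      unfolding SU using U k by (intro eq_vecI) (auto simp: mat_diag_mult_right[of _ n])
    also have "complex_of_real (l k) = ?b * ?b" using l[OF k] by (simp flip: of_real_mult)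
    finally have CCu: "C *\<^sub>v (C *\<^sub>v ?u) = (?b * ?b) \<cdot>\<^sub>v ?u" .
    have "C *\<^sub>v w = C *\<^sub>v (C *\<^sub>v ?u) - ?b \<cdot>\<^sub>v (C *\<^sub>v ?u)"
      unfolding w_def using cC u Cu by (subst mult_minus_distrib_mat_vec[of _ n n]) (auto simp: mult_mat_vec)
    also have "\<dots> = (- ?b) \<cdot>\<^sub>v w"
      unfolding CCu w_def using u Cu carrier_matD[OF cC] carrier_matD[OF U(1)]
      by (intro eq_vecI) (auto simp: right_diff_distrib simp del: index_mult_mat_vec)
    finally have "(C *\<^sub>v w) \<bullet>c w = - ?b * (w \<bullet>c w)" using w by (simp add: cinner_smult_left[of _ n])
    then have "0 \<le> - (sqrt (l k) * (vnorm w)\<^sup>2)"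
      using psdD[OF C(1) w] cinner_self[OF w] by (simp add: less_eq_complex_def)
    then have "vnorm w = 0" using l[OF k] by (auto simp: mult_le_0_iff)
    then have w0: "C *\<^sub>v ?u - ?b \<cdot>\<^sub>v ?u = 0\<^sub>v n" using vnorm_eq_0[OF w] by (simp add: w_def)
    show ?thesis
    proof (rule eq_vecI)
      fix i assume "i < dim_vec (?b \<cdot>\<^sub>v ?u)"
      then show "(C *\<^sub>v ?u) $ i = (?b \<cdot>\<^sub>v ?u) $ i"
        using arg_cong[OF w0, of "\<lambda>x. x $ i"] U(1) cC by (simp del: index_mult_mat_vec)
    qed (use U cC in auto)
  qed
  have "C * U = U * ?D"
  proof (rule eq_matI)
    fix i k assume "i < dim_row (U * ?D)" "k < dim_col (U * ?D)"
    then have ik: "i < n" "k < r" using U(1) by auto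
    have "(C * U) $$ (i, k) = (C *\<^sub>v col U k) $ i" using cC U ik by simp
    also have "\<dots> = (U * ?D) $$ (i, k)"
      using U(1) ik by (simp add: CU mat_diag_mult_right[of _ n] del: index_mult_mat_vec)
    finally show "(C * U) $$ (i, k) = (U * ?D) $$ (i, k)" .
  qed (use U cC in auto)
  then have "C * U * U\<^sup>\<dagger> = U * ?D * U\<^sup>\<dagger>" by simp
  then have "C * ?S (\<lambda>_. 1) = ?S (\<lambda>k. sqrt (l k))"
    unfolding spectral_mat_one[OF U(1)] using carrier_matD[OF U(1)] carrier_matD[OF cC]
    by (simp add: spectral_mat_def assoc_mult_mat_dim)
  moreover have "C\<^sup>\<dagger> * C = ?S l" using C psd_adjoint[OF C(1)] by simp
  ultimately show ?thesis using mult_range_proj[OF U cC] by simp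
qed

lemma mat_sqrt_spectral_mat:
  assumes U: "U \<in> carrier_mat n r" "U\<^sup>\<dagger> * U = 1\<^sub>m r" and l: "\<And>k. k < r \<Longrightarrow> 0 < l k"
  shows "mat_sqrt (spectral_mat U l) = spectral_mat U (\<lambda>k. sqrt (l k))"
proof -
  have d: "dim_row (spectral_mat U l) = n" using U(1) by (simp add: spectral_mat_def)
  show ?thesis
    unfolding mat_sqrt_def d
  proof (rule the_equality)
    have "psd n (spectral_mat U (\<lambda>k. sqrt (l k)))"
      using U(1) by (rule spectral_mat_psd) (simp add: l less_imp_le)
    moreover have "spectral_mat U (\<lambda>k. sqrt (l k)) * spectral_mat U (\<lambda>k. sqrt (l k)) = spectral_mat U l"
      unfolding spectral_mat_mult[OF U] using U(1)
      by (rule spectral_mat_cong) (simp add: l less_imp_le)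
    ultimately show "psd n (spectral_mat U (\<lambda>k. sqrt (l k))) \<and>
        spectral_mat U (\<lambda>k. sqrt (l k)) * spectral_mat U (\<lambda>k. sqrt (l k)) = spectral_mat U l" by blast
  qed (use psd_sqrt_unique[OF U l] in auto)
qed

lemma mat_sqrt_psd:
  assumes "psd n A"
  shows "psd n (mat_sqrt A)" and "mat_sqrt A * mat_sqrt A = A"
proof -
  obtain r U l where U: "U \<in> carrier_mat n r" "U\<^sup>\<dagger> * U = 1\<^sub>m r" and l: "\<And>k. k < r \<Longrightarrow> 0 < l k"
    and A: "A = spectral_mat U l"
    using psd_spectral_mat[OF assms] by metis
  have sq: "mat_sqrt A = spectral_mat U (\<lambda>k. sqrt (l k))"
    unfolding A by (rule mat_sqrt_spectral_mat[OF U]) (rule l)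
  show "psd n (mat_sqrt A)"
    unfolding sq using U(1) by (rule spectral_mat_psd) (simp add: l less_imp_le)
  have "mat_sqrt A * mat_sqrt A = spectral_mat U (\<lambda>k. sqrt (l k) * sqrt (l k))"
    unfolding sq by (rule spectral_mat_mult[OF U])
  also have "\<dots> = A"
    unfolding A using U(1) by (rule spectral_mat_cong) (simp add: l less_imp_le)
  finally show "mat_sqrt A * mat_sqrt A = A" .
qed

lemma psd_gram_exists:
  assumes "psd n A"
  obtains r E where "E \<in> carrier_mat n r" "A = E * E\<^sup>\<dagger>"
  using mat_sqrt_psd[OF assms] psd_adjoint[of n "mat_sqrt A"] psd_carrier[of n "mat_sqrt A"] by metis

text \<open>\<open>V\<close> is \<open>X\<close> times the inverse square root of its Gram matrix on
  the range. Then \<open>V\<^sup>\<dagger> * V\<close> is the range projection, which makes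
  \<open>V\<close> a partial isometry, also for rectangular \<open>X\<close>.\<close>

lemma polar_decomposition:
  assumes X: "X \<in> carrier_mat m n"
  obtains V where "V \<in> carrier_mat m n" "contraction V"
    "X = V * mat_sqrt (X\<^sup>\<dagger> * X)" "V\<^sup>\<dagger> * X = mat_sqrt (X\<^sup>\<dagger> * X)"
proof -
  have "psd n (X\<^sup>\<dagger> * X)" using psd_gram[of "X\<^sup>\<dagger>" n m] X by simp
  then obtain r U l where U: "U \<in> carrier_mat n r" "U\<^sup>\<dagger> * U = 1\<^sub>m r" and l: "\<And>k. k < r \<Longrightarrow> 0 < l k"
    and gram: "X\<^sup>\<dagger> * X = spectral_mat U l"
    using psd_spectral_mat by metis
  have sq: "mat_sqrt (X\<^sup>\<dagger> * X) = spectral_mat U (\<lambda>k. sqrt (l k))"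
    unfolding gram by (rule mat_sqrt_spectral_mat[OF U]) (rule l)
  let ?R = "spectral_mat U (\<lambda>k. 1 / sqrt (l k))"
  let ?P = "spectral_mat U (\<lambda>_. 1)"
  note S = spectral_mat_carrier[OF U(1)]
  have Radj: "?R\<^sup>\<dagger> = ?R"
    using U(1) by (intro psd_adjoint[of n] spectral_mat_psd) (auto simp: l less_imp_le)
  define V where "V = X * ?R"
  have V: "V \<in> carrier_mat m n" using X S by (auto simp: V_def)
  have Vadj: "V\<^sup>\<dagger> = ?R * X\<^sup>\<dagger>" unfolding V_def using adjoint_mult[OF X S] Radj by simp
  have "V * mat_sqrt (X\<^sup>\<dagger> * X) = X * (?R * spectral_mat U (\<lambda>k. sqrt (l k)))"
    unfolding sq V_def using X S by (intro assoc_mult_mat) auto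
  also have "?R * spectral_mat U (\<lambda>k. sqrt (l k)) = ?P"
    unfolding spectral_mat_mult[OF U] using U(1) by (rule spectral_mat_cong) (use l in force)
  finally have 1: "X = V * mat_sqrt (X\<^sup>\<dagger> * X)" using mult_range_proj[OF U X gram] by simp
  have "V\<^sup>\<dagger> * X = ?R * (X\<^sup>\<dagger> * X)"
    unfolding Vadj using X S by (intro assoc_mult_mat[of _ n n _ m]) auto
  also have "\<dots> = mat_sqrt (X\<^sup>\<dagger> * X)"
    unfolding sq unfolding gram spectral_mat_mult[OF U] using U(1)
  proof (rule spectral_mat_cong)
    fix k assume "k < r"
    then show "1 / sqrt (l k) * l k = sqrt (l k)" using l[of k] by (simp add: real_div_sqrt)
  qed
  finally have 2: "V\<^sup>\<dagger> * X = mat_sqrt (X\<^sup>\<dagger> * X)" .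
  have "V\<^sup>\<dagger> * V = mat_sqrt (X\<^sup>\<dagger> * X) * ?R"
    unfolding 2[symmetric] V_def[symmetric] using V X S
    by (subst assoc_mult_mat[of _ n m _ n _ n]) (auto simp: V_def)
  also have "\<dots> = ?P"
    unfolding sq spectral_mat_mult[OF U] using U(1) by (rule spectral_mat_cong) (use l in force)
  finally have VV: "V\<^sup>\<dagger> * V = U * U\<^sup>\<dagger>" using spectral_mat_one[OF U(1)] by simp
  have "contraction V"
    unfolding contraction_def
  proof
    fix v :: "complex vec" assume "v \<in> carrier_vec (dim_col V)"
    then have v: "v \<in> carrier_vec n" using V by simp
    have "(V *\<^sub>v v) \<bullet>c (V *\<^sub>v v) = v \<bullet>c (V\<^sup>\<dagger> * V *\<^sub>v v)"
      using V v by (subst cinner_adjoint[of _ m n]) (auto simp: assoc_mult_mat_vec[of _ n m _ n])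
    also have "\<dots> = v \<bullet>c ((U\<^sup>\<dagger>)\<^sup>\<dagger> *\<^sub>v (U\<^sup>\<dagger> *\<^sub>v v))"
      using U v by (simp add: VV assoc_mult_mat_vec[of _ n r _ n])
    also have "\<dots> = (U\<^sup>\<dagger> *\<^sub>v v) \<bullet>c (U\<^sup>\<dagger> *\<^sub>v v)"
      using U v by (intro cinner_adjoint[symmetric, of _ r n]) auto
    finally have "vnorm (V *\<^sub>v v) = vnorm (U\<^sup>\<dagger> *\<^sub>v v)" by (simp add: vnorm_def)
    also have "\<dots> \<le> vnorm v"
      using U v by (intro contractionD[OF contraction_adjoint[OF contraction_isometry[OF U]], of r n]) auto
    finally show "vnorm (V *\<^sub>v v) \<le> vnorm v" .
  qed
  from that[OF V this 1 2] show thesis .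
qed

lemma contraction_diag_le_1:
  assumes "contraction T" "T \<in> carrier_mat n n" "i < n"
  shows "cmod (T $$ (i, i)) \<le> 1"
proof -
  have "T $$ (i, i) = (T *\<^sub>v unit_vec n i) \<bullet>c unit_vec n i"
    using assms by (subst cinner_unit[of _ n]) (auto simp: mult_unit_vec_index[of _ n n] simp del: index_mult_mat_vec)
  also have "cmod \<dots> \<le> vnorm (T *\<^sub>v unit_vec n i) * vnorm (unit_vec n i)"
    using assms by (intro cinner_le_vnorm[of _ n]) auto
  also have "\<dots> \<le> 1" using contractionD[OF assms(1,2), of "unit_vec n i"] assms by simp
  finally show ?thesis .
qed

text \<open>In an eigenbasis of \<open>S\<close> the trace is a sum of eigenvalues weighted by
  diagonal entries of a contraction.\<close>

lemma trace_contraction_psd_le: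
  assumes T: "contraction T" "T \<in> carrier_mat n n" and S: "psd n S"
  shows "cmod (mat_trace (T * S)) \<le> Re (mat_trace S)"
proof -
  obtain r U l where U: "U \<in> carrier_mat n r" "U\<^sup>\<dagger> * U = 1\<^sub>m r" and l: "\<And>k. k < r \<Longrightarrow> 0 < l k"
    and S: "S = spectral_mat U l"
    using psd_spectral_mat[OF S] by metis
  let ?D = "mat_diag r (\<lambda>k. complex_of_real (l k))"
  let ?M = "U\<^sup>\<dagger> * (T * U)"
  have M: "?M \<in> carrier_mat r r" using U T by auto
  have UD: "U * ?D \<in> carrier_mat n r" using U(1) by (auto intro: mult_carrier_mat)
  have "contraction ?M"
    using contraction_isometry[OF U] U T
    by (intro contraction_mult[of _ _ r n r] contraction_mult[of T U n n r] contraction_adjoint) auto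
  then have diag: "cmod (?M $$ (k, k)) \<le> 1" if "k < r" for k using contraction_diag_le_1 M that by blast
  have "T * S = T * (U * ?D) * U\<^sup>\<dagger>"
    unfolding S spectral_mat_def using U T UD by (simp add: assoc_mult_mat[of _ n n _ r _ n])
  then have "mat_trace (T * S) = mat_trace (U\<^sup>\<dagger> * (T * (U * ?D)))"
    using U T UD by (simp add: trace_comm[of _ n r])
  also have "U\<^sup>\<dagger> * (T * (U * ?D)) = ?M * ?D"
    using U T UD by (simp add: assoc_mult_mat[of _ n n _ r _ r, symmetric] assoc_mult_mat[of _ r n _ r _ r])
  also have "mat_trace \<dots> = (\<Sum>k<r. ?M $$ (k, k) * complex_of_real (l k))"
    using M by (subst trace_index[of _ r]) (auto simp: mat_diag_mult_right[of _ r] simp del: index_mult_mat(1) intro!: sum.cong)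
  also have "cmod \<dots> \<le> (\<Sum>k<r. l k)"
  proof (rule sum_norm_le)
    fix k assume "k \<in> {..<r}"
    then show "cmod (?M $$ (k, k) * complex_of_real (l k)) \<le> l k"
      using diag[of k] l[of k] by (simp add: norm_mult mult_left_le_one_le del: index_mult_mat(1))
  qed
  also have "\<dots> = Re (mat_trace S)" unfolding S spectral_mat_trace[OF U] by simp
  finally show ?thesis .
qed

text \<open>Uhlmann's theorem, with purifications written as factors \<open>A A\<^sup>\<dagger>\<close>.\<close>

lemma trace_le_trace_norm_sqrt:
  assumes A: "A \<in> carrier_mat d N" and B: "B \<in> carrier_mat d N"
  shows "cmod (mat_trace (B\<^sup>\<dagger> * A)) \<le> trace_norm (mat_sqrt (A * A\<^sup>\<dagger>) * mat_sqrt (B * B\<^sup>\<dagger>))"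
proof -
  define R S where "R = mat_sqrt (A * A\<^sup>\<dagger>)" and "S = mat_sqrt (B * B\<^sup>\<dagger>)"
  have R: "psd d R" and S: "psd d S"
    using A B unfolding R_def S_def by (auto intro: mat_sqrt_psd psd_gram)
  note cR = psd_carrier[OF R] and cS = psd_carrier[OF S]
  obtain V where V: "V \<in> carrier_mat N d" "contraction V" "A\<^sup>\<dagger> = V * R"
    using polar_decomposition[of "A\<^sup>\<dagger>" N d] A unfolding R_def by (metis adjoint_adjoint adjoint_carrier)
  obtain W where W: "W \<in> carrier_mat N d" "contraction W" "B\<^sup>\<dagger> = W * S"
    using polar_decomposition[of "B\<^sup>\<dagger>" N d] B unfolding S_def by (metis adjoint_adjoint adjoint_carrier)
  define X where "X = R * S"
  have X: "X \<in> carrier_mat d d" using cR cS by (auto simp: X_def)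
  define H where "H = mat_sqrt (X\<^sup>\<dagger> * X)"
  have "psd d (X\<^sup>\<dagger> * X)" using psd_gram[of "X\<^sup>\<dagger>" d d] X by simp
  then have H: "psd d H" unfolding H_def by (rule mat_sqrt_psd)
  note cH = psd_carrier[OF H]
  obtain Y where Y: "Y \<in> carrier_mat d d" "contraction Y" "X = Y * H"
    using polar_decomposition[OF X] unfolding H_def by metis
  have A': "A = R * V\<^sup>\<dagger>"
    using adjoint_mult[OF V(1) cR] V(3) psd_adjoint[OF R] by (metis adjoint_adjoint)
  have SR: "S * R = H * Y\<^sup>\<dagger>"
    using adjoint_mult[OF cR cS] adjoint_mult[OF Y(1) cH] Y(3) psd_adjoint[OF R] psd_adjoint[OF S]
      psd_adjoint[OF H] by (metis X_def)
  \<comment> \<open>Cyclicity collects the three polar factors into one contraction in front of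
    \<open>H\<close>, the modulus of \<open>R * S\<close>, whose trace is the trace norm.\<close>
  have "mat_trace (B\<^sup>\<dagger> * A) = mat_trace (A * B\<^sup>\<dagger>)"
    using A B by (intro trace_comm[of _ N d]) auto
  also have "A * B\<^sup>\<dagger> = R * (V\<^sup>\<dagger> * W * S)"
    unfolding W(3) using V W cR cS A'
    by (simp add: assoc_mult_mat[of _ d d _ N _ d] assoc_mult_mat[of _ d N _ d _ d])
  also have "mat_trace \<dots> = mat_trace (V\<^sup>\<dagger> * W * S * R)"
    using V W cR cS by (intro trace_comm[of _ d d]) auto
  also have "V\<^sup>\<dagger> * W * S * R = V\<^sup>\<dagger> * W * H * Y\<^sup>\<dagger>"
    using carrier_matD[OF V(1)] carrier_matD[OF W(1)] carrier_matD[OF cR] carrier_matD[OF cS]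
      carrier_matD[OF cH] carrier_matD[OF Y(1)]
    by (simp add: assoc_mult_mat_dim SR)
  also have "mat_trace \<dots> = mat_trace (Y\<^sup>\<dagger> * (V\<^sup>\<dagger> * W * H))"
    using V W cH Y by (intro trace_comm[of _ d d]) auto
  also have "Y\<^sup>\<dagger> * (V\<^sup>\<dagger> * W * H) = (Y\<^sup>\<dagger> * (V\<^sup>\<dagger> * W)) * H"
    using V W cH Y by (intro assoc_mult_mat[symmetric, of _ d d _ d _ d]) auto
  also have "cmod (mat_trace \<dots>) \<le> Re (mat_trace H)"
    using V W Y H
    by (intro trace_contraction_psd_le[of _ d] contraction_mult[of _ _ d d d]
        contraction_mult[of "V\<^sup>\<dagger>" W d N d] contraction_adjoint) auto
  finally show ?thesis by (simp add: trace_norm_def X_def H_def R_def S_def)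
qed

text \<open>The choice \<open>A = R * T\<close>, with \<open>T\<close> composed of the polar factors
  of \<open>R * S\<close> and of \<open>B\<^sup>\<dagger>\<close>, cancels all phases in the trace.
  As \<open>T\<close> is only a contraction, \<open>A * A\<^sup>\<dagger>\<close> lies below
  \<open>\<rho>\<close>, and the positive difference is factored as
  \<open>E * E\<^sup>\<dagger>\<close>.\<close>

lemma trace_norm_sqrt_attained:
  assumes \<rho>: "psd d \<rho>" and B: "B \<in> carrier_mat d N"
  obtains A r E where "A \<in> carrier_mat d N" "E \<in> carrier_mat d r" "\<rho> = A * A\<^sup>\<dagger> + E * E\<^sup>\<dagger>"
    "mat_trace (B\<^sup>\<dagger> * A) = complex_of_real (trace_norm (mat_sqrt \<rho> * mat_sqrt (B * B\<^sup>\<dagger>)))"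
proof -
  define R S where "R = mat_sqrt \<rho>" and "S = mat_sqrt (B * B\<^sup>\<dagger>)"
  have R: "psd d R" and S: "psd d S"
    using \<rho> B unfolding R_def S_def by (auto intro: mat_sqrt_psd psd_gram)
  note cR = psd_carrier[OF R] and cS = psd_carrier[OF S]
  obtain W where W: "W \<in> carrier_mat N d" "contraction W" "W\<^sup>\<dagger> * B\<^sup>\<dagger> = S"
    using polar_decomposition[of "B\<^sup>\<dagger>" N d] B unfolding S_def by (metis adjoint_adjoint adjoint_carrier)
  define X where "X = R * S"
  have X: "X \<in> carrier_mat d d" using cR cS by (auto simp: X_def)
  define H where "H = mat_sqrt (X\<^sup>\<dagger> * X)"
  have "psd d (X\<^sup>\<dagger> * X)" using psd_gram[of "X\<^sup>\<dagger>" d d] X by simp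
  then have H: "psd d H" unfolding H_def by (rule mat_sqrt_psd)
  note cH = psd_carrier[OF H]
  obtain Y where Y: "Y \<in> carrier_mat d d" "contraction Y" "Y\<^sup>\<dagger> * X = H"
    using polar_decomposition[OF X] unfolding H_def by metis
  define T where "T = Y * W\<^sup>\<dagger>"
  have T: "T \<in> carrier_mat d N" using Y W by (auto simp: T_def)
  have "contraction T"
    unfolding T_def using Y W by (intro contraction_mult[of _ _ d d N] contraction_adjoint) auto
  then have T': "contraction (T\<^sup>\<dagger>)" by (rule contraction_adjoint)
  define A where "A = R * T"
  have A: "A \<in> carrier_mat d N" using cR T by (auto simp: A_def)
  have Aadj: "A\<^sup>\<dagger> = T\<^sup>\<dagger> * R" unfolding A_def using adjoint_mult[OF cR T] psd_adjoint[OF R] by simp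
  have "psd d (\<rho> - A * A\<^sup>\<dagger>)"
    unfolding psd_def
  proof safe
    show cD: "\<rho> - A * A\<^sup>\<dagger> \<in> carrier_mat d d" using psd_carrier[OF \<rho>] A by (auto intro!: minus_carrier_mat)
    fix v :: "complex vec" assume v: "v \<in> carrier_vec d"
    let ?y = "R *\<^sub>v v"
    have y: "?y \<in> carrier_vec d" using cR v by (rule mult_mat_vec_carrier)
    have Ty: "T\<^sup>\<dagger> *\<^sub>v ?y \<in> carrier_vec N" using T by simp
    have "\<rho> *\<^sub>v v = R *\<^sub>v ?y"
      using cR v unfolding R_def by (subst mat_sqrt_psd(2)[OF \<rho>, symmetric]) (auto simp: assoc_mult_mat_vec[of _ d d _ d])
    then have rv: "(\<rho> *\<^sub>v v) \<bullet>c v = ?y \<bullet>c ?y"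
      using cinner_adjoint[OF cR y v] psd_adjoint[OF R] by simp
    have "A * A\<^sup>\<dagger> *\<^sub>v v = A *\<^sub>v (A\<^sup>\<dagger> *\<^sub>v v)"
      using A v by (auto simp: assoc_mult_mat_vec[of _ d N _ d])
    moreover have "A\<^sup>\<dagger> *\<^sub>v v = T\<^sup>\<dagger> *\<^sub>v ?y"
      unfolding Aadj using T cR v by (auto simp: assoc_mult_mat_vec[of _ N d _ d])
    ultimately have av: "(A * A\<^sup>\<dagger> *\<^sub>v v) \<bullet>c v = (T\<^sup>\<dagger> *\<^sub>v ?y) \<bullet>c (T\<^sup>\<dagger> *\<^sub>v ?y)"
      using cinner_adjoint[OF A Ty v] by simp
    have "((\<rho> - A * A\<^sup>\<dagger>) *\<^sub>v v) \<bullet>c v = (\<rho> *\<^sub>v v) \<bullet>c v - (A * A\<^sup>\<dagger> *\<^sub>v v) \<bullet>c v"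
      using psd_carrier[OF \<rho>] A v
      by (subst minus_mult_distrib_mat_vec[of _ d d]) (auto intro!: cinner_diff_left mult_mat_vec_carrier[of _ d d])
    also have "\<dots> = complex_of_real ((vnorm ?y)\<^sup>2 - (vnorm (T\<^sup>\<dagger> *\<^sub>v ?y))\<^sup>2)"
      unfolding rv av cinner_self[OF y] cinner_self[OF Ty] by simp
    also have "0 \<le> \<dots>"
      using contractionD[OF T' _ y, of N] T by (simp add: less_eq_complex_def power_mono)
    finally show "0 \<le> ((\<rho> - A * A\<^sup>\<dagger>) *\<^sub>v v) \<bullet>c v" .
  qed
  then obtain r E where E: "E \<in> carrier_mat d r" "\<rho> - A * A\<^sup>\<dagger> = E * E\<^sup>\<dagger>"
    using psd_gram_exists by metis
  have AA: "A * A\<^sup>\<dagger> \<in> carrier_mat d d" using A by auto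
  have "\<rho> = A * A\<^sup>\<dagger> + (\<rho> - A * A\<^sup>\<dagger>)"
    using psd_carrier[OF \<rho>] AA by (intro eq_matI) auto
  then have \<rho>_eq: "\<rho> = A * A\<^sup>\<dagger> + E * E\<^sup>\<dagger>" unfolding E(2) .
  have "mat_trace (B\<^sup>\<dagger> * A) = mat_trace (A * B\<^sup>\<dagger>)"
    using A B by (intro trace_comm[of _ N d]) auto
  also have "A * B\<^sup>\<dagger> = R * (Y * S)"
    unfolding A_def T_def W(3)[symmetric] using Y W B cR
    by (simp add: assoc_mult_mat[of _ d d _ N _ d] assoc_mult_mat[of _ d d _ d _ d])
  also have "mat_trace \<dots> = mat_trace (Y * S * R)"
    using Y cR cS by (intro trace_comm[of _ d d]) auto
  also have "Y * S * R = Y * X\<^sup>\<dagger>"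
    using Y cR cS by (simp add: X_def adjoint_mult[OF cR cS] psd_adjoint[OF R] psd_adjoint[OF S]
        assoc_mult_mat[of _ d d _ d _ d])
  also have "\<dots> = (X * Y\<^sup>\<dagger>)\<^sup>\<dagger>" using X Y by (simp add: adjoint_mult[of _ d d _ d])
  also have "mat_trace \<dots> = cnj (mat_trace (X * Y\<^sup>\<dagger>))"
    using X Y by (intro trace_adjoint[of _ d]) auto
  also have "mat_trace (X * Y\<^sup>\<dagger>) = mat_trace H"
    unfolding Y(3)[symmetric] using X Y by (intro trace_comm[of _ d d]) auto
  also have "cnj (mat_trace H) = mat_trace H"
    using trace_adjoint[OF cH] psd_adjoint[OF H] by simp
  finally have tr: "mat_trace (B\<^sup>\<dagger> * A) = mat_trace H" .
  moreover have "mat_trace H = complex_of_real (trace_norm (R * S))"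
    using \<open>cnj (mat_trace H) = mat_trace H\<close> by (auto simp: trace_norm_def X_def H_def complex_eq_iff)
  ultimately show thesis using that[OF A E(1) \<rho>_eq] by (simp add: R_def S_def)
qed

subsection \<open>Equalising a diagonal quadratic form over a decomposition\<close>

text \<open>Complex coefficients let one form carry two real diagonal forms, its real and imaginary
  parts.\<close>

definition diag_form :: "nat \<Rightarrow> (nat \<Rightarrow> complex) \<Rightarrow> (nat \<Rightarrow> complex) \<Rightarrow> complex" where
  "diag_form d \<tau> x = (\<Sum>i<d. \<tau> i * (x i * cnj (x i)))"

text \<open>The imaginary part equals that of \<open>e * (\<gamma> - cnj \<beta>)\<close>, so
  \<open>e\<close> only has to rotate this number onto the real axis.\<close>

lemma unit_phase_Im_0:
  obtains e :: complex where "e * cnj e = 1" "Im (cnj e * \<beta> + e * \<gamma>) = 0"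
proof (cases "\<gamma> = cnj \<beta>")
  case True
  then show thesis by (intro that[of 1]) auto
next
  case False
  define q where "q = \<gamma> - cnj \<beta>"
  have q: "q \<noteq> 0" using False by (simp add: q_def)
  define e where "e = cnj q / complex_of_real (cmod q)"
  have qq: "q * cnj q = complex_of_real (cmod q) * complex_of_real (cmod q)"
    using complex_norm_square[of q] by (simp add: power2_eq_square)
  then have 1: "e * cnj e = 1" using q by (simp add: e_def mult.commute)
  have "e * q = complex_of_real (cmod q)" using q qq by (simp add: e_def mult.commute)
  then have "Im (e * q) = 0" by simp
  moreover have "Im (cnj e * \<beta> + e * \<gamma>) = Im (e * q)" by (simp add: q_def algebra_simps)
  ultimately show thesis using that 1 by simp
qed

text \<open>Along \<open>c = cos t\<close>, \<open>s = sin t\<close> the expression runs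
  continuously from 1 at 0 to 0 at \<open>pi / 2\<close>, whatever \<open>\<kappa>\<close>
  is.\<close>

lemma cos_sin_interpolation:
  assumes "0 \<le> \<mu>" "\<mu> \<le> (1 :: real)"
  obtains c s where "c\<^sup>2 + s\<^sup>2 = 1" "c\<^sup>2 + c * s * \<kappa> = \<mu>"
proof -
  let ?g = "\<lambda>t. (cos t)\<^sup>2 + cos t * sin t * \<kappa>"
  have "\<exists>t\<ge>0. t \<le> pi / 2 \<and> ?g t = \<mu>"
    by (rule IVT2') (use assms in \<open>auto intro!: continuous_intros\<close>)
  then obtain t where "?g t = \<mu>" by blast
  then show thesis by (intro that[of "cos t" "sin t"]) auto
qed

text \<open>Toeplitz--Hausdorff for a pair: a unitary mixing of two vectors moves the value of the form at
  the first one anywhere on the segment between the two values.\<close>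

lemma diag_form_pair:
  assumes \<mu>: "0 \<le> \<mu>" "\<mu> \<le> 1"
  obtains u v where "\<And>a b. u a * cnj (u b) + v a * cnj (v b) = z a * cnj (z b) + w a * cnj (w b)"
    "diag_form d \<tau> u = complex_of_real \<mu> * diag_form d \<tau> z + complex_of_real (1 - \<mu>) * diag_form d \<tau> w"
proof (cases "diag_form d \<tau> z = diag_form d \<tau> w")
  case True
  then show thesis by (intro that[of z w]) (auto simp: algebra_simps)
next
  case False
  let ?f = "diag_form d \<tau>"
  define \<alpha> where "\<alpha> = ?f z - ?f w"
  have \<alpha>: "\<alpha> \<noteq> 0" using False by (simp add: \<alpha>_def)
  define \<beta> where "\<beta> = (\<Sum>i<d. \<tau> i * (z i * cnj (w i)))"
  define \<gamma> where "\<gamma> = (\<Sum>i<d. \<tau> i * (w i * cnj (z i)))"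
  \<comment> \<open>The phase makes the cross term a real multiple of \<open>\<alpha>\<close>, so
    that mixing moves the value along the line through the two given values.\<close>
  obtain e where e: "e * cnj e = 1" "Im (cnj e * (\<beta> / \<alpha>) + e * (\<gamma> / \<alpha>)) = 0"
    using unit_phase_Im_0 by blast
  define \<kappa> where "\<kappa> = Re (cnj e * (\<beta> / \<alpha>) + e * (\<gamma> / \<alpha>))"
  have "cnj e * (\<beta> / \<alpha>) + e * (\<gamma> / \<alpha>) = complex_of_real \<kappa>"
    using e(2) by (simp add: \<kappa>_def complex_eq_iff)
  then have \<kappa>: "cnj e * \<beta> + e * \<gamma> = complex_of_real \<kappa> * \<alpha>" using \<alpha> by (simp add: field_simps)
  obtain c s where cs: "c\<^sup>2 + s\<^sup>2 = 1" "c\<^sup>2 + c * s * \<kappa> = \<mu>" using cos_sin_interpolation[OF \<mu>] .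
  define C where "C = complex_of_real c"
  define S where "S = complex_of_real s"
  have C: "cnj C = C" "cnj S = S" "C * C + S * S = 1" "C * C + C * S * complex_of_real \<kappa> = complex_of_real \<mu>"
    using cs unfolding C_def S_def
    by (auto simp flip: of_real_mult of_real_add simp: power2_eq_square)
  \<comment> \<open>\<open>?u\<close> and \<open>?v\<close> arise from \<open>z\<close> and
    \<open>w\<close> by a two-by-two unitary, which preserves the sum of the two Gram terms.\<close>
  let ?u = "\<lambda>a. C * z a + S * e * w a"
  let ?v = "\<lambda>a. C * w a - S * cnj e * z a"
  show thesis
  proof (rule that)
    fix a b
    have "?u a * cnj (?u b) + ?v a * cnj (?v b) =
        (C * C + S * S * (e * cnj e)) * (z a * cnj (z b)) + (C * C + S * S * (e * cnj e)) * (w a * cnj (w b))"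
      by (simp add: C algebra_simps)
    then show "?u a * cnj (?u b) + ?v a * cnj (?v b) = z a * cnj (z b) + w a * cnj (w b)"
      using C(3) e(1) by simp
  next
    have "?f ?u = (\<Sum>i<d. C * C * (\<tau> i * (z i * cnj (z i))) + S * S * (e * cnj e) * (\<tau> i * (w i * cnj (w i)))
        + C * S * (cnj e * (\<tau> i * (z i * cnj (w i))) + e * (\<tau> i * (w i * cnj (z i)))))"
      unfolding diag_form_def by (intro sum.cong) (auto simp: C algebra_simps)
    also have "\<dots> = C * C * ?f z + S * S * ?f w + C * S * (cnj e * \<beta> + e * \<gamma>)"
      by (simp add: diag_form_def \<beta>_def \<gamma>_def sum.distrib sum_distrib_left distrib_left mult.assoc e(1))
    also have "\<dots> = (C * C + C * S * complex_of_real \<kappa>) * ?f z + (S * S - C * S * complex_of_real \<kappa>) * ?f w"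
      unfolding \<kappa> \<alpha>_def by (simp add: algebra_simps)
    also have "S * S - C * S * complex_of_real \<kappa> = 1 - (C * C + C * S * complex_of_real \<kappa>)"
      using C(3) by (simp add: algebra_simps)
    finally show "?f ?u = complex_of_real \<mu> * ?f z + complex_of_real (1 - \<mu>) * ?f w"
      unfolding C(4) by simp
  qed
qed

text \<open>In the step, the first \<open>n\<close> vectors are equalised, one of them is mixed with
  the last vector to reach the overall mean, and the induction hypothesis is applied once more to
  the other \<open>n\<close> vectors, whose mean is then the same. Multiplying by \<open>n\<close>
  avoids a division in the empty case.\<close>

lemma diag_form_equalise:
  "\<exists>z'. (\<forall>a b. (\<Sum>j<n. z' j a * cnj (z' j b)) = (\<Sum>j<n. z j a * cnj (z j b))) \<and>
    (\<forall>j<n. complex_of_real (real n) * diag_form d \<tau> (z' j) = (\<Sum>j<n. diag_form d \<tau> (z j)))"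
proof (induction n arbitrary: z)
  case (Suc n)
  let ?f = "diag_form d \<tau>"
  \<comment> \<open>The total of the form depends only on the preserved Gram sums, so the overall
    mean never changes.\<close>
  have tr: "(\<Sum>j<k. ?f (x j)) = (\<Sum>j<k. ?f (y j))"
    if "\<forall>a b. (\<Sum>j<k. x j a * cnj (x j b)) = (\<Sum>j<k. y j a * cnj (y j b))" for x y and k :: nat
    using that unfolding diag_form_def
    by (subst (1 2) sum.swap) (simp flip: sum_distrib_left)
  show ?case
  proof (cases "n = 0")
    case True
    then show ?thesis by (intro exI[of _ z]) auto
  next
    case False
    then have n: "0 < n" by simp
    define s where "s = (\<Sum>j<Suc n. ?f (z j)) / complex_of_real (real (Suc n))"
    have s: "(\<Sum>j<Suc n. ?f (z j)) = complex_of_real (real (Suc n)) * s"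
      by (simp add: s_def del: of_nat_Suc)
    obtain y where y: "\<forall>a b. (\<Sum>j<n. y j a * cnj (y j b)) = (\<Sum>j<n. z j a * cnj (z j b))"
      "\<forall>j<n. complex_of_real (real n) * ?f (y j) = (\<Sum>j<n. ?f (z j))"
      using Suc.IH[of z] by blast
    \<comment> \<open>\<open>y 0\<close> already carries the mean of the first \<open>n\<close>
      values, so the last vector enters with weight one in \<open>Suc n\<close>.\<close>
    let ?\<mu> = "1 / real (Suc n)"
    obtain u v where uv: "\<And>a b. u a * cnj (u b) + v a * cnj (v b) = z n a * cnj (z n b) + y 0 a * cnj (y 0 b)"
      "?f u = complex_of_real ?\<mu> * ?f (z n) + complex_of_real (1 - ?\<mu>) * ?f (y 0)"
      using diag_form_pair[of ?\<mu> "z n" "y 0" d \<tau>] by auto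
    have "complex_of_real (real (Suc n)) * ?f u = ?f (z n) + complex_of_real (real n) * ?f (y 0)"
      unfolding uv(2) by (simp add: field_simps add_nonneg_eq_0_iff flip: of_nat_Suc) (simp add: algebra_simps)
    also have "\<dots> = (\<Sum>j<Suc n. ?f (z j))" using y(2) n by simp
    finally have fu: "?f u = s" unfolding s by (simp del: of_nat_Suc)
    define x where "x = (\<lambda>j. if j = 0 then v else y j)"
    have shift: "(\<Sum>j<n. g (x j)) = g v + (\<Sum>j\<in>{1..<n}. g (y j))"
      "(\<Sum>j<n. g (y j)) = g (y 0) + (\<Sum>j\<in>{1..<n}. g (y j))" for g :: "(nat \<Rightarrow> complex) \<Rightarrow> complex"
      using n by (auto simp: x_def lessThan_atLeast0 sum.atLeast_Suc_lessThan)
    have x: "(\<Sum>j<n. x j a * cnj (x j b)) + u a * cnj (u b) = (\<Sum>j<Suc n. z j a * cnj (z j b))" for a b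
    proof -
      have "(\<Sum>j<n. x j a * cnj (x j b)) + u a * cnj (u b) =
          (u a * cnj (u b) + v a * cnj (v b)) + (\<Sum>j\<in>{1..<n}. y j a * cnj (y j b))"
        using shift(1)[of "\<lambda>x. x a * cnj (x b)"] by simp
      also have "\<dots> = z n a * cnj (z n b) + (\<Sum>j<n. y j a * cnj (y j b))"
        unfolding uv(1) using shift(2)[of "\<lambda>x. x a * cnj (x b)"] by simp
      finally show ?thesis using y(1) by simp
    qed
    obtain x' where x': "\<forall>a b. (\<Sum>j<n. x' j a * cnj (x' j b)) = (\<Sum>j<n. x j a * cnj (x j b))"
      "\<forall>j<n. complex_of_real (real n) * ?f (x' j) = (\<Sum>j<n. ?f (x j))"
      using Suc.IH[of x] by blast
    define z' where "z' = (\<lambda>j. if j < n then x' j else u)"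
    have gram: "(\<Sum>j<Suc n. z' j a * cnj (z' j b)) = (\<Sum>j<Suc n. z j a * cnj (z j b))" for a b
      using x'(1) x[of a b] by (simp add: z'_def)
    then have "(\<Sum>j<Suc n. ?f (z' j)) = (\<Sum>j<Suc n. ?f (z j))" by (intro tr) simp
    then have "(\<Sum>j<n. ?f (x j)) + s = complex_of_real (real (Suc n)) * s"
      using tr[OF x'(1)] unfolding s by (simp add: z'_def fu)
    then have xs: "(\<Sum>j<n. ?f (x j)) = complex_of_real (real n) * s" by (simp add: algebra_simps)
    have "?f (z' j) = s" if "j < Suc n" for j
      using x'(2) xs n fu that by (cases "j < n") (auto simp: z'_def)
    then show ?thesis using gram s by (intro exI[of _ z']) simp
  qed
qed simp

subsection \<open>The hypersimplex\<close>

text \<open>If all other entries were 0 or 1, the integral total would make the remaining one an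
  integer.\<close>

lemma exists_second_fractional:
  assumes "finite I" "\<forall>i\<in>I. 0 \<le> x i \<and> x i \<le> (1::real)" "sum x I = real m"
    and i: "i \<in> I" "0 < x i" "x i < 1"
  shows "\<exists>j\<in>I. j \<noteq> i \<and> 0 < x j \<and> x j < 1"
proof (rule ccontr)
  assume neg: "\<not> ?thesis"
  then have "x j = 0 \<or> x j = 1" if "j \<in> I - {i}" for j
    using neg assms(2) that by (metis DiffD1 DiffD2 insertI1 less_eq_real_def)
  then have 01: "x j \<in> \<int>" if "j \<in> I - {i}" for j using that by force
  have "x i = real m - sum x (I - {i})" using assms(1,3) i(1) by (simp add: sum.remove)
  also have "\<dots> \<in> \<int>" using 01 by (intro Ints_diff Ints_sum) auto
  finally show False using i(2,3) by (auto elim!: Ints_cases)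
qed

text \<open>Shifting mass between two fractional coordinates in either direction exhibits
  \<open>x\<close> as a mixture of two points with fewer fractional coordinates; a point without any
  is the indicator of an \<open>m\<close>-element set.\<close>

lemma hypersimplex_decomposition:
  assumes "finite I" "\<forall>i\<in>I. 0 \<le> x i \<and> x i \<le> (1::real)" "sum x I = real m"
  shows "\<exists>t. (\<forall>S. 0 \<le> t S \<and> (t S \<noteq> 0 \<longrightarrow> card S = m)) \<and> sum t (Pow I) = 1 \<and>
    (\<forall>i\<in>I. x i = (\<Sum>S\<in>Pow I. t S * of_bool (i \<in> S)))"
  using assms(2,3)
proof (induction "card {i\<in>I. 0 < x i \<and> x i < 1}" arbitrary: x rule: less_induct)
  case less
  note x01 = less.prems(1) and sum = less.prems(2)
  show ?case
  proof (cases "\<exists>i\<in>I. 0 < x i \<and> x i < 1")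
    case False
    define S where "S = {i\<in>I. x i = 1}"
    have x: "x i = of_bool (i \<in> S)" if "i \<in> I" for i using False x01 that by (force simp: S_def)
    have "sum x I = (\<Sum>i\<in>I. of_bool (i \<in> S))" using x by (intro sum.cong) auto
    also have "\<dots> = real (card S)"
      using assms(1) by (subst sum_of_bool_eq) (auto simp: S_def intro!: arg_cong[of _ _ card])
    finally have "real (card S) = sum x I" by simp
    then have "card S = m" using sum by simp
    moreover have "(\<Sum>T\<in>Pow I. of_bool (T = S) * of_bool (i \<in> T)) = (of_bool (i \<in> S) :: real)" for i
      using assms(1) by (subst sum.mono_neutral_right[of _ "{S}"]) (auto simp: S_def)
    moreover have "(\<Sum>T\<in>Pow I. of_bool (T = S)) = (1::real)"
      using assms(1) by (subst sum.mono_neutral_right[of _ "{S}"]) (auto simp: S_def)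
    ultimately show ?thesis using x by (intro exI[of _ "\<lambda>T. of_bool (T = S)"]) auto
  next
    case True
    then obtain i where i: "i \<in> I" "0 < x i" "x i < 1" by blast
    obtain j where j: "j \<in> I" "j \<noteq> i" "0 < x j" "x j < 1"
      using exists_second_fractional[OF assms(1) x01 sum i] by blast
    define y where "y = (\<lambda>\<delta>. x(i := x i + \<delta>, j := x j - \<delta>))"
    have step: "\<exists>t. (\<forall>S. 0 \<le> t S \<and> (t S \<noteq> 0 \<longrightarrow> card S = m)) \<and> sum t (Pow I) = 1 \<and>
        (\<forall>i\<in>I. y \<delta> i = (\<Sum>S\<in>Pow I. t S * of_bool (i \<in> S)))"
      if b: "0 \<le> x i + \<delta>" "x i + \<delta> \<le> 1" "0 \<le> x j - \<delta>" "x j - \<delta> \<le> 1"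
        and e: "x i + \<delta> \<in> {0, 1} \<or> x j - \<delta> \<in> {0, 1}" for \<delta>
    proof (rule less.hyps)
      show "card {k\<in>I. 0 < y \<delta> k \<and> y \<delta> k < 1} < card {k\<in>I. 0 < x k \<and> x k < 1}"
      proof (rule psubset_card_mono)
        show "finite {k\<in>I. 0 < x k \<and> x k < 1}" using assms(1) by simp
        show "{k\<in>I. 0 < y \<delta> k \<and> y \<delta> k < 1} \<subset> {k\<in>I. 0 < x k \<and> x k < 1}"
        proof
          show "{k\<in>I. 0 < y \<delta> k \<and> y \<delta> k < 1} \<subseteq> {k\<in>I. 0 < x k \<and> x k < 1}"
            using i j by (auto simp: y_def)
          have "\<not> (0 < y \<delta> i \<and> y \<delta> i < 1) \<or> \<not> (0 < y \<delta> j \<and> y \<delta> j < 1)"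
            using e j(2) by (auto simp: y_def)
          then show "{k\<in>I. 0 < y \<delta> k \<and> y \<delta> k < 1} \<noteq> {k\<in>I. 0 < x k \<and> x k < 1}"
            using i j by blast
        qed
      qed
      show "\<forall>k\<in>I. 0 \<le> y \<delta> k \<and> y \<delta> k \<le> 1" using x01 b by (auto simp: y_def)
      have "sum (y \<delta>) I = y \<delta> i + (y \<delta> j + sum (y \<delta>) (I - {i} - {j}))"
        using assms(1) i j by (simp add: sum.remove[of I i] sum.remove[of "I - {i}" j])
      also have "sum (y \<delta>) (I - {i} - {j}) = sum x (I - {i} - {j})"
        by (intro sum.cong) (auto simp: y_def)
      also have "y \<delta> i + (y \<delta> j + \<dots>) = sum x I"
        using assms(1) i j by (simp add: sum.remove[of I i] sum.remove[of "I - {i}" j] y_def)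
      finally show "sum (y \<delta>) I = real m" using sum by simp
    qed
    \<comment> \<open>The largest shifts towards \<open>i\<close> and away from \<open>i\<close>
      that stay in the unit interval; each makes one of the two coordinates integral.\<close>
    define p where "p = min (1 - x i) (x j)"
    define q where "q = min (x i) (1 - x j)"
    have pq: "0 < p" "0 < q" using i j by (auto simp: p_def q_def)
    obtain t where t: "\<forall>S. 0 \<le> t S \<and> (t S \<noteq> 0 \<longrightarrow> card S = m)" "sum t (Pow I) = 1"
      "\<forall>i\<in>I. y p i = (\<Sum>S\<in>Pow I. t S * of_bool (i \<in> S))"
    proof -
      have "0 \<le> x i + p" "x i + p \<le> 1" "0 \<le> x j - p" "x j - p \<le> 1" "x i + p \<in> {0, 1} \<or> x j - p \<in> {0, 1}"
        using i j unfolding p_def by (simp_all add: min_def)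
      from step[OF this] that show thesis by blast
    qed
    obtain t' where t': "\<forall>S. 0 \<le> t' S \<and> (t' S \<noteq> 0 \<longrightarrow> card S = m)" "sum t' (Pow I) = 1"
      "\<forall>i\<in>I. y (-q) i = (\<Sum>S\<in>Pow I. t' S * of_bool (i \<in> S))"
    proof -
      have "0 \<le> x i + - q" "x i + - q \<le> 1" "0 \<le> x j - - q" "x j - - q \<le> 1"
        "x i + - q \<in> {0, 1} \<or> x j - - q \<in> {0, 1}"
        using i j unfolding q_def by (simp_all add: min_def)
      from step[OF this] that show thesis by blast
    qed
    \<comment> \<open>The weights are inversely proportional to the shifts, so the displacements
      \<open>p\<close> and \<open>- q\<close> cancel.\<close>
    let ?t = "\<lambda>S. (q * t S + p * t' S) / (p + q)"
    have "x k = (q * y p k + p * y (-q) k) / (p + q)" for k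
      using pq by (auto simp: y_def field_simps)
    then have "x k = (\<Sum>S\<in>Pow I. ?t S * of_bool (k \<in> S))" if "k \<in> I" for k
      using t(3) t'(3) that
      by (simp add: sum.distrib sum_distrib_left sum_divide_distrib add_divide_distrib distrib_right mult.assoc)
    moreover have "sum ?t (Pow I) = 1"
      using t(2) t'(2) pq by (simp add: sum.distrib sum_divide_distrib[symmetric] sum_distrib_left[symmetric])
    moreover have "0 \<le> ?t S \<and> (?t S \<noteq> 0 \<longrightarrow> card S = m)" for S
      using t(1) t'(1) pq by (cases "t S = 0"; cases "t' S = 0") (auto intro!: divide_nonneg_pos add_nonneg_nonneg)
    ultimately show ?thesis by (intro exI[of _ ?t]) auto
  qed
qed

subsection \<open>Flat vectors and operators with constant diagonal\<close>

text \<open>The sum is at most 1 at \<open>r\<close> and at least 1 at the constant function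
  \<open>1 / m\<close>, so some point of the segment between them has sum exactly 1.\<close>

lemma raise_to_sum_1:
  fixes r :: "nat \<Rightarrow> real"
  assumes m: "1 \<le> m" "m \<le> d" and r: "\<And>i. i < d \<Longrightarrow> 0 \<le> r i \<and> r i \<le> 1 / real m" "(\<Sum>i<d. r i) \<le> 1"
  obtains s where "\<And>i. i < d \<Longrightarrow> r i \<le> s i \<and> s i \<le> 1 / real m" "(\<Sum>i<d. s i) = 1"
proof -
  define R where "R = (\<Sum>i<d. r i)"
  \<comment> \<open>Solves the linear equation for the sum. If the denominator vanishes,
    \<open>\<mu>\<close> is 0 by default, which is right because then \<open>R = 1\<close>.\<close>
  define \<mu> where "\<mu> = (1 - R) / (real d / real m - R)"
  have dm: "1 \<le> real d / real m" using m by simp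
  have R: "R \<le> 1" using r(2) by (simp add: R_def)
  have \<mu>: "0 \<le> \<mu>" "\<mu> \<le> 1"
    using dm R by (auto simp: \<mu>_def divide_le_eq_1)
  have eq: "(1 - \<mu>) * R + real d * \<mu> / real m = 1"
  proof (cases "real d / real m = R")
    case True
    then have "R = 1" using dm R by simp
    then show ?thesis using True by (simp add: algebra_simps)
  next
    case False
    then have "\<mu> * (real d / real m - R) = 1 - R" by (simp add: \<mu>_def)
    then show ?thesis by (simp add: algebra_simps)
  qed
  show thesis
  proof
    let ?s = "\<lambda>i. (1 - \<mu>) * r i + \<mu> * (1 / real m)"
    show "r i \<le> ?s i \<and> ?s i \<le> 1 / real m" if "i < d" for i
    proof
      have "\<mu> * r i \<le> \<mu> * (1 / real m)" using r(1)[OF that] \<mu> by (intro mult_left_mono) auto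
      then show "r i \<le> ?s i" unfolding left_diff_distrib by linarith
      have "(1 - \<mu>) * r i \<le> (1 - \<mu>) * (1 / real m)" using r(1)[OF that] \<mu> by (intro mult_left_mono) auto
      then show "?s i \<le> 1 / real m" unfolding left_diff_distrib by linarith
    qed
    show "(\<Sum>i<d. ?s i) = 1"
      using eq by (simp add: sum.distrib sum_distrib_left[symmetric] R_def)
  qed
qed

text \<open>Let \<open>q\<close> be the value of the form at \<open>\<psi>\<close> and
  \<open>y = M *\<^sub>v \<psi>\<close>. From \<open>M\<close> being at most the identity,
  \<open>(vnorm y)\<^sup>2 \<le> q\<close>; Cauchy-Schwarz for the form of \<open>M\<close> against
  basis vectors gives \<open>(cmod (y $ i))\<^sup>2 \<le> q / m\<close>. Hence the squared moduli of
  \<open>y\<close> divided by \<open>q\<close> can be raised to a flat distribution, and the overlap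
  stays at least \<open>sqrt q\<close>.\<close>

lemma flat_vector_above_quadratic_form:
  assumes M: "psd d M" "\<And>v. v \<in> carrier_vec d \<Longrightarrow> Re ((M *\<^sub>v v) \<bullet>c v) \<le> (vnorm v)\<^sup>2"
    "\<And>i. i < d \<Longrightarrow> M $$ (i, i) = complex_of_real (1 / real m)"
    and m: "1 \<le> m" "m \<le> d" and \<psi>: "\<psi> \<in> carrier_vec d"
  obtains w c where "w \<in> unit_vectors d" "\<And>i. i < d \<Longrightarrow> (cmod (w $ i))\<^sup>2 \<le> 1 / real m"
    "0 \<le> c" "\<psi> \<bullet>c w = complex_of_real c" "Re ((M *\<^sub>v \<psi>) \<bullet>c \<psi>) \<le> c\<^sup>2"
proof -
  note cM = psd_carrier[OF M(1)]
  obtain r E where E: "E \<in> carrier_mat d r" "M = E * E\<^sup>\<dagger>" using psd_gram_exists[OF M(1)] .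
  have form: "(M *\<^sub>v u) \<bullet>c v = (E\<^sup>\<dagger> *\<^sub>v u) \<bullet>c (E\<^sup>\<dagger> *\<^sub>v v)"
    if "u \<in> carrier_vec d" "v \<in> carrier_vec d" for u v
  proof -
    have "(M *\<^sub>v u) \<bullet>c v = (E *\<^sub>v (E\<^sup>\<dagger> *\<^sub>v u)) \<bullet>c v"
      unfolding E(2) using that E(1) by (subst assoc_mult_mat_vec[of _ d r _ d]) auto
    also have "\<dots> = (E\<^sup>\<dagger> *\<^sub>v u) \<bullet>c (E\<^sup>\<dagger> *\<^sub>v v)"
      using that E(1) by (intro cinner_adjoint[of _ d r]) auto
    finally show ?thesis .
  qed
  have norm: "Re ((M *\<^sub>v v) \<bullet>c v) = (vnorm (E\<^sup>\<dagger> *\<^sub>v v))\<^sup>2" if "v \<in> carrier_vec d" for v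
    using form[OF that that] cinner_self[of "E\<^sup>\<dagger> *\<^sub>v v" r] E(1) by simp
  have "contraction (E\<^sup>\<dagger>)"
    unfolding contraction_def
  proof
    fix v :: "complex vec" assume "v \<in> carrier_vec (dim_col (E\<^sup>\<dagger>))"
    then have v: "v \<in> carrier_vec d" using E(1) by simp
    have "(vnorm (E\<^sup>\<dagger> *\<^sub>v v))\<^sup>2 \<le> (vnorm v)\<^sup>2" using norm[OF v] M(2)[OF v] by linarith
    then show "vnorm (E\<^sup>\<dagger> *\<^sub>v v) \<le> vnorm v" by (rule power2_le_imp_le) simp
  qed
  then have E': "contraction E" using contraction_adjoint by fastforce
  define q where "q = (vnorm (E\<^sup>\<dagger> *\<^sub>v \<psi>))\<^sup>2"
  have q: "0 \<le> q" by (simp add: q_def)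
  define y where "y = M *\<^sub>v \<psi>"
  have y: "y \<in> carrier_vec d" using cM \<psi> by (auto simp: y_def)
  have "y = E *\<^sub>v (E\<^sup>\<dagger> *\<^sub>v \<psi>)"
    unfolding y_def E(2) using \<psi> E(1) by (subst assoc_mult_mat_vec[of _ d r _ d]) auto
  then have "vnorm y \<le> vnorm (E\<^sup>\<dagger> *\<^sub>v \<psi>)"
    using contractionD[OF E' E(1), of "E\<^sup>\<dagger> *\<^sub>v \<psi>"] E(1) by simp
  then have yq: "(vnorm y)\<^sup>2 \<le> q" by (simp add: q_def power_mono)
  have yi: "(cmod (y $ i))\<^sup>2 \<le> q / real m" if i: "i < d" for i
  proof -
    let ?e = "unit_vec d i :: complex vec"
    have "(M *\<^sub>v ?e) \<bullet>c ?e = M $$ (i, i)"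
      using cM i by (subst cinner_unit[of _ d]) (auto simp: mult_unit_vec_index[of _ d d] simp del: index_mult_mat_vec)
    then have e: "(vnorm (E\<^sup>\<dagger> *\<^sub>v ?e))\<^sup>2 = 1 / real m" using norm[of ?e] M(3)[OF i] by simp
    have "cmod (y $ i) = cmod ((E\<^sup>\<dagger> *\<^sub>v \<psi>) \<bullet>c (E\<^sup>\<dagger> *\<^sub>v ?e))"
      using form[OF \<psi>, of ?e] cinner_unit[OF y i] by (simp add: y_def)
    also have "\<dots> \<le> vnorm (E\<^sup>\<dagger> *\<^sub>v \<psi>) * vnorm (E\<^sup>\<dagger> *\<^sub>v ?e)"
      using E(1) by (intro cinner_le_vnorm[of _ r]) auto
    finally have "(cmod (y $ i))\<^sup>2 \<le> (vnorm (E\<^sup>\<dagger> *\<^sub>v \<psi>) * vnorm (E\<^sup>\<dagger> *\<^sub>v ?e))\<^sup>2" by (simp add: power_mono)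
    then show ?thesis by (simp add: power_mult_distrib e q_def)
  qed
  \<comment> \<open>For \<open>q = 0\<close> the quotients are 0 by default, and the raising still
    applies.\<close>
  obtain s where s: "\<And>i. i < d \<Longrightarrow> (cmod (y $ i))\<^sup>2 / q \<le> s i \<and> s i \<le> 1 / real m" "(\<Sum>i<d. s i) = 1"
  proof (rule raise_to_sum_1[OF m, of "\<lambda>i. (cmod (y $ i))\<^sup>2 / q"])
    show "0 \<le> (cmod (y $ i))\<^sup>2 / q \<and> (cmod (y $ i))\<^sup>2 / q \<le> 1 / real m" if "i < d" for i
      using yi[OF that] q by (cases "q = 0") (auto simp: divide_le_eq mult.commute)
    show "(\<Sum>i<d. (cmod (y $ i))\<^sup>2 / q) \<le> 1"
      using yq q by (cases "q = 0") (auto simp: vnorm_sq[OF y] sum_divide_distrib[symmetric])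
  qed blast
  have s0: "0 \<le> s i" if "i < d" for i
    using s(1)[OF that] q by (meson divide_nonneg_nonneg order_trans zero_le_power2)
  \<comment> \<open>Phases of \<open>\<psi>\<close> make all terms of the overlap nonnegative. Where
    \<open>\<psi>\<close> vanishes, \<open>sgn\<close> would be 0 and spoil the modulus of
    \<open>w\<close>, so 1 is taken.\<close>
  let ?p = "\<lambda>i. if \<psi> $ i = 0 then 1 else sgn (\<psi> $ i)"
  define w where "w = vec d (\<lambda>i. ?p i * complex_of_real (sqrt (s i)))"
  have w: "w \<in> carrier_vec d" by (simp add: w_def)
  have wi: "(cmod (w $ i))\<^sup>2 = s i" if "i < d" for i
    using that s0[OF that] by (auto simp: w_def norm_mult norm_sgn)
  define c where "c = (\<Sum>i<d. cmod (\<psi> $ i) * sqrt (s i))"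
  have "\<psi> $ i * cnj (w $ i) = complex_of_real (cmod (\<psi> $ i) * sqrt (s i))" if "i < d" for i
  proof -
    have "z * cnj (sgn z) = complex_of_real (cmod z)" for z
      using complex_norm_square[of z] by (cases "z = 0") (auto simp: sgn_eq power2_eq_square nonzero_divide_eq_eq)
    then show ?thesis using that by (simp add: w_def mult.assoc[symmetric])
  qed
  then have c: "\<psi> \<bullet>c w = complex_of_real c"
    by (simp add: cinner_index[OF \<psi> w] c_def)
  have c0: "0 \<le> c" unfolding c_def using s0 by (intro sum_nonneg) auto
  have "sqrt q \<le> c"
  proof (cases "q = 0")
    case False
    have "q = cmod (y \<bullet>c \<psi>)"
      using form[OF \<psi> \<psi>] cinner_self[of "E\<^sup>\<dagger> *\<^sub>v \<psi>" r] E(1) by (simp add: y_def q_def norm_power)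
    also have "\<dots> \<le> (\<Sum>i<d. cmod (\<psi> $ i) * cmod (y $ i))"
      unfolding cinner_index[OF y \<psi>] by (rule sum_norm_le) (simp add: norm_mult mult.commute)
    also have "\<dots> \<le> (\<Sum>i<d. cmod (\<psi> $ i) * (sqrt q * sqrt (s i)))"
    proof (intro sum_mono mult_left_mono)
      fix i assume "i \<in> {..<d}"
      then have "(cmod (y $ i))\<^sup>2 \<le> q * s i" using s(1)[of i] q False by (simp add: divide_le_eq mult.commute)
      then have "cmod (y $ i) \<le> sqrt (q * s i)" by (rule real_le_rsqrt)
      then show "cmod (y $ i) \<le> sqrt q * sqrt (s i)" by (simp add: real_sqrt_mult)
    qed simp
    also have "\<dots> = sqrt q * c" by (simp add: c_def sum_distrib_left algebra_simps)
    finally have "sqrt q * sqrt q \<le> sqrt q * c" using q by simp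
    then show ?thesis using mult_le_cancel_left_pos[of "sqrt q" "sqrt q" c] q False by simp
  qed (use c0 in simp)
  then have "q \<le> c\<^sup>2" by (rule sqrt_le_D)
  then have qc: "Re ((M *\<^sub>v \<psi>) \<bullet>c \<psi>) \<le> c\<^sup>2" using norm[OF \<psi>] by (simp add: q_def)
  have "(vnorm w)\<^sup>2 = 1" using vnorm_sq[OF w] wi s(2) by simp
  then have "w \<in> unit_vectors d" using w vnorm_ge_0[of w] by (auto simp: unit_vectors_def power2_eq_1_iff)
  then show thesis using that[OF _ _ c0 c qc] wi s(1) by simp
qed

subsection \<open>Channels and the fidelity with the maximally coherent state\<close>

text \<open>For \<open>m \<ge> 1\<close> this is the expectation of \<open>Z\<close> in the
  maximally coherent vector, as \<open>flat_value_form\<close> shows.\<close>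

definition flat_value :: "nat \<Rightarrow> complex mat \<Rightarrow> complex" where
  "flat_value m Z = (\<Sum>i<m. \<Sum>j<m. Z $$ (i, j)) / complex_of_real (real m)"

lemma max_coherent_index:
  "i < m \<Longrightarrow> j < m \<Longrightarrow> max_coherent m $$ (i, j) = complex_of_real (1 / real m)"
  by (auto simp: max_coherent_def proj_def simp flip: of_real_mult)

lemma max_coherent_carrier [simp]: "max_coherent m \<in> carrier_mat m m"
  by (auto simp: max_coherent_def)

text \<open>The conjugation stems from the first slot of \<open>hs_inner\<close>; afterwards only
  real parts are compared.\<close>

lemma hs_inner_max_coherent:
  assumes "Z \<in> carrier_mat m m"
  shows "hs_inner Z (max_coherent m) = cnj (flat_value m Z)"
proof -
  have "hs_inner Z (max_coherent m) = (\<Sum>i<m. \<Sum>k<m. cnj (Z $$ (k, i)) * complex_of_real (1 / real m))"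
    using assms mult_carrier_mat[of "Z\<^sup>\<dagger>" m m "max_coherent m" m] unfolding hs_inner_def
    by (subst trace_index[of _ m])
      (auto simp: mult_index[of "Z\<^sup>\<dagger>" m m "max_coherent m" m] max_coherent_index simp del: index_mult_mat(1) intro!: sum.cong)
  also have "\<dots> = cnj (flat_value m Z)"
    unfolding flat_value_def by (subst sum.swap) (simp add: sum_divide_distrib)
  finally show ?thesis .
qed

definition flat_vec :: "nat \<Rightarrow> complex vec" where
  "flat_vec m = vec m (\<lambda>i. complex_of_real (1 / sqrt (real m)))"

lemma flat_vec_unit:
  assumes "1 \<le> m"
  shows "flat_vec m \<in> carrier_vec m" "vnorm (flat_vec m) = 1"
  using assms by (auto simp: flat_vec_def vnorm_L2[of _ m] L2_set_def norm_divide power_divide)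

lemma flat_value_form:
  assumes "Z \<in> carrier_mat m m" "1 \<le> m"
  shows "flat_value m Z = (Z *\<^sub>v flat_vec m) \<bullet>c flat_vec m"
proof -
  have "(Z *\<^sub>v flat_vec m) \<bullet>c flat_vec m = (\<Sum>i<m. \<Sum>j<m. Z $$ (i, j) * complex_of_real (1 / sqrt m * (1 / sqrt m)))"
    using assms flat_vec_unit[OF assms(2)]
    by (subst quadratic_form_index[of _ m]) (auto simp: flat_vec_def mult.assoc simp flip: of_real_mult intro!: sum.cong)
  also have "\<dots> = flat_value m Z"
    by (simp add: flat_value_def sum_divide_distrib)
  finally show ?thesis by simp
qed

lemma proj_index: "v \<in> carrier_vec n \<Longrightarrow> i < n \<Longrightarrow> j < n \<Longrightarrow> proj v $$ (i, j) = v $ i * cnj (v $ j)"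
  by (auto simp: proj_def)

lemma contraction_proj:
  assumes "v \<in> carrier_vec n" "vnorm v = 1"
  shows "contraction (proj v)"
  unfolding contraction_def
proof
  fix x :: "complex vec" assume "x \<in> carrier_vec (dim_col (proj v))"
  then have x: "x \<in> carrier_vec n" using assms by (simp add: proj_def)
  show "vnorm (proj v *\<^sub>v x) \<le> vnorm x"
    using cinner_le_vnorm[OF x assms(1)] by (simp add: proj_mult_vec[OF assms(1) x] vnorm_smult assms(2))
qed

text \<open>The form is the trace of a rank-one projection times \<open>Z\<close>, and such a
  projection is a contraction.\<close>

lemma psd_form_le_trace:
  assumes Z: "psd n Z" and v: "v \<in> carrier_vec n" "vnorm v = 1"
  shows "Re ((Z *\<^sub>v v) \<bullet>c v) \<le> Re (mat_trace Z)"
proof -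
  note cZ = psd_carrier[OF Z]
  have "(Z *\<^sub>v v) \<bullet>c v = mat_trace (Z * proj v)"
    using cZ v unfolding quadratic_form_index[OF cZ v(1)]
    by (subst trace_index[of _ n])
      (auto simp: mult_index[OF cZ proj_carrier[OF v(1)]] proj_index[OF v(1)] mult.assoc simp del: index_mult_mat(1) intro!: sum.cong)
  also have "\<dots> = mat_trace (proj v * Z)" using cZ v by (intro trace_comm[of _ n n]) auto
  finally have "Re ((Z *\<^sub>v v) \<bullet>c v) \<le> cmod (mat_trace (proj v * Z))" by (simp add: complex_Re_le_cmod)
  also have "\<dots> \<le> Re (mat_trace Z)"
    using contraction_proj[OF v] v Z by (intro trace_contraction_psd_le[of _ n]) auto
  finally show ?thesis .
qed

section \<open>Channels on matrix units, incoherent states and the dual operator\<close>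

definition ket_bra :: "nat \<Rightarrow> nat \<Rightarrow> nat \<Rightarrow> complex mat" where
  "ket_bra d a b = mat d d (\<lambda>(i, j). if i = a \<and> j = b then 1 else 0)"

lemma ket_bra_carrier [simp]: "ket_bra d a b \<in> carrier_mat d d"
  by (simp add: ket_bra_def)

text \<open>Induction over the set of positions at which the entries of \<open>X\<close> are
  retained.\<close>

lemma linear_on_ops_expand:
  assumes lin: "linear_on_ops d m \<Lambda>" and X: "X \<in> carrier_mat d d" and pq: "p < m" "q < m"
  shows "\<Lambda> X $$ (p, q) = (\<Sum>a<d. \<Sum>b<d. X $$ (a, b) * \<Lambda> (ket_bra d a b) $$ (p, q))"
proof -
  define R where "R F = mat d d (\<lambda>(a, b). if (a, b) \<in> F then X $$ (a, b) else 0)" for F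
  have R: "R F \<in> carrier_mat d d" for F by (simp add: R_def)
  have "F \<subseteq> {..<d} \<times> {..<d} \<Longrightarrow>
      \<Lambda> (R F) $$ (p, q) = (\<Sum>(a, b)\<in>F. X $$ (a, b) * \<Lambda> (ket_bra d a b) $$ (p, q))" if "finite F" for F
    using that
  proof (induction F)
    case empty
    \<comment> \<open>Writing zero as a multiple lets homogeneity determine its image.\<close>
    have "R {} = 0 \<cdot>\<^sub>m X" using X by (auto simp: R_def)
    then have "\<Lambda> (R {}) = 0 \<cdot>\<^sub>m \<Lambda> X" using lin X by (simp add: linear_on_ops_def)
    moreover have "\<Lambda> X \<in> carrier_mat m m" using lin X by (simp add: linear_on_ops_def)
    ultimately show ?case using pq by auto
  next
    case (insert ab F)
    obtain a b where ab: "ab = (a, b)" by (cases ab)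
    have "R (insert ab F) = R F + X $$ (a, b) \<cdot>\<^sub>m ket_bra d a b"
      using insert.hyps by (auto simp: R_def ket_bra_def ab intro!: eq_matI)
    then have "\<Lambda> (R (insert ab F)) = \<Lambda> (R F) + X $$ (a, b) \<cdot>\<^sub>m \<Lambda> (ket_bra d a b)"
      using lin R by (simp add: linear_on_ops_def)
    moreover have "\<Lambda> (R F) \<in> carrier_mat m m" "\<Lambda> (ket_bra d a b) \<in> carrier_mat m m"
      using lin R by (auto simp: linear_on_ops_def)
    ultimately show ?case using insert pq by (auto simp: ab)
  qed
  from this[of "{..<d} \<times> {..<d}"]
  have "\<Lambda> (R ({..<d} \<times> {..<d})) $$ (p, q) =
      (\<Sum>(a, b)\<in>{..<d} \<times> {..<d}. X $$ (a, b) * \<Lambda> (ket_bra d a b) $$ (p, q))" by simp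
  moreover have "R ({..<d} \<times> {..<d}) = X" using X by (auto simp: R_def)
  ultimately show ?thesis by (simp add: sum.cartesian_product)
qed

lemma channel_carrier: "\<Lambda> \<in> channels d m \<Longrightarrow> X \<in> carrier_mat d d \<Longrightarrow> \<Lambda> X \<in> carrier_mat m m"
  by (simp add: channels_def linear_on_ops_def)

lemma channel_trace: "\<Lambda> \<in> channels d m \<Longrightarrow> X \<in> carrier_mat d d \<Longrightarrow> mat_trace (\<Lambda> X) = mat_trace X"
  by (simp add: channels_def trace_preserving_def)

text \<open>Complete positivity with a one-dimensional ancilla.\<close>

lemma channel_psd:
  assumes \<Lambda>: "\<Lambda> \<in> channels d m" and X: "psd d X"
  shows "psd m (\<Lambda> X)"
proof -
  note cX = psd_carrier[OF X]
  have "psd (1 * d) X" using X by simp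
  then have "psd (1 * m) (ampliate 1 d m \<Lambda> X)"
    using \<Lambda> unfolding channels_def completely_positive_def by blast
  moreover have "block d X 0 0 = X" using cX by (auto simp: block_def)
  then have "ampliate 1 d m \<Lambda> X = \<Lambda> X"
    using channel_carrier[OF \<Lambda> cX] by (auto simp: ampliate_def)
  ultimately show ?thesis by simp
qed

lemma proj_psd:
  assumes "v \<in> carrier_vec n"
  shows "psd n (proj v)"
proof -
  let ?A = "mat n 1 (\<lambda>(i, _). v $ i)"
  have "?A * ?A\<^sup>\<dagger> = proj v"
    using assms by (auto simp: proj_def scalar_prod_def intro!: eq_matI)
  then show ?thesis using psd_gram[of ?A n 1] by simp
qed

lemma proj_trace: "v \<in> carrier_vec n \<Longrightarrow> mat_trace (proj v) = complex_of_real ((vnorm v)\<^sup>2)"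
  unfolding cinner_self[symmetric] by (auto simp: cinner_index mat_trace_def proj_def)

lemma ket_bra_proj: "a < d \<Longrightarrow> ket_bra d a a = proj (unit_vec d a)"
  by (auto simp: ket_bra_def proj_def)

lemma dephase_index:
  "X \<in> carrier_mat n n \<Longrightarrow> i < n \<Longrightarrow> j < n \<Longrightarrow> dephase X $$ (i, j) = (if i = j then X $$ (i, i) else 0)"
  by (auto simp: dephase_def mat_diag_def)

lemma dephase_carrier [simp]: "X \<in> carrier_mat n n \<Longrightarrow> dephase X \<in> carrier_mat n n"
  by (auto simp: dephase_def)

lemma incoherent_offdiag:
  assumes "\<omega> \<in> incoherent_states n" "i < n" "j < n" "i \<noteq> j"
  shows "\<omega> $$ (i, j) = 0"
proof -
  have "\<omega> \<in> carrier_mat n n" "\<omega> = dephase \<omega>"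
    using assms by (auto simp: incoherent_states_def density_def psd_def)
  then show ?thesis using dephase_index[of \<omega> n i j] assms by simp
qed

lemma incoherent_ket_bra: "a < d \<Longrightarrow> ket_bra d a a \<in> incoherent_states d"
  using proj_psd[of "unit_vec d a" d] proj_trace[of "unit_vec d a" d]
  by (auto simp: incoherent_states_def density_def ket_bra_proj)
    (auto simp: dephase_def proj_def mat_diag_def unit_vec_def)

lemma kraus_offdiag:
  assumes "kraus_decomposition d m r K \<Lambda>" "\<forall>l<r. incoherent_operator d m (K l)"
    and "\<omega> \<in> incoherent_states d" "i < m" "j < m" "i \<noteq> j"
  shows "\<Lambda> \<omega> $$ (i, j) = 0"
proof -
  have \<omega>: "\<omega> \<in> carrier_mat d d" using assms(3) by (auto simp: incoherent_states_def density_def psd_def)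
  have "(K l * \<omega> * (K l)\<^sup>\<dagger>) $$ (i, j) = 0" if l: "l < r" for l
  proof -
    obtain c \<tau> where \<tau>: "\<tau> \<in> incoherent_states m" "K l * \<omega> * (K l)\<^sup>\<dagger> = complex_of_real c \<cdot>\<^sub>m \<tau>"
      using assms(2,3) l unfolding incoherent_operator_def by metis
    then show ?thesis
      using incoherent_offdiag[OF \<tau>(1) assms(4-6)] assms(4-6)
      by (auto simp: incoherent_states_def density_def psd_def)
  qed
  then show ?thesis using assms \<omega> by (auto simp: kraus_decomposition_def mat_sum_def)
qed

lemma free_operation_channel: "\<Lambda> \<in> free_operations \<O> d m \<Longrightarrow> \<Lambda> \<in> channels d m"
  by (cases \<O>) auto

text \<open>Besides being a channel, this is what the upper bound uses of a free operation, and it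
  is common to all four classes.\<close>

lemma free_operation_offdiag:
  assumes \<Lambda>: "\<Lambda> \<in> free_operations \<O> d m" and \<omega>: "\<omega> \<in> incoherent_states d"
    and ij: "i < m" "j < m" "i \<noteq> j"
  shows "\<Lambda> \<omega> $$ (i, j) = 0"
proof (cases \<O>)
  case MIO
  then show ?thesis using incoherent_offdiag[OF _ ij] \<Lambda> \<omega> by simp
next
  case DIO
  then have "dephase (\<Lambda> \<omega>) = \<Lambda> \<omega>" using \<Lambda> \<omega> by (simp add: incoherent_states_def)
  moreover have "\<Lambda> \<omega> \<in> carrier_mat m m"
    using channel_carrier[OF free_operation_channel[OF \<Lambda>]] \<omega>
    by (auto simp: incoherent_states_def density_def psd_def)
  ultimately show ?thesis using dephase_index[of "\<Lambda> \<omega>" m i j] ij by simp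
next
  case IO
  then show ?thesis using kraus_offdiag[OF _ _ \<omega> ij] \<Lambda> by auto
next
  case SIO
  then show ?thesis using kraus_offdiag[OF _ _ \<omega> ij] \<Lambda> by auto
qed

lemma channel_flat_value:
  assumes \<Lambda>: "\<Lambda> \<in> channels d m" and m: "1 \<le> m" and v: "v \<in> carrier_vec d"
  shows "0 \<le> flat_value m (\<Lambda> (proj v))" "Re (flat_value m (\<Lambda> (proj v))) \<le> (vnorm v)\<^sup>2"
proof -
  have Z: "psd m (\<Lambda> (proj v))" using channel_psd[OF \<Lambda> proj_psd[OF v]] .
  note form = flat_value_form[OF psd_carrier[OF Z] m]
  show "0 \<le> flat_value m (\<Lambda> (proj v))"
    unfolding form using flat_vec_unit[OF m] by (intro psdD[OF Z])
  have "Re (flat_value m (\<Lambda> (proj v))) \<le> Re (mat_trace (\<Lambda> (proj v)))"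
    unfolding form using flat_vec_unit[OF m] by (intro psd_form_le_trace[OF Z])
  also have "\<dots> = (vnorm v)\<^sup>2" using channel_trace[OF \<Lambda>] v by (simp add: proj_trace)
  finally show "Re (flat_value m (\<Lambda> (proj v))) \<le> (vnorm v)\<^sup>2" .
qed

text \<open>The matrix \<open>M\<close> is the adjoint channel applied to the maximally coherent state.\<close>

lemma free_operation_dual:
  assumes \<Lambda>: "\<Lambda> \<in> free_operations \<O> d m" and m: "1 \<le> m"
  obtains M where "psd d M" "\<And>v. v \<in> carrier_vec d \<Longrightarrow> Re ((M *\<^sub>v v) \<bullet>c v) \<le> (vnorm v)\<^sup>2"
    "\<And>i. i < d \<Longrightarrow> M $$ (i, i) = complex_of_real (1 / real m)"
    "\<And>v. v \<in> carrier_vec d \<Longrightarrow> flat_value m (\<Lambda> (proj v)) = (M *\<^sub>v v) \<bullet>c v"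
proof -
  note ch = free_operation_channel[OF \<Lambda>]
  have lin: "linear_on_ops d m \<Lambda>" using ch by (simp add: channels_def)
  \<comment> \<open>The indices are exchanged because entry \<open>(i, j)\<close> of
    \<open>M\<close> multiplies \<open>v $ j * cnj (v $ i)\<close>, which is entry
    \<open>(j, i)\<close> of \<open>proj v\<close>.\<close>
  define M where "M = mat d d (\<lambda>(i, j). flat_value m (\<Lambda> (ket_bra d j i)))"
  have cM: "M \<in> carrier_mat d d" by (simp add: M_def)
  have form: "flat_value m (\<Lambda> (proj v)) = (M *\<^sub>v v) \<bullet>c v" if v: "v \<in> carrier_vec d" for v
  proof -
    have "flat_value m (\<Lambda> (proj v)) = (\<Sum>p<m. \<Sum>q<m. \<Sum>a<d. \<Sum>b<d.
        v $ a * cnj (v $ b) * \<Lambda> (ket_bra d a b) $$ (p, q)) / complex_of_real (real m)"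
      unfolding flat_value_def using v
      by (auto simp: linear_on_ops_expand[OF lin proj_carrier[OF v]] proj_index[OF v] intro!: sum.cong arg_cong2[of _ _ _ _ "(/)"])
    also have "(\<Sum>p<m. \<Sum>q<m. \<Sum>a<d. \<Sum>b<d. v $ a * cnj (v $ b) * \<Lambda> (ket_bra d a b) $$ (p, q)) =
        (\<Sum>p<m. \<Sum>a<d. \<Sum>b<d. \<Sum>q<m. v $ a * cnj (v $ b) * \<Lambda> (ket_bra d a b) $$ (p, q))"
      by (rule sum.cong[OF refl], rule trans[OF sum.swap], rule sum.cong[OF refl], rule sum.swap)
    also have "\<dots> = (\<Sum>a<d. \<Sum>b<d. \<Sum>p<m. \<Sum>q<m. v $ a * cnj (v $ b) * \<Lambda> (ket_bra d a b) $$ (p, q))"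
      by (rule trans[OF sum.swap], rule sum.cong[OF refl], rule sum.swap)
    also have "\<dots> / complex_of_real (real m) = (\<Sum>a<d. \<Sum>b<d. M $$ (b, a) * v $ a * cnj (v $ b))"
      by (auto simp: M_def flat_value_def sum_divide_distrib sum_distrib_left sum_distrib_right algebra_simps intro!: sum.cong)
    also have "\<dots> = (M *\<^sub>v v) \<bullet>c v"
      unfolding quadratic_form_index[OF cM v] by (rule sum.swap)
    finally show ?thesis .
  qed
  show thesis
  proof (rule that[OF _ _ _ form])
    show "psd d M" unfolding psd_def using cM channel_flat_value(1)[OF ch m] form by auto
    show "Re ((M *\<^sub>v v) \<bullet>c v) \<le> (vnorm v)\<^sup>2" if "v \<in> carrier_vec d" for v
      using channel_flat_value(2)[OF ch m that] form[OF that] by simp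
    show "M $$ (i, i) = complex_of_real (1 / real m)" if i: "i < d" for i
    proof -
      let ?Z = "\<Lambda> (ket_bra d i i)"
      have Z: "?Z \<in> carrier_mat m m" using channel_carrier[OF ch] by simp
      \<comment> \<open>The image of a basis state is diagonal, so the sum of all its entries is its
        trace, which is 1.\<close>
      have "(\<Sum>p<m. \<Sum>q<m. ?Z $$ (p, q)) = (\<Sum>p<m. \<Sum>q<m. if q = p then ?Z $$ (p, p) else 0)"
        using free_operation_offdiag[OF \<Lambda> incoherent_ket_bra[OF i]] by (intro sum.cong) auto
      also have "\<dots> = mat_trace ?Z" using Z by (simp add: trace_index)
      also have "\<dots> = mat_trace (ket_bra d i i)" by (rule channel_trace[OF ch]) simp
      also have "\<dots> = 1" using i by (simp add: ket_bra_proj proj_trace[of _ d])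
      finally show ?thesis using i by (simp add: M_def flat_value_def)
    qed
  qed
qed

subsection \<open>Strictly incoherent Kraus maps\<close>

definition kraus_map :: "nat \<Rightarrow> nat \<Rightarrow> (nat \<Rightarrow> complex mat) \<Rightarrow> complex mat \<Rightarrow> complex mat" where
  "kraus_map m r K X = mat_sum m r (\<lambda>l. K l * X * (K l)\<^sup>\<dagger>)"

lemma mat_sum_carrier [simp]: "mat_sum n r A \<in> carrier_mat n n"
  by (simp add: mat_sum_def)

lemma mat_sum_index: "i < n \<Longrightarrow> j < n \<Longrightarrow> mat_sum n r A $$ (i, j) = (\<Sum>l<r. A l $$ (i, j))"
  by (simp add: mat_sum_def)

lemma conj_mult_index:
  assumes "K \<in> carrier_mat m d" "X \<in> carrier_mat d d" "a < m" "b < m"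
  shows "(K * X * K\<^sup>\<dagger>) $$ (a, b) = (\<Sum>i<d. \<Sum>j<d. K $$ (a, i) * X $$ (i, j) * cnj (K $$ (b, j)))"
proof -
  have KX: "K * X \<in> carrier_mat m d" using assms by auto
  have "(K * X * K\<^sup>\<dagger>) $$ (a, b) = (\<Sum>j<d. (K * X) $$ (a, j) * K\<^sup>\<dagger> $$ (j, b))"
    using assms KX by (intro mult_index[of _ m d _ m]) auto
  also have "\<dots> = (\<Sum>j<d. \<Sum>i<d. K $$ (a, i) * X $$ (i, j) * cnj (K $$ (b, j)))"
    using assms by (intro sum.cong refl) (simp add: mult_index[of K m d X d] sum_distrib_right del: index_mult_mat(1))
  finally show ?thesis by (subst sum.swap)
qed

lemma kraus_map_index:
  assumes "\<And>l. l < r \<Longrightarrow> K l \<in> carrier_mat m d" "X \<in> carrier_mat d d" "a < m" "b < m"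
  shows "kraus_map m r K X $$ (a, b) =
    (\<Sum>l<r. \<Sum>i<d. \<Sum>j<d. K l $$ (a, i) * X $$ (i, j) * cnj (K l $$ (b, j)))"
  using assms by (simp add: kraus_map_def mat_sum_index conj_mult_index[of _ m d] del: index_mult_mat(1))

lemma kraus_map_carrier [simp]: "kraus_map m r K X \<in> carrier_mat m m"
  by (simp add: kraus_map_def)

lemma psd_mat_sum:
  assumes "\<And>l. l < r \<Longrightarrow> psd n (A l)"
  shows "psd n (mat_sum n r A)"
  unfolding psd_def
proof safe
  fix v :: "complex vec" assume v: "v \<in> carrier_vec n"
  have "(mat_sum n r A *\<^sub>v v) \<bullet>c v = (\<Sum>i<n. \<Sum>j<n. \<Sum>l<r. A l $$ (i, j) * v $ j * cnj (v $ i))"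
    unfolding quadratic_form_index[OF mat_sum_carrier v] by (simp add: mat_sum_index sum_distrib_right)
  also have "\<dots> = (\<Sum>l<r. \<Sum>i<n. \<Sum>j<n. A l $$ (i, j) * v $ j * cnj (v $ i))"
    by (subst (2) sum.swap, subst sum.swap, rule refl)
  also have "\<dots> = (\<Sum>l<r. (A l *\<^sub>v v) \<bullet>c v)"
    by (intro sum.cong refl quadratic_form_index[symmetric] v psd_carrier assms) simp
  also have "0 \<le> \<dots>" using assms v by (intro sum_nonneg psdD) auto
  finally show "0 \<le> (mat_sum n r A *\<^sub>v v) \<bullet>c v" .
qed simp

lemma kraus_map_linear:
  assumes K: "\<And>l. l < r \<Longrightarrow> K l \<in> carrier_mat m d"
  shows "linear_on_ops d m (kraus_map m r K)"
  unfolding linear_on_ops_def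
proof safe
  fix X Y :: "complex mat" assume "X \<in> carrier_mat d d" "Y \<in> carrier_mat d d"
  then show "kraus_map m r K (X + Y) = kraus_map m r K X + kraus_map m r K Y"
    using carrier_matD[OF kraus_map_carrier[of m r K]]
    by (intro eq_matI) (auto simp: kraus_map_index[of r K m d] K distrib_left distrib_right sum.distrib)
next
  fix c and X :: "complex mat" assume "X \<in> carrier_mat d d"
  then show "kraus_map m r K (c \<cdot>\<^sub>m X) = c \<cdot>\<^sub>m kraus_map m r K X"
    using carrier_matD[OF kraus_map_carrier[of m r K]]
    by (intro eq_matI) (auto simp: kraus_map_index[of r K m d] K sum_distrib_left algebra_simps)
qed simp

lemma block_gram:
  assumes E: "E \<in> carrier_mat (k * d) s" and ab: "a < k" "b < k"
  shows "block d (E * E\<^sup>\<dagger>) a b =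
    mat d s (\<lambda>(i, t). E $$ (a * d + i, t)) * (mat d s (\<lambda>(i, t). E $$ (b * d + i, t)))\<^sup>\<dagger>"
    (is "_ = ?E a * (?E b)\<^sup>\<dagger>")
proof (rule eq_matI)
  fix i j assume "i < dim_row (?E a * (?E b)\<^sup>\<dagger>)" "j < dim_col (?E a * (?E b)\<^sup>\<dagger>)"
  then have ij: "i < d" "j < d" by auto
  have lt: "c * d + x < k * d" if "c < k" "x < d" for c x
  proof -
    have "c * d + x < Suc c * d" using that by simp
    also have "\<dots> \<le> k * d" using that by (intro mult_le_mono1) simp
    finally show ?thesis .
  qed
  have "(E * E\<^sup>\<dagger>) $$ (a * d + i, b * d + j) = (\<Sum>t<s. E $$ (a * d + i, t) * cnj (E $$ (b * d + j, t)))"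
    using E lt[OF ab(1) ij(1)] lt[OF ab(2) ij(2)] by (subst mult_index[of _ "k * d" s _ "k * d"]) auto
  also have "\<dots> = (?E a * (?E b)\<^sup>\<dagger>) $$ (i, j)"
    using ij by (subst mult_index[of _ d s _ d]) auto
  finally show "block d (E * E\<^sup>\<dagger>) a b $$ (i, j) = (?E a * (?E b)\<^sup>\<dagger>) $$ (i, j)"
    using ij by (simp add: block_def)
qed (auto simp: block_def)

text \<open>A Gram factor of the input yields one for every Kraus term: \<open>F l\<close> stacks
  the products of \<open>K l\<close> with the row blocks of \<open>E\<close>. This plays the part of
  tensoring \<open>K l\<close> with the identity.\<close>

lemma kraus_map_completely_positive:
  assumes K: "\<And>l. l < r \<Longrightarrow> K l \<in> carrier_mat m d"
  shows "completely_positive d m (kraus_map m r K)"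
  unfolding completely_positive_def
proof (intro allI impI)
  fix k X assume X: "psd (k * d) X"
  obtain s E where E: "E \<in> carrier_mat (k * d) s" "X = E * E\<^sup>\<dagger>" using psd_gram_exists[OF X] .
  define B where "B = (\<lambda>a. mat d s (\<lambda>(i, t). E $$ (a * d + i, t)))"
  have B: "B a \<in> carrier_mat d s" for a by (simp add: B_def)
  define F where "F = (\<lambda>l. mat (k * m) s (\<lambda>(x, t). (K l * B (x div m)) $$ (x mod m, t)))"
  have F: "F l \<in> carrier_mat (k * m) s" for l by (simp add: F_def)
  have "ampliate k d m (kraus_map m r K) X = mat_sum (k * m) r (\<lambda>l. F l * (F l)\<^sup>\<dagger>)"
  proof (rule eq_matI)
    fix x y assume "x < dim_row (mat_sum (k * m) r (\<lambda>l. F l * (F l)\<^sup>\<dagger>))"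
      "y < dim_col (mat_sum (k * m) r (\<lambda>l. F l * (F l)\<^sup>\<dagger>))"
    then have xy: "x < k * m" "y < k * m" by (auto simp: mat_sum_def)
    then have "0 < m" by (cases m) auto
    then have dm: "x div m < k" "y div m < k" "x mod m < m" "y mod m < m"
      using xy by (auto simp: less_mult_imp_div_less)
    let ?a = "x div m" and ?b = "y div m"
    have blk: "block d X ?a ?b = B ?a * (B ?b)\<^sup>\<dagger>"
      unfolding E(2) B_def using block_gram[OF E(1) dm(1,2)] .
    have "(K l * (B ?a * (B ?b)\<^sup>\<dagger>) * (K l)\<^sup>\<dagger>) $$ (x mod m, y mod m) = (F l * (F l)\<^sup>\<dagger>) $$ (x, y)"
      if l: "l < r" for l
    proof -
      have KB: "K l * B a \<in> carrier_mat m s" for a using K[OF l] B by auto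
      have "K l * (B ?a * (B ?b)\<^sup>\<dagger>) * (K l)\<^sup>\<dagger> = (K l * B ?a) * (K l * B ?b)\<^sup>\<dagger>"
        unfolding adjoint_mult[OF K[OF l] B] using carrier_matD[OF K[OF l]] carrier_matD[OF B]
        by (simp add: assoc_mult_mat_dim)
      also have "\<dots> $$ (x mod m, y mod m) =
          (\<Sum>t<s. (K l * B ?a) $$ (x mod m, t) * cnj ((K l * B ?b) $$ (y mod m, t)))"
        using KB[of ?b] KB[of ?a] dm K[OF l] B[of ?b] 
        by (subst mult_index[of _ m s _ m]) (auto simp del: index_mult_mat(1))
      also have "\<dots> = (F l * (F l)\<^sup>\<dagger>) $$ (x, y)"
        using xy F[of l] by (subst mult_index[of _ "k * m" s _ "k * m"])
          (auto simp: F_def simp del: index_mult_mat(1))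
      finally show ?thesis .
    qed
    then show "ampliate k d m (kraus_map m r K) X $$ (x, y) = mat_sum (k * m) r (\<lambda>l. F l * (F l)\<^sup>\<dagger>) $$ (x, y)"
      using xy dm by (simp add: ampliate_def blk kraus_map_def mat_sum_index del: index_mult_mat(1))
  qed (auto simp: ampliate_def mat_sum_def)
  then show "psd (k * m) (ampliate k d m (kraus_map m r K) X)"
    using psd_mat_sum[of r "k * m" "\<lambda>l. F l * (F l)\<^sup>\<dagger>"] psd_gram[OF F] by simp
qed

text \<open>Basis vectors go to multiples of basis vectors. Demanded of the adjoint as well, this is
  strict incoherence in terms of entries.\<close>

definition monomial_cols :: "complex mat \<Rightarrow> bool" where
  "monomial_cols K \<longleftrightarrow> (\<forall>i<dim_col K. \<forall>a<dim_row K. \<forall>b<dim_row K.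
     K $$ (a, i) \<noteq> 0 \<longrightarrow> K $$ (b, i) \<noteq> 0 \<longrightarrow> a = b)"

lemma monomial_cols_conj_offdiag:
  assumes K: "K \<in> carrier_mat m d" "monomial_cols K" and X: "X \<in> carrier_mat d d"
    "\<And>i j. i < d \<Longrightarrow> j < d \<Longrightarrow> i \<noteq> j \<Longrightarrow> X $$ (i, j) = 0" and ab: "a < m" "b < m" "a \<noteq> b"
  shows "(K * X * K\<^sup>\<dagger>) $$ (a, b) = 0"
proof -
  have "K $$ (a, i) * X $$ (i, j) * cnj (K $$ (b, j)) = 0" if "i < d" "j < d" for i j
    using K X(2)[OF that] ab that unfolding monomial_cols_def by (cases "i = j") auto
  then show ?thesis unfolding conj_mult_index[OF K(1) X(1) ab(1,2)] by (intro sum.neutral ballI) simp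
qed

text \<open>Only the diagonal of \<open>X\<close> enters, which yields the diagonal half of
  commuting with dephasing.\<close>

lemma monomial_rows_conj_diag:
  assumes K: "K \<in> carrier_mat m d" "monomial_cols (K\<^sup>\<dagger>)" and X: "X \<in> carrier_mat d d" and a: "a < m"
  shows "(K * X * K\<^sup>\<dagger>) $$ (a, a) = (\<Sum>i<d. complex_of_real ((cmod (K $$ (a, i)))\<^sup>2) * X $$ (i, i))"
proof -
  have rows: "K $$ (a, i) = 0 \<or> K $$ (a, j) = 0" if "i < d" "j < d" "i \<noteq> j" for i j
    using K that a unfolding monomial_cols_def by auto
  have "(K * X * K\<^sup>\<dagger>) $$ (a, a) = (\<Sum>i<d. \<Sum>j<d. if j = i then K $$ (a, i) * X $$ (i, i) * cnj (K $$ (a, i)) else 0)"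
    unfolding conj_mult_index[OF K(1) X a a] using rows by (intro sum.cong refl) force
  also have "\<dots> = (\<Sum>i<d. complex_of_real ((cmod (K $$ (a, i)))\<^sup>2) * X $$ (i, i))"
    by (intro sum.cong refl) (auto simp: complex_norm_square algebra_simps simp del: of_real_power)
  finally show ?thesis .
qed

lemma monomial_cols_incoherent:
  assumes K: "K \<in> carrier_mat m d" "monomial_cols K" and m: "1 \<le> m"
  shows "incoherent_operator d m K"
  unfolding incoherent_operator_def
proof safe
  fix \<sigma> assume \<sigma>: "\<sigma> \<in> incoherent_states d"
  then have psd: "psd d \<sigma>" by (simp add: incoherent_states_def density_def)
  note c\<sigma> = psd_carrier[OF psd]
  let ?Z = "K * \<sigma> * K\<^sup>\<dagger>"
  have cZ: "?Z \<in> carrier_mat m m" using K c\<sigma> by auto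
  obtain r E where E: "E \<in> carrier_mat d r" "\<sigma> = E * E\<^sup>\<dagger>" using psd_gram_exists[OF psd] .
  have "?Z = (K * E) * (K * E)\<^sup>\<dagger>"
    unfolding adjoint_mult[OF K(1) E(1)] E(2) using carrier_matD[OF K(1)] carrier_matD[OF E(1)]
    by (simp add: assoc_mult_mat_dim)
  then have psdZ: "psd m ?Z" using psd_gram[of "K * E" m r] K E by (simp add: mult_carrier_mat[of K m d E r])
  define c where "c = Re (mat_trace ?Z)"
  have "0 \<le> mat_trace ?Z" unfolding trace_index[OF cZ] using psd_diag[OF psdZ] by (intro sum_nonneg) auto
  then have c: "0 \<le> c" "mat_trace ?Z = complex_of_real c"
    by (auto simp: c_def less_eq_complex_def complex_eq_iff)
  have off: "?Z $$ (a, b) = 0" if "a < m" "b < m" "a \<noteq> b" for a b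
    using incoherent_offdiag[OF \<sigma>] that by (intro monomial_cols_conj_offdiag[OF K c\<sigma>]) auto
  show "\<exists>c. \<exists>\<tau>\<in>incoherent_states m. 0 \<le> c \<and> ?Z = complex_of_real c \<cdot>\<^sub>m \<tau>"
  proof (cases "c = 0")
    case True
    then have "?Z = 0\<^sub>m m m" using psd_trace_eq_0[OF psdZ] c by simp
    \<comment> \<open>A witness state is demanded even with factor zero; \<open>1 \<le> m\<close>
      supplies a basis state.\<close>
    then have "?Z = complex_of_real 0 \<cdot>\<^sub>m ket_bra m 0 0" by (auto intro!: eq_matI simp: ket_bra_def)
    then show ?thesis using incoherent_ket_bra[of 0 m] m by (intro exI[of _ 0] bexI[of _ "ket_bra m 0 0"]) auto
  next
    case False
    let ?\<tau> = "complex_of_real (1 / c) \<cdot>\<^sub>m ?Z"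
    have c\<tau>: "?\<tau> \<in> carrier_mat m m" using cZ by simp
    have "psd m ?\<tau>"
      unfolding psd_def
    proof safe
      fix v :: "complex vec" assume v: "v \<in> carrier_vec m"
      have "(?\<tau> *\<^sub>v v) \<bullet>c v = complex_of_real (1 / c) * ((?Z *\<^sub>v v) \<bullet>c v)"
        using cZ v by (subst smult_mat_mult_vec[OF cZ v]) (intro cinner_smult_left[of _ m] mult_mat_vec_carrier[of _ m m])
      also have "0 \<le> \<dots>" using psdD[OF psdZ v] c(1) by (intro mult_nonneg_nonneg) (auto simp: less_eq_complex_def)
      finally show "0 \<le> (?\<tau> *\<^sub>v v) \<bullet>c v" .
    qed (rule c\<tau>)
    moreover have "mat_trace ?\<tau> = 1" using trace_smult[OF cZ] c False by simp
    moreover have "?\<tau> = dephase ?\<tau>"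
    proof (rule eq_matI)
      fix i j assume "i < dim_row (dephase ?\<tau>)" "j < dim_col (dephase ?\<tau>)"
      then have ij: "i < m" "j < m" using carrier_matD[OF dephase_carrier[OF c\<tau>]] by auto
      then show "?\<tau> $$ (i, j) = dephase ?\<tau> $$ (i, j)"
        unfolding dephase_index[OF c\<tau> ij] using off[OF ij] cZ by auto
    qed (use carrier_matD[OF dephase_carrier[OF c\<tau>]] carrier_matD[OF c\<tau>] in simp_all)
    ultimately have "?\<tau> \<in> incoherent_states m" by (simp add: incoherent_states_def density_def)
    moreover have "?Z = complex_of_real c \<cdot>\<^sub>m ?\<tau>" using False by (intro eq_matI) (auto simp del: index_mult_mat(1))
    ultimately show ?thesis using c(1) by blast
  qed
qed fact

text \<open>Monomial rows make every \<open>(K l)\<^sup>\<dagger> * K l\<close> diagonal, so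
  \<open>norm\<close> is the whole completeness relation. Monomial rows and columns together give
  both strict incoherence and commutation with dephasing, and thereby membership in each
  class.\<close>

lemma kraus_map_free:
  assumes K: "\<And>l. l < r \<Longrightarrow> K l \<in> carrier_mat m d"
    and cols: "\<And>l. l < r \<Longrightarrow> monomial_cols (K l)" and rows: "\<And>l. l < r \<Longrightarrow> monomial_cols ((K l)\<^sup>\<dagger>)"
    and norm: "\<And>i. i < d \<Longrightarrow> (\<Sum>l<r. \<Sum>a<m. (cmod (K l $$ (a, i)))\<^sup>2) = 1"
    and m: "1 \<le> m" and d: "1 \<le> d"
  shows "kraus_map m r K \<in> free_operations \<O> d m"
proof -
  let ?\<Lambda> = "kraus_map m r K"
  have diag: "?\<Lambda> X $$ (a, a) = (\<Sum>l<r. \<Sum>i<d. complex_of_real ((cmod (K l $$ (a, i)))\<^sup>2) * X $$ (i, i))"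
    if "X \<in> carrier_mat d d" "a < m" for X a
    using that K rows by (simp add: kraus_map_def mat_sum_index monomial_rows_conj_diag[of _ m d] del: index_mult_mat(1))
  have tr: "mat_trace (?\<Lambda> X) = mat_trace X" if X: "X \<in> carrier_mat d d" for X
  proof -
    have "mat_trace (?\<Lambda> X) = (\<Sum>a<m. \<Sum>l<r. \<Sum>i<d. complex_of_real ((cmod (K l $$ (a, i)))\<^sup>2) * X $$ (i, i))"
      by (simp add: trace_index[of _ m] diag X)
    also have "\<dots> = (\<Sum>l<r. \<Sum>i<d. \<Sum>a<m. complex_of_real ((cmod (K l $$ (a, i)))\<^sup>2) * X $$ (i, i))"
      by (rule trans[OF sum.swap], rule sum.cong[OF refl], rule sum.swap)
    also have "\<dots> = (\<Sum>i<d. \<Sum>l<r. \<Sum>a<m. complex_of_real ((cmod (K l $$ (a, i)))\<^sup>2) * X $$ (i, i))"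
      by (rule sum.swap)
    also have "\<dots> = (\<Sum>i<d. complex_of_real (\<Sum>l<r. \<Sum>a<m. (cmod (K l $$ (a, i)))\<^sup>2) * X $$ (i, i))"
      by (simp add: sum_distrib_right)
    also have "\<dots> = mat_trace X" using norm X by (simp add: trace_index)
    finally show ?thesis .
  qed
  have channel: "?\<Lambda> \<in> channels d m"
    using kraus_map_linear[of r K m d] kraus_map_completely_positive[of r K m d] K tr
    by (simp add: channels_def trace_preserving_def)
  have dephase: "dephase (?\<Lambda> X) = ?\<Lambda> (dephase X)" if X: "X \<in> carrier_mat d d" for X
  proof (rule eq_matI)
    note dX = dephase_carrier[OF X]
    fix a b assume "a < dim_row (?\<Lambda> (dephase X))" "b < dim_col (?\<Lambda> (dephase X))"
    then have ab: "a < m" "b < m" using carrier_matD[OF kraus_map_carrier[of m r K]] by auto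
    show "dephase (?\<Lambda> X) $$ (a, b) = ?\<Lambda> (dephase X) $$ (a, b)"
    proof (cases "a = b")
      case True
      then show ?thesis
        using ab X dX by (simp add: dephase_index[of _ m] diag dephase_index[of _ d])
    next
      case False
      have "(K l * dephase X * (K l)\<^sup>\<dagger>) $$ (a, b) = 0" if "l < r" for l
        using K[OF that] cols[OF that] dX ab False X
        by (intro monomial_cols_conj_offdiag[of _ m d]) (auto simp: dephase_index[of _ d])
      then show ?thesis
        using ab False by (simp add: dephase_index[of _ m] kraus_map_def mat_sum_index del: index_mult_mat(1))
    qed
  qed (use carrier_matD[OF kraus_map_carrier[of m r K]] carrier_matD[OF dephase_carrier[OF kraus_map_carrier[of m r K]]] in simp_all)
  have "kraus_decomposition d m r K ?\<Lambda>" using K by (simp add: kraus_decomposition_def kraus_map_def)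
  moreover have "incoherent_operator d m (K l) \<and> incoherent_operator m d ((K l)\<^sup>\<dagger>)" if "l < r" for l
    using monomial_cols_incoherent[OF K[OF that] cols[OF that] m]
      monomial_cols_incoherent[OF adjoint_carrier[OF K[OF that]] rows[OF that] d] by simp
  moreover have "?\<Lambda> \<omega> \<in> incoherent_states m" if \<omega>: "\<omega> \<in> incoherent_states d" for \<omega>
  proof -
    have "psd d \<omega>" "mat_trace \<omega> = 1" "dephase \<omega> = \<omega>"
      using \<omega> by (auto simp: incoherent_states_def density_def)
    then show ?thesis
      using channel_psd[OF channel] tr psd_carrier dephase[of \<omega>]
      by (simp add: incoherent_states_def density_def)
  qed
  moreover have "dephase (?\<Lambda> \<omega>) = ?\<Lambda> (dephase \<omega>)" if "\<omega> \<in> density d" for \<omega>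
    using that by (intro dephase psd_carrier) (simp add: density_def)
  ultimately show ?thesis using channel by (cases \<O>) auto
qed

text \<open>The map that discards its input and prepares the first basis state. It makes sets of
  values nonempty and serves ensemble members of no weight.\<close>

lemma free_operation_exists:
  assumes "1 \<le> m" "1 \<le> d"
  obtains \<Lambda> where "\<Lambda> \<in> free_operations \<O> d m"
proof -
  define K where "K = (\<lambda>l. mat m d (\<lambda>(a, i). if a = 0 \<and> i = l then 1 else 0 :: complex))"
  have "kraus_map m d K \<in> free_operations \<O> d m"
  proof (rule kraus_map_free)
    fix i assume i: "i < d"
    have "(\<Sum>a<m. (cmod (K l $$ (a, i)))\<^sup>2) = (if l = i then 1 else 0)" if "l < d" for l
    proof -
      have "(\<Sum>a<m. (cmod (K l $$ (a, i)))\<^sup>2) = (\<Sum>a<m. if a = 0 then of_bool (l = i) else 0)"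
        using i by (intro sum.cong) (auto simp: K_def)
      then show ?thesis using assms by simp
    qed
    then show "(\<Sum>l<d. \<Sum>a<m. (cmod (K l $$ (a, i)))\<^sup>2) = 1" using i by simp
  qed (use assms in \<open>auto simp: K_def monomial_cols_def split: if_splits\<close>)
  then show thesis using that by blast
qed

text \<open>Against the uniform vector, each Kraus operator contributes the squared modulus of the
  sum of the entries of its output vector.\<close>

lemma kraus_map_flat_value_proj:
  assumes K: "\<And>l. l < r \<Longrightarrow> K l \<in> carrier_mat m d" and \<psi>: "\<psi> \<in> carrier_vec d"
  shows "flat_value m (kraus_map m r K (proj \<psi>)) =
    complex_of_real ((\<Sum>l<r. (cmod (\<Sum>a<m. \<Sum>i<d. K l $$ (a, i) * \<psi> $ i))\<^sup>2) / real m)"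
proof -
  have *: "kraus_map m r K (proj \<psi>) $$ (a, b) =
      (\<Sum>l<r. (\<Sum>i<d. K l $$ (a, i) * \<psi> $ i) * cnj (\<Sum>i<d. K l $$ (b, i) * \<psi> $ i))" if "a < m" "b < m" for a b
    using that K \<psi> by (simp add: kraus_map_index[of r K m d] proj_index[OF \<psi>] sum_product algebra_simps)
  have "(\<Sum>a<m. \<Sum>b<m. kraus_map m r K (proj \<psi>) $$ (a, b)) =
      (\<Sum>a<m. \<Sum>b<m. \<Sum>l<r. (\<Sum>i<d. K l $$ (a, i) * \<psi> $ i) * cnj (\<Sum>i<d. K l $$ (b, i) * \<psi> $ i))"
    by (intro sum.cong refl *) auto
  also have "\<dots> = (\<Sum>l<r. \<Sum>a<m. \<Sum>b<m. (\<Sum>i<d. K l $$ (a, i) * \<psi> $ i) * cnj (\<Sum>i<d. K l $$ (b, i) * \<psi> $ i))"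
    by (subst (2) sum.swap, subst sum.swap, rule refl)
  also have "\<dots> = (\<Sum>l<r. (\<Sum>a<m. \<Sum>i<d. K l $$ (a, i) * \<psi> $ i) * cnj (\<Sum>a<m. \<Sum>i<d. K l $$ (a, i) * \<psi> $ i))"
    by (simp add: sum_product)
  also have "\<dots> = complex_of_real (\<Sum>l<r. (cmod (\<Sum>a<m. \<Sum>i<d. K l $$ (a, i) * \<psi> $ i))\<^sup>2)"
    unfolding of_real_sum by (intro sum.cong refl complex_norm_square[symmetric])
  finally show ?thesis by (simp add: flat_value_def)
qed

text \<open>Writing \<open>m |\<phi> i|\<^sup>2\<close> as a mixture of indicators of \<open>m\<close>-element sets turns \<open>\<phi>\<close> into the maximally
  coherent state exactly; the operators indexed by \<open>N + i\<close> only complete the map to a channel on the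
  zeros of \<open>\<phi>\<close>, where \<open>1 / \<phi> i = 0\<close>.\<close>

lemma flat_state_conversion:
  assumes \<phi>: "\<phi> \<in> carrier_vec d" "\<And>i. i < d \<Longrightarrow> (cmod (\<phi> $ i))\<^sup>2 \<le> 1 / real m" "vnorm \<phi> = 1"
    and m: "1 \<le> m" and \<psi>: "\<psi> \<in> carrier_vec d"
  obtains \<Lambda> where "\<And>\<O>. \<Lambda> \<in> free_operations \<O> d m" "(cmod (\<psi> \<bullet>c \<phi>))\<^sup>2 \<le> Re (flat_value m (\<Lambda> (proj \<psi>)))"
proof -
  have sum1: "(\<Sum>i<d. (cmod (\<phi> $ i))\<^sup>2) = 1" using vnorm_sq[OF \<phi>(1)] \<phi>(3) by simp
  then have d: "1 \<le> d" by (cases d) auto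
  let ?P = "Pow {..<d}"
  have "\<forall>i\<in>{..<d}. 0 \<le> real m * (cmod (\<phi> $ i))\<^sup>2 \<and> real m * (cmod (\<phi> $ i))\<^sup>2 \<le> 1"
    using \<phi>(2) m by (auto simp: field_simps)
  moreover have "(\<Sum>i<d. real m * (cmod (\<phi> $ i))\<^sup>2) = real m"
    using sum1 by (simp flip: sum_distrib_left)
  ultimately have "\<exists>t. (\<forall>S. 0 \<le> t S \<and> (t S \<noteq> 0 \<longrightarrow> card S = m)) \<and> sum t ?P = 1 \<and>
      (\<forall>i\<in>{..<d}. real m * (cmod (\<phi> $ i))\<^sup>2 = (\<Sum>S\<in>?P. t S * of_bool (i \<in> S)))"
    by (intro hypersimplex_decomposition) auto
  then obtain t :: "nat set \<Rightarrow> real" where t: "\<And>S. 0 \<le> t S" "\<And>S. t S \<noteq> 0 \<Longrightarrow> card S = m" "sum t ?P = 1"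
    "\<And>i. i < d \<Longrightarrow> real m * (cmod (\<phi> $ i))\<^sup>2 = (\<Sum>S\<in>?P. t S * of_bool (i \<in> S))"
    by (metis lessThan_iff)
  define N where "N = card ?P"
  obtain h where h: "bij_betw h {..<N} ?P"
    using ex_bij_betw_nat_finite[of ?P] by (auto simp: N_def lessThan_atLeast0)
  have "\<exists>f. bij_betw f S {..<m}" if "S \<in> ?P" "t S \<noteq> 0" for S
    using that t(2)[OF that(2)] finite_subset[of S "{..<d}"] by (intro finite_same_card_bij) auto
  then obtain f where f: "\<And>S. S \<in> ?P \<Longrightarrow> t S \<noteq> 0 \<Longrightarrow> bij_betw (f S) S {..<m}" by metis
  \<comment> \<open>Scaled so that \<open>L S\<close> sends \<open>\<phi>\<close> to
    \<open>sqrt (t S)\<close> times the maximally coherent vector: for \<open>t S \<noteq> 0\<close>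
    all entries of \<open>\<phi>\<close> on \<open>S\<close> are nonzero, and \<open>f S\<close>
    relabels \<open>S\<close> as the target basis.\<close>
  define g where "g = (\<lambda>S i. complex_of_real (sqrt (t S / real m)) / \<phi> $ i)"
  define L where "L = (\<lambda>S. mat m d (\<lambda>(a, i). if t S \<noteq> 0 \<and> i \<in> S \<and> f S i = a then g S i else 0))"
  define Z where "Z = (\<lambda>k. mat m d (\<lambda>(a, i). if a = 0 \<and> i = k \<and> \<phi> $ i = 0 then 1 else 0 :: complex))"
  define K where "K = (\<lambda>l. if l < N then L (h l) else Z (l - N))"
  have K: "K l \<in> carrier_mat m d" for l by (simp add: K_def L_def Z_def)
  have hP: "h l \<in> ?P" if "l < N" for l using h that by (auto simp: bij_betw_def)
  have split: "(\<Sum>l<N + d. G (K l)) = (\<Sum>S\<in>?P. G (L S)) + (\<Sum>k<d. G (Z k))" for G :: "complex mat \<Rightarrow> real"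
  proof -
    have "(\<Sum>l<N + d. G (K l)) = (\<Sum>l<N. G (K l)) + (\<Sum>l<d. G (K (N + l)))"
      by (induction d) (simp_all add: add.assoc)
    also have "(\<Sum>l<N. G (K l)) = (\<Sum>l<N. G (L (h l)))" by (simp add: K_def)
    also have "\<dots> = (\<Sum>S\<in>?P. G (L S))" by (rule sum.reindex_bij_betw[OF h])
    finally show ?thesis by (simp add: K_def)
  qed
  have fm: "f S i < m" if "S \<in> ?P" "t S \<noteq> 0" "i \<in> S" for S i
    using f[OF that(1,2)] that(3) by (auto simp: bij_betw_def)
  have Lsum: "(\<Sum>a<m. G (L S $$ (a, i))) = (if t S \<noteq> 0 \<and> i \<in> S then G (g S i) else 0)"
    if S: "S \<in> ?P" and i: "i < d" and G: "G 0 = 0" for S i and G :: "complex \<Rightarrow> 'b::comm_monoid_add"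
  proof -
    have "(\<Sum>a<m. G (L S $$ (a, i))) = (\<Sum>a<m. if a = f S i then (if t S \<noteq> 0 \<and> i \<in> S then G (g S i) else 0) else 0)"
      using i G by (intro sum.cong) (auto simp: L_def)
    then show ?thesis using fm[OF S, of i] by auto
  qed
  have free: "kraus_map m (N + d) K \<in> free_operations \<O> d m" for \<O>
  proof (rule kraus_map_free[OF K _ _ _ m d])
    fix l
    show "monomial_cols (K l)" by (auto simp: K_def L_def Z_def monomial_cols_def split: if_splits)
    assume "l < N + d"
    show "monomial_cols ((K l)\<^sup>\<dagger>)"
    proof (cases "l < N")
      case True
      have "i = j" if "t (h l) \<noteq> 0" "i \<in> h l" "j \<in> h l" "f (h l) i = f (h l) j" for i j
        using f[OF hP[OF True] that(1)] that(2-4) by (auto simp: bij_betw_def inj_on_def)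
      then show ?thesis using True by (auto simp: K_def L_def monomial_cols_def split: if_splits)
    qed (auto simp: K_def Z_def monomial_cols_def split: if_splits)
  next
    fix i assume i: "i < d"
    have "(\<Sum>S\<in>?P. \<Sum>a<m. (cmod (L S $$ (a, i)))\<^sup>2) = (\<Sum>S\<in>?P. t S * of_bool (i \<in> S)) / (real m * (cmod (\<phi> $ i))\<^sup>2)"
      unfolding sum_divide_distrib
    proof (rule sum.cong[OF refl])
      fix S assume S: "S \<in> ?P"
      show "(\<Sum>a<m. (cmod (L S $$ (a, i)))\<^sup>2) = t S * of_bool (i \<in> S) / (real m * (cmod (\<phi> $ i))\<^sup>2)"
        using Lsum[OF S i, of "\<lambda>z. (cmod z)\<^sup>2"] t(1)[of S] m
        by (auto simp: g_def norm_divide power_divide)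
    qed
    also have "\<dots> = (if \<phi> $ i = 0 then 0 else 1)" using t(4)[OF i] m by auto
    finally have 1: "(\<Sum>S\<in>?P. \<Sum>a<m. (cmod (L S $$ (a, i)))\<^sup>2) = (if \<phi> $ i = 0 then 0 else 1)" .
    have "(\<Sum>a<m. (cmod (Z k $$ (a, i)))\<^sup>2) = (if k = i then (if \<phi> $ i = 0 then 1 else 0) else 0)" for k
    proof -
      have "(\<Sum>a<m. (cmod (Z k $$ (a, i)))\<^sup>2) = (\<Sum>a<m. if a = 0 then (if k = i then (if \<phi> $ i = 0 then 1 else 0) else 0) else 0)"
        using i by (intro sum.cong) (auto simp: Z_def)
      then show ?thesis using m by simp
    qed
    then have 2: "(\<Sum>k<d. \<Sum>a<m. (cmod (Z k $$ (a, i)))\<^sup>2) = (if \<phi> $ i = 0 then 1 else 0)" using i by simp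
    show "(\<Sum>l<N + d. \<Sum>a<m. (cmod (K l $$ (a, i)))\<^sup>2) = 1"
      unfolding split[of "\<lambda>M. \<Sum>a<m. (cmod (M $$ (a, i)))\<^sup>2"] 1 2 by simp
  qed
  \<comment> \<open>Up to the factor \<open>sqrt (t S / m)\<close>, the sum of the entries of
    \<open>L S\<close> applied to \<open>\<psi>\<close>.\<close>
  define y where "y = (\<lambda>S. \<Sum>i<d. of_bool (i \<in> S) * (\<psi> $ i / \<phi> $ i))"
  have LS: "(cmod (\<Sum>a<m. \<Sum>i<d. L S $$ (a, i) * \<psi> $ i))\<^sup>2 / real m = t S * (cmod (y S) / real m)\<^sup>2" if S: "S \<in> ?P" for S
  proof -
    have "(\<Sum>a<m. \<Sum>i<d. L S $$ (a, i) * \<psi> $ i) = (\<Sum>i<d. \<Sum>a<m. L S $$ (a, i) * \<psi> $ i)" by (rule sum.swap)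
    also have "\<dots> = (\<Sum>i<d. complex_of_real (sqrt (t S / real m)) * (of_bool (i \<in> S) * (\<psi> $ i / \<phi> $ i)))"
      using Lsum[OF S, of _ "\<lambda>z. z * \<psi> $ _"] by (intro sum.cong refl) (auto simp: g_def)
    also have "\<dots> = complex_of_real (sqrt (t S / real m)) * y S" by (simp add: y_def sum_distrib_left)
    finally have "(cmod (\<Sum>a<m. \<Sum>i<d. L S $$ (a, i) * \<psi> $ i))\<^sup>2 = t S / real m * (cmod (y S))\<^sup>2"
      using t(1)[of S] by (simp add: norm_mult power_mult_distrib)
    then show ?thesis by (simp add: power_divide power2_eq_square)
  qed
  \<comment> \<open>\<open>cnj (\<phi> $ i)\<close> is
    \<open>(cmod (\<phi> $ i))\<^sup>2 / \<phi> $ i\<close>, also at zeros of \<open>\<phi>\<close>.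
    Inserting the hypersimplex weights turns the overlap into the average of \<open>y S / m\<close>
    under \<open>t\<close>.\<close>
  have "\<psi> \<bullet>c \<phi> = (\<Sum>i<d. complex_of_real (\<Sum>S\<in>?P. t S * of_bool (i \<in> S)) * (\<psi> $ i / \<phi> $ i) / complex_of_real (real m))"
    unfolding cinner_index[OF \<psi> \<phi>(1)]
  proof (rule sum.cong[OF refl])
    fix i assume "i \<in> {..<d}"
    then have i: "i < d" by simp
    show "\<psi> $ i * cnj (\<phi> $ i) = complex_of_real (\<Sum>S\<in>?P. t S * of_bool (i \<in> S)) * (\<psi> $ i / \<phi> $ i) / complex_of_real (real m)"
      unfolding t(4)[OF i, symmetric] using m complex_norm_square[of "\<phi> $ i"]
      by (cases "\<phi> $ i = 0") (auto simp: field_simps)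
  qed
  also have "\<dots> = (\<Sum>i<d. \<Sum>S\<in>?P. complex_of_real (t S / real m) * (of_bool (i \<in> S) * (\<psi> $ i / \<phi> $ i)))"
    by (intro sum.cong refl) (auto simp: sum_distrib_right sum_divide_distrib of_bool_def
        simp del: sum_mult_of_bool_eq sum_of_bool_mult_eq intro!: sum.cong)
  also have "\<dots> = (\<Sum>S\<in>?P. complex_of_real (t S / real m) * y S)"
    by (subst sum.swap) (simp add: y_def sum_distrib_left)
  finally have "cmod (\<psi> \<bullet>c \<phi>) \<le> (\<Sum>S\<in>?P. cmod (complex_of_real (t S / real m) * y S))"
    by (simp add: norm_sum)
  also have "\<dots> = (\<Sum>S\<in>?P. sqrt (t S) * (sqrt (t S) * (cmod (y S) / real m)))"
  proof (intro sum.cong refl)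
    fix S
    have "sqrt (t S) * (sqrt (t S) * x) = t S * x" for x using t(1)[of S] by (simp flip: mult.assoc)
    then show "cmod (complex_of_real (t S / real m) * y S) = sqrt (t S) * (sqrt (t S) * (cmod (y S) / real m))"
      using t(1)[of S] by (simp add: norm_mult norm_divide)
  qed
  \<comment> \<open>Splitting off \<open>sqrt (t S)\<close> costs nothing in Cauchy-Schwarz, since
    \<open>t\<close> sums to 1.\<close>
  also have "\<dots> \<le> L2_set (\<lambda>S. sqrt (t S)) ?P * L2_set (\<lambda>S. sqrt (t S) * (cmod (y S) / real m)) ?P"
    using L2_set_mult_ineq[of "\<lambda>S. sqrt (t S)" "\<lambda>S. sqrt (t S) * (cmod (y S) / real m)" ?P] t(1)
    by simp
  finally have "(cmod (\<psi> \<bullet>c \<phi>))\<^sup>2 \<le> (L2_set (\<lambda>S. sqrt (t S)) ?P * L2_set (\<lambda>S. sqrt (t S) * (cmod (y S) / real m)) ?P)\<^sup>2"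
    by (simp add: power_mono)
  also have "\<dots> = (\<Sum>S\<in>?P. t S * (cmod (y S) / real m)\<^sup>2)"
    using t(1,3) by (simp add: L2_set_def power_mult_distrib power_divide sum_nonneg)
  also have "\<dots> = (\<Sum>S\<in>?P. (cmod (\<Sum>a<m. \<Sum>i<d. L S $$ (a, i) * \<psi> $ i))\<^sup>2 / real m)"
    by (intro sum.cong refl LS[symmetric])
  also have "\<dots> \<le> (\<Sum>l<N + d. (cmod (\<Sum>a<m. \<Sum>i<d. K l $$ (a, i) * \<psi> $ i))\<^sup>2 / real m)"
    unfolding split[of "\<lambda>M. (cmod (\<Sum>a<m. \<Sum>i<d. M $$ (a, i) * \<psi> $ i))\<^sup>2 / real m"]
    by (simp add: sum_nonneg)
  also have "\<dots> = Re (flat_value m (kraus_map m (N + d) K (proj \<psi>)))"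
    unfolding kraus_map_flat_value_proj[OF K \<psi>] by (simp add: sum_divide_distrib)
  finally show thesis using that free by blast
qed

subsection \<open>Fidelity of states written as Gram matrices\<close>

lemma density_psd: "\<rho> \<in> density d \<Longrightarrow> psd d \<rho>"
  by (simp add: density_def)

lemma fidelity_ge_overlap:
  assumes "A \<in> carrier_mat d N" "B \<in> carrier_mat d N"
  shows "(cmod (mat_trace (B\<^sup>\<dagger> * A)))\<^sup>2 \<le> fidelity (A * A\<^sup>\<dagger>) (B * B\<^sup>\<dagger>)"
  unfolding fidelity_def by (rule power_mono[OF trace_le_trace_norm_sqrt[OF assms] norm_ge_zero])

lemma fidelity_attained:
  assumes \<rho>: "psd d \<rho>" and B: "B \<in> carrier_mat d N"
  obtains A r E where "A \<in> carrier_mat d N" "E \<in> carrier_mat d r" "\<rho> = A * A\<^sup>\<dagger> + E * E\<^sup>\<dagger>"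
    "fidelity \<rho> (B * B\<^sup>\<dagger>) = (cmod (mat_trace (B\<^sup>\<dagger> * A)))\<^sup>2"
  using trace_norm_sqrt_attained[OF assms] by (metis fidelity_def norm_of_real power2_abs)

lemma trace_adjoint_mult:
  assumes "A \<in> carrier_mat d N" "B \<in> carrier_mat d N"
  shows "mat_trace (B\<^sup>\<dagger> * A) = (\<Sum>j<N. \<Sum>i<d. A $$ (i, j) * cnj (B $$ (i, j)))"
  using assms
  by (subst trace_index[of _ N])
    (auto simp: mult_index[of "B\<^sup>\<dagger>" N d A N] mult.commute simp del: index_mult_mat(1) intro!: sum.cong mult_carrier_mat[of _ N d])

lemma gram_index:
  assumes "A \<in> carrier_mat d N" "a < d" "b < d"
  shows "(A * A\<^sup>\<dagger>) $$ (a, b) = (\<Sum>j<N. A $$ (a, j) * cnj (A $$ (b, j)))"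
  using assms by (subst mult_index[of _ d N _ d]) auto

lemma gram_trace:
  assumes "A \<in> carrier_mat d N"
  shows "mat_trace (A * A\<^sup>\<dagger>) = complex_of_real (\<Sum>j<N. \<Sum>i<d. (cmod (A $$ (i, j)))\<^sup>2)"
proof -
  have "mat_trace (A * A\<^sup>\<dagger>) = (\<Sum>i<d. \<Sum>j<N. complex_of_real ((cmod (A $$ (i, j)))\<^sup>2))"
    using assms mult_carrier_mat[OF assms adjoint_carrier[OF assms]]
    by (simp add: trace_index[of _ d] gram_diag_index del: index_mult_mat(1))
  then show ?thesis by (subst (asm) sum.swap) simp
qed

text \<open>The fidelity is the squared overlap of two factors of entrywise norm at most 1. This
  bounds the sets whose suprema are taken.\<close>

lemma fidelity_le_1:
  assumes \<rho>: "\<rho> \<in> density d" and \<omega>: "\<omega> \<in> density d"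
  shows "fidelity \<rho> \<omega> \<le> 1"
proof -
  obtain N B where B: "B \<in> carrier_mat d N" "\<omega> = B * B\<^sup>\<dagger>"
    using psd_gram_exists[OF density_psd[OF \<omega>]] .
  obtain A r E where A: "A \<in> carrier_mat d N" and E: "E \<in> carrier_mat d r"
    and \<rho>_eq: "\<rho> = A * A\<^sup>\<dagger> + E * E\<^sup>\<dagger>" and F: "fidelity \<rho> \<omega> = (cmod (mat_trace (B\<^sup>\<dagger> * A)))\<^sup>2"
    using fidelity_attained[OF density_psd[OF \<rho>] B(1), folded B(2)] .
  let ?a = "\<lambda>X. \<Sum>j<N. \<Sum>i<d. (cmod (X $$ (i, j)))\<^sup>2"
  have "complex_of_real (?a B) = complex_of_real 1"
    using gram_trace[OF B(1), folded B(2)] \<omega> by (simp add: density_def)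
  then have Bn: "?a B = 1" by (rule of_real_eq_iff[THEN iffD1])
  have "mat_trace \<rho> = mat_trace (A * A\<^sup>\<dagger>) + mat_trace (E * E\<^sup>\<dagger>)"
    unfolding \<rho>_eq using A E by (intro trace_add[of _ d]) auto
  then have "complex_of_real (?a A + (\<Sum>j<r. \<Sum>i<d. (cmod (E $$ (i, j)))\<^sup>2)) = complex_of_real 1"
    using gram_trace[OF A] gram_trace[OF E] \<rho> by (simp add: density_def)
  then have "?a A + (\<Sum>j<r. \<Sum>i<d. (cmod (E $$ (i, j)))\<^sup>2) = 1" by (rule of_real_eq_iff[THEN iffD1])
  moreover have "0 \<le> (\<Sum>j<r. \<Sum>i<d. (cmod (E $$ (i, j)))\<^sup>2)" by (simp add: sum_nonneg)
  ultimately have An: "?a A \<le> 1" by linarith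
  let ?J = "{..<N} \<times> {..<d}"
  have L2: "L2_set (\<lambda>(j, i). cmod (X $$ (i, j))) ?J = sqrt (?a X)" for X
    by (simp add: L2_set_def sum.cartesian_product split_def)
  have "cmod (mat_trace (B\<^sup>\<dagger> * A)) \<le> (\<Sum>(j, i)\<in>?J. \<bar>cmod (A $$ (i, j))\<bar> * \<bar>cmod (B $$ (i, j))\<bar>)"
    unfolding trace_adjoint_mult[OF A B(1)] sum.cartesian_product
    by (rule sum_norm_le) (auto simp: norm_mult)
  also have "\<dots> \<le> sqrt (?a A) * sqrt (?a B)"
    using L2_set_mult_ineq[of "\<lambda>(j, i). cmod (A $$ (i, j))" "\<lambda>(j, i). cmod (B $$ (i, j))" ?J]
    unfolding L2 by (simp add: split_def)
  also have "\<dots> \<le> 1" using An by (simp add: Bn)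
  finally show ?thesis unfolding F by (simp add: power_le_one)
qed

text \<open>A nonnegative diagonal matrix stretches each coordinate by its entry, and basis vectors
  realise every entry.\<close>

lemma op_norm_dephase_le_iff:
  assumes \<omega>: "\<omega> \<in> density d" and c: "0 \<le> c"
  shows "op_norm (dephase \<omega>) \<le> c \<longleftrightarrow> (\<forall>i<d. Re (\<omega> $$ (i, i)) \<le> c)"
proof -
  have psd: "psd d \<omega>" and tr: "mat_trace \<omega> = 1" using \<omega> by (auto simp: density_def)
  note c\<omega> = psd_carrier[OF psd]
  let ?D = "dephase \<omega>"
  have D: "?D \<in> carrier_mat d d" using c\<omega> by simp
  have diag: "0 \<le> Re (\<omega> $$ (i, i))" "\<omega> $$ (i, i) = complex_of_real (Re (\<omega> $$ (i, i)))" if "i < d" for i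
    using psd_diag[OF psd that] by (auto simp: less_eq_complex_def complex_eq_iff)
  have Dv: "(?D *\<^sub>v v) $ i = complex_of_real (Re (\<omega> $$ (i, i))) * v $ i" if "v \<in> carrier_vec d" "i < d" for v i
  proof -
    have "(?D *\<^sub>v v) $ i = (\<Sum>k<d. ?D $$ (i, k) * v $ k)" using that by (intro mult_vec_index[OF D])
    also have "\<dots> = (\<Sum>k<d. if k = i then \<omega> $$ (i, i) * v $ i else 0)"
      using that by (intro sum.cong refl) (auto simp: dephase_index[OF c\<omega>])
    finally show ?thesis using that diag(2)[OF that(2)] by simp
  qed
  have bound: "vnorm (?D *\<^sub>v v) \<le> b" if v: "v \<in> unit_vectors d" and b: "\<And>i. i < d \<Longrightarrow> Re (\<omega> $$ (i, i)) \<le> b" "0 \<le> b" for v b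
  proof -
    have cv: "v \<in> carrier_vec d" "vnorm v = 1" using v by (auto simp: unit_vectors_def)
    have "(vnorm (?D *\<^sub>v v))\<^sup>2 = (\<Sum>i<d. (cmod ((?D *\<^sub>v v) $ i))\<^sup>2)"
      using D cv(1) by (intro vnorm_sq mult_mat_vec_carrier)
    also have "\<dots> = (\<Sum>i<d. (Re (\<omega> $$ (i, i)) * cmod (v $ i))\<^sup>2)"
    proof (intro sum.cong refl)
      fix i assume "i \<in> {..<d}"
      then have i: "i < d" by simp
      show "(cmod ((?D *\<^sub>v v) $ i))\<^sup>2 = (Re (\<omega> $$ (i, i)) * cmod (v $ i))\<^sup>2"
        unfolding Dv[OF cv(1) i] using diag(1)[OF i] by (simp add: norm_mult)
    qed
    also have "\<dots> \<le> (\<Sum>i<d. (b * cmod (v $ i))\<^sup>2)"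
      using diag(1) b by (intro sum_mono power_mono mult_right_mono) auto
    also have "\<dots> = (b * vnorm v)\<^sup>2" by (simp add: power_mult_distrib vnorm_sq[OF cv(1)] sum_distrib_left)
    finally have "(vnorm (?D *\<^sub>v v))\<^sup>2 \<le> b\<^sup>2" by (simp add: cv(2))
    then show ?thesis using b(2) by (rule power2_le_imp_le)
  qed
  have "(\<Sum>i<d. Re (\<omega> $$ (i, i))) = 1" using arg_cong[OF tr, of Re] c\<omega> by (simp add: trace_index)
  then have le1: "Re (\<omega> $$ (i, i)) \<le> 1" if "i < d" for i
    using member_le_sum[of i "{..<d}" "\<lambda>i. Re (\<omega> $$ (i, i))"] diag(1) that by auto
  have "0 < d" using tr c\<omega> by (cases d) (auto simp: trace_index)
  then have ne: "unit_vectors d \<noteq> {}" by (auto simp: unit_vectors_def intro!: exI[of _ "unit_vec d 0"])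
  have op: "op_norm ?D = (SUP v\<in>unit_vectors d. vnorm (?D *\<^sub>v v))" using D by (simp add: op_norm_def)
  have bdd: "bdd_above ((\<lambda>v. vnorm (?D *\<^sub>v v)) ` unit_vectors d)"
    using bound[of _ 1] le1 by (intro bdd_aboveI2[of _ _ 1]) auto
  show ?thesis
  proof
    assume le: "op_norm ?D \<le> c"
    show "\<forall>i<d. Re (\<omega> $$ (i, i)) \<le> c"
    proof safe
      fix i assume i: "i < d"
      let ?e = "unit_vec d i :: complex vec"
      have e: "?e \<in> unit_vectors d" using i by (simp add: unit_vectors_def)
      have "?D *\<^sub>v ?e = complex_of_real (Re (\<omega> $$ (i, i))) \<cdot>\<^sub>v ?e"
        using D i by (intro eq_vecI) (auto simp: Dv simp del: index_mult_mat_vec)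
      then have "Re (\<omega> $$ (i, i)) = vnorm (?D *\<^sub>v ?e)" using i diag(1)[OF i] by (simp add: vnorm_smult)
      also have "\<dots> \<le> op_norm ?D" unfolding op using bdd e by (intro cSUP_upper)
      finally show "Re (\<omega> $$ (i, i)) \<le> c" using le by simp
    qed
  next
    assume "\<forall>i<d. Re (\<omega> $$ (i, i)) \<le> c"
    then show "op_norm ?D \<le> c" unfolding op using bound[of _ c] c ne by (intro cSUP_least) auto
  qed
qed

lemma M_tilde_iff:
  "\<omega> \<in> M_tilde d m \<longleftrightarrow> \<omega> \<in> density d \<and> (\<forall>i<d. Re (\<omega> $$ (i, i)) \<le> 1 / real m)"
  using op_norm_dephase_le_iff[of \<omega> d "1 / real m"] by (auto simp: M_tilde_def)

lemma density_dim_pos: "\<rho> \<in> density d \<Longrightarrow> 1 \<le> d"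
  by (cases d) (auto simp: density_def psd_def trace_index)

text \<open>Unit trace needs \<open>d\<close> entries of at most \<open>1 / m\<close> to add up to
  1; conversely the uniform superposition has diagonal entries \<open>1 / d\<close>.\<close>

lemma M_tilde_nonempty_iff:
  assumes "1 \<le> m" "1 \<le> d"
  shows "M_tilde d m \<noteq> {} \<longleftrightarrow> m \<le> d"
proof
  assume "M_tilde d m \<noteq> {}"
  then obtain \<omega> where \<omega>: "\<omega> \<in> density d" "\<forall>i<d. Re (\<omega> $$ (i, i)) \<le> 1 / real m" by (auto simp: M_tilde_iff)
  then have "\<omega> \<in> carrier_mat d d" "mat_trace \<omega> = 1" by (auto simp: density_def psd_def)
  then have "Re (\<Sum>i<d. \<omega> $$ (i, i)) = 1" by (simp only: trace_index one_complex.sel)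
  then have "1 = (\<Sum>i<d. Re (\<omega> $$ (i, i)))" by simp
  also have "\<dots> \<le> (\<Sum>i<d. 1 / real m)" using \<omega>(2) by (intro sum_mono) auto
  finally show "m \<le> d" using assms by (simp add: field_simps)
next
  assume md: "m \<le> d"
  have "proj (flat_vec d) \<in> density d"
    using flat_vec_unit[OF assms(2)] proj_psd[of "flat_vec d" d] proj_trace[of "flat_vec d" d]
    by (simp add: density_def)
  moreover have "Re (proj (flat_vec d) $$ (i, i)) \<le> 1 / real m" if "i < d" for i
  proof -
    have "proj (flat_vec d) $$ (i, i) = complex_of_real (1 / real d)"
      using that by (simp add: proj_def flat_vec_def flip: of_real_mult)
    then show ?thesis using md assms by (simp add: frac_le)
  qed
  ultimately show "M_tilde d m \<noteq> {}" using M_tilde_iff by blast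
qed

lemma fidelity_le_fidelity_tilde:
  assumes \<rho>: "\<rho> \<in> density d" and \<omega>: "\<omega> \<in> M_tilde d m"
  shows "fidelity \<rho> \<omega> \<le> fidelity_tilde d \<rho> m"
proof -
  have "fidelity \<rho> \<omega> \<le> 1" if "\<omega> \<in> M_tilde d m" for \<omega>
    using fidelity_le_1[OF \<rho>] that by (simp add: M_tilde_def)
  then have "bdd_above (fidelity \<rho> ` M_tilde d m)" by (intro bdd_aboveI2)
  then show ?thesis unfolding fidelity_tilde_def using \<omega> by (intro cSUP_upper)
qed

lemma fidelity_tilde_nonneg:
  assumes "\<rho> \<in> density d" "M_tilde d m \<noteq> {}"
  shows "0 \<le> fidelity_tilde d \<rho> m"
proof -
  obtain \<omega> where "\<omega> \<in> M_tilde d m" using assms(2) by blast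
  then have "fidelity \<rho> \<omega> \<le> fidelity_tilde d \<rho> m" by (rule fidelity_le_fidelity_tilde[OF assms(1)])
  moreover have "0 \<le> fidelity \<rho> \<omega>" by (simp add: fidelity_def)
  ultimately show ?thesis by simp
qed

subsection \<open>Pure-state decompositions\<close>

text \<open>A zero column receives an arbitrary unit vector, because
  \<open>pure_decomposition\<close> asks for unit vectors at weight zero too.\<close>

lemma column_normalise:
  assumes "1 \<le> d"
  obtains u where "u \<in> unit_vectors d"
    "\<And>i. i < d \<Longrightarrow> x i = complex_of_real (sqrt (\<Sum>k<d. (cmod (x k))\<^sup>2)) * u $ i"
proof (cases "(\<Sum>k<d. (cmod (x k))\<^sup>2) = 0")
  case True
  then have "x i = 0" if "i < d" for i using that by (subst (asm) sum_nonneg_eq_0_iff) auto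
  then show thesis using True assms by (intro that[of "unit_vec d 0"]) (auto simp: unit_vectors_def)
next
  case False
  define s where "s = sqrt (\<Sum>k<d. (cmod (x k))\<^sup>2)"
  have "0 \<le> (\<Sum>k<d. (cmod (x k))\<^sup>2)" by (simp add: sum_nonneg)
  then have s: "s \<noteq> 0" "(\<Sum>k<d. (cmod (x k))\<^sup>2) = s\<^sup>2" using False by (simp_all add: s_def)
  let ?u = "vec d (\<lambda>i. x i / complex_of_real s)"
  have "(vnorm ?u)\<^sup>2 = (\<Sum>k<d. (cmod (x k))\<^sup>2) / s\<^sup>2"
    by (subst vnorm_sq[of _ d]) (auto simp: norm_divide power_divide sum_divide_distrib)
  then have "(vnorm ?u)\<^sup>2 = 1" unfolding s(2) using s(1) by simp
  then have "vnorm ?u = 1" using vnorm_ge_0[of ?u] by (auto simp: power2_eq_1_iff)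
  show thesis
  proof (rule that)
    show "?u \<in> unit_vectors d" using \<open>vnorm ?u = 1\<close> by (simp add: unit_vectors_def)
    show "x i = complex_of_real (sqrt (\<Sum>k<d. (cmod (x k))\<^sup>2)) * ?u $ i" if "i < d" for i
      unfolding s_def[symmetric] using that s(1) by simp
  qed
qed

definition ensemble_value ::
    "nat \<Rightarrow> nat \<Rightarrow> (nat \<Rightarrow> real) \<Rightarrow> (nat \<Rightarrow> complex vec) \<Rightarrow> (nat \<Rightarrow> complex mat \<Rightarrow> complex mat) \<Rightarrow> real" where
  "ensemble_value m n p \<psi> \<Lambda> = (\<Sum>i<n. p i * Re (flat_value m (\<Lambda> i (proj (\<psi> i)))))"

definition ensemble_values :: "free_class \<Rightarrow> nat \<Rightarrow> complex mat \<Rightarrow> nat \<Rightarrow> real set" where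
  "ensemble_values \<O> d \<rho> m = {ensemble_value m n p \<psi> \<Lambda> | n p \<psi> \<Lambda>.
     pure_decomposition d \<rho> n p \<psi> \<and> (\<forall>i<n. \<Lambda> i \<in> free_operations \<O> d m)}"

lemma flat_value_mat_sum:
  assumes "\<And>i. i < n \<Longrightarrow> Z i \<in> carrier_mat m m"
  shows "flat_value m (mat_sum m n (\<lambda>i. c i \<cdot>\<^sub>m Z i)) = (\<Sum>i<n. c i * flat_value m (Z i))"
proof -
  have "mat_sum m n (\<lambda>i. c i \<cdot>\<^sub>m Z i) $$ (a, b) = (\<Sum>i<n. c i * Z i $$ (a, b))" if "a < m" "b < m" for a b
    unfolding mat_sum_index[OF that]
  proof (intro sum.cong refl)
    fix i assume "i \<in> {..<n}"
    then show "(c i \<cdot>\<^sub>m Z i) $$ (a, b) = c i * Z i $$ (a, b)" using assms[of i] that by auto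
  qed
  then have "(\<Sum>a<m. \<Sum>b<m. mat_sum m n (\<lambda>i. c i \<cdot>\<^sub>m Z i) $$ (a, b)) = (\<Sum>a<m. \<Sum>b<m. \<Sum>i<n. c i * Z i $$ (a, b))"
    by simp
  also have "\<dots> = (\<Sum>a<m. \<Sum>i<n. \<Sum>b<m. c i * Z i $$ (a, b))"
    by (rule sum.cong[OF refl], rule sum.swap)
  also have "\<dots> = (\<Sum>i<n. \<Sum>a<m. \<Sum>b<m. c i * Z i $$ (a, b))" by (rule sum.swap)
  finally show ?thesis by (simp add: flat_value_def sum_divide_distrib sum_distrib_left)
qed

lemma ensemble_value_hs_inner:
  assumes "pure_decomposition d \<rho> n p \<psi>" "\<forall>i<n. \<Lambda> i \<in> free_operations \<O> d m"
  shows "Re (hs_inner (mat_sum m n (\<lambda>i. complex_of_real (p i) \<cdot>\<^sub>m \<Lambda> i (proj (\<psi> i)))) (max_coherent m)) =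
    ensemble_value m n p \<psi> \<Lambda>"
proof -
  have Z: "\<Lambda> i (proj (\<psi> i)) \<in> carrier_mat m m" if "i < n" for i
  proof (rule channel_carrier[OF free_operation_channel[OF assms(2)[rule_format, OF that]]])
    show "proj (\<psi> i) \<in> carrier_mat d d"
      using assms(1) that by (intro proj_carrier) (simp add: pure_decomposition_def unit_vectors_def)
  qed
  have "flat_value m (mat_sum m n (\<lambda>i. complex_of_real (p i) \<cdot>\<^sub>m \<Lambda> i (proj (\<psi> i)))) =
      (\<Sum>i<n. complex_of_real (p i) * flat_value m (\<Lambda> i (proj (\<psi> i))))"
    by (rule flat_value_mat_sum) (rule Z)
  then show ?thesis
    unfolding hs_inner_max_coherent[OF mat_sum_carrier] by (simp add: ensemble_value_def)
qed

lemma assisted_fidelity_Sup: "assisted_fidelity \<O> d \<rho> m = Sup (ensemble_values \<O> d \<rho> m)"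
  unfolding assisted_fidelity_def ensemble_values_def
  by (intro arg_cong[of _ _ Sup] Collect_cong iff_exI)
    (auto simp: ensemble_value_hs_inner[where d = d and \<rho> = \<rho> and \<O> = \<O>])

text \<open>Normalising the columns of a factor gives an ensemble, with squared column norms as
  probabilities. The number and order of columns are kept, so that it can be compared with a second
  factor.\<close>

lemma pure_decomposition_gram:
  assumes \<rho>: "A * A\<^sup>\<dagger> \<in> density d" and A: "A \<in> carrier_mat d n"
  obtains p \<psi> where "pure_decomposition d (A * A\<^sup>\<dagger>) n p \<psi>" 
    "\<And>i j. i < d \<Longrightarrow> j < n \<Longrightarrow> A $$ (i, j) = complex_of_real (sqrt (p j)) * \<psi> j $ i"
proof -
  have d: "1 \<le> d" using density_dim_pos[OF \<rho>] .
  define p where "p = (\<lambda>j. \<Sum>k<d. (cmod (A $$ (k, j)))\<^sup>2)"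
  have p0: "0 \<le> p j" for j by (simp add: p_def sum_nonneg)
  have "\<exists>u\<in>unit_vectors d. \<forall>i<d. A $$ (i, j) = complex_of_real (sqrt (p j)) * u $ i" for j
    using column_normalise[OF d, of "\<lambda>i. A $$ (i, j)"] unfolding p_def by metis
  then obtain \<psi> where \<psi>: "\<And>j. \<psi> j \<in> unit_vectors d"
    "\<And>i j. i < d \<Longrightarrow> A $$ (i, j) = complex_of_real (sqrt (p j)) * \<psi> j $ i" by metis
  have c\<psi>: "\<psi> j \<in> carrier_vec d" for j using \<psi>(1)[of j] by (simp add: unit_vectors_def)
  have "complex_of_real (\<Sum>j<n. p j) = complex_of_real 1"
    using gram_trace[OF A] \<rho> by (simp add: density_def p_def)
  then have "(\<Sum>j<n. p j) = 1" by (rule of_real_eq_iff[THEN iffD1])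
  moreover have "A * A\<^sup>\<dagger> = mat_sum d n (\<lambda>i. complex_of_real (p i) \<cdot>\<^sub>m proj (\<psi> i))"
  proof (rule eq_matI)
    fix a b assume "a < dim_row (mat_sum d n (\<lambda>i. complex_of_real (p i) \<cdot>\<^sub>m proj (\<psi> i)))"
      "b < dim_col (mat_sum d n (\<lambda>i. complex_of_real (p i) \<cdot>\<^sub>m proj (\<psi> i)))"
    then have ab: "a < d" "b < d" by (auto simp: mat_sum_def)
    have "A $$ (a, j) * cnj (A $$ (b, j)) = (complex_of_real (p j) \<cdot>\<^sub>m proj (\<psi> j)) $$ (a, b)" for j
    proof -
      have "A $$ (a, j) * cnj (A $$ (b, j)) = complex_of_real (sqrt (p j) * sqrt (p j)) * (\<psi> j $ a * cnj (\<psi> j $ b))"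
        unfolding \<psi>(2)[OF ab(1)] \<psi>(2)[OF ab(2)]
        by (simp only: of_real_mult complex_cnj_mult complex_cnj_complex_of_real mult_ac)
      also have "\<dots> = complex_of_real (p j) * (\<psi> j $ a * cnj (\<psi> j $ b))"
        by (simp only: real_sqrt_mult_self abs_of_nonneg[OF p0])
      also have "\<dots> = (complex_of_real (p j) \<cdot>\<^sub>m proj (\<psi> j)) $$ (a, b)"
        using ab carrier_matD[OF proj_carrier[OF c\<psi>[of j]]] by (simp add: proj_index[OF c\<psi>])
      finally show ?thesis .
    qed
    then show "(A * A\<^sup>\<dagger>) $$ (a, b) = mat_sum d n (\<lambda>i. complex_of_real (p i) \<cdot>\<^sub>m proj (\<psi> i)) $$ (a, b)"
      unfolding gram_index[OF A ab] mat_sum_index[OF ab] by simp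
  qed (use A in \<open>auto simp: mat_sum_def\<close>)
  ultimately have "pure_decomposition d (A * A\<^sup>\<dagger>) n p \<psi>"
    using p0 \<psi>(1) by (simp add: pure_decomposition_def)
  then show thesis using that \<psi>(2) by blast
qed

lemma ensemble_values_nonempty:
  assumes \<rho>: "\<rho> \<in> density d" and m: "1 \<le> m"
  shows "ensemble_values \<O> d \<rho> m \<noteq> {}"
proof -
  obtain n A where A: "A \<in> carrier_mat d n" "\<rho> = A * A\<^sup>\<dagger>"
    using psd_gram_exists[OF density_psd[OF \<rho>]] .
  obtain p \<psi> where "pure_decomposition d \<rho> n p \<psi>"
    using pure_decomposition_gram[OF _ A(1)] \<rho> A(2) by metis
  moreover obtain \<Lambda> where "\<Lambda> \<in> free_operations \<O> d m"
    using free_operation_exists[OF m density_dim_pos[OF \<rho>]] .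
  ultimately have "ensemble_value m n p \<psi> (\<lambda>_. \<Lambda>) \<in> ensemble_values \<O> d \<rho> m"
    unfolding ensemble_values_def by blast
  then show ?thesis by blast
qed

subsection \<open>The upper bound\<close>

text \<open>Each ensemble member has a flat partner \<open>w j\<close> with nonnegative overlap
  \<open>c j\<close>. Mixing the partners preserves the bound on the diagonal, and as the overlaps
  are nonnegative they add up without cancellation.\<close>

lemma ensemble_value_le_fidelity_tilde:
  assumes \<rho>: "\<rho> \<in> density d" and m: "1 \<le> m" "m \<le> d"
    and x: "x \<in> ensemble_values \<O> d \<rho> m"
  shows "x \<le> fidelity_tilde d \<rho> m"
proof -
  obtain n p \<psi> \<Lambda> where dec: "pure_decomposition d \<rho> n p \<psi>" and \<Lambda>: "\<forall>j<n. \<Lambda> j \<in> free_operations \<O> d m"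
    and x: "x = ensemble_value m n p \<psi> \<Lambda>"
    using x by (auto simp: ensemble_values_def)
  have p: "\<And>j. j < n \<Longrightarrow> 0 \<le> p j" "(\<Sum>j<n. p j) = 1" and \<psi>: "\<And>j. j < n \<Longrightarrow> \<psi> j \<in> carrier_vec d"
    and \<rho>_eq: "\<rho> = mat_sum d n (\<lambda>j. complex_of_real (p j) \<cdot>\<^sub>m proj (\<psi> j))"
    using dec by (auto simp: pure_decomposition_def unit_vectors_def)
  have ne: "M_tilde d m \<noteq> {}" using M_tilde_nonempty_iff m by auto
  have "\<exists>w c. w \<in> unit_vectors d \<and> (\<forall>i<d. (cmod (w $ i))\<^sup>2 \<le> 1 / real m) \<and> 0 \<le> c \<and>
      \<psi> j \<bullet>c w = complex_of_real c \<and> Re (flat_value m (\<Lambda> j (proj (\<psi> j)))) \<le> c\<^sup>2" if j: "j < n" for j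
  proof -
    obtain M where M: "psd d M" "\<And>v. v \<in> carrier_vec d \<Longrightarrow> Re ((M *\<^sub>v v) \<bullet>c v) \<le> (vnorm v)\<^sup>2"
      "\<And>i. i < d \<Longrightarrow> M $$ (i, i) = complex_of_real (1 / real m)"
      "\<And>v. v \<in> carrier_vec d \<Longrightarrow> flat_value m (\<Lambda> j (proj v)) = (M *\<^sub>v v) \<bullet>c v"
      using free_operation_dual[of "\<Lambda> j" \<O> d m] \<Lambda> j m(1) by blast
    show ?thesis
      using flat_vector_above_quadratic_form[OF M(1-3) m \<psi>[OF j]] M(4)[OF \<psi>[OF j]] by metis
  qed
  then obtain w c where w: "\<And>j. j < n \<Longrightarrow> w j \<in> unit_vectors d"
    "\<And>j i. j < n \<Longrightarrow> i < d \<Longrightarrow> (cmod (w j $ i))\<^sup>2 \<le> 1 / real m"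
    and c: "\<And>j. j < n \<Longrightarrow> 0 \<le> c j" "\<And>j. j < n \<Longrightarrow> \<psi> j \<bullet>c w j = complex_of_real (c j)"
      "\<And>j. j < n \<Longrightarrow> Re (flat_value m (\<Lambda> j (proj (\<psi> j)))) \<le> (c j)\<^sup>2"
    by metis
  have cw: "w j \<in> carrier_vec d" "(\<Sum>i<d. (cmod (w j $ i))\<^sup>2) = 1" if "j < n" for j
    using w(1)[OF that] vnorm_sq[of "w j" d] by (auto simp: unit_vectors_def)
  define T where "T = (\<Sum>j<n. p j * (c j)\<^sup>2)"
  have xT: "x \<le> T" unfolding x ensemble_value_def T_def using p(1) c(3) by (intro sum_mono mult_left_mono) auto
  show ?thesis
  proof (cases "T = 0")
    case True
    then show ?thesis using xT fidelity_tilde_nonneg[OF \<rho> ne] by simp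
  next
    case False
    moreover have "0 \<le> T" unfolding T_def using p(1) by (intro sum_nonneg mult_nonneg_nonneg) auto
    ultimately have T: "0 < T" by simp
    let ?A = "mat d n (\<lambda>(i, j). complex_of_real (sqrt (p j)) * \<psi> j $ i)"
    \<comment> \<open>The weights \<open>(b j)\<^sup>2 = p j * (c j)\<^sup>2 / T\<close> are the
      equality case of Cauchy-Schwarz: they make the overlap \<open>sqrt T\<close>, while the
      weights \<open>p j\<close> would give only the sum of \<open>p j * c j\<close>.\<close>
    define b where "b = (\<lambda>j. sqrt (p j) * c j / sqrt T)"
    let ?B = "mat d n (\<lambda>(i, j). complex_of_real (b j) * w j $ i)"
    have A: "?A \<in> carrier_mat d n" and B: "?B \<in> carrier_mat d n" by auto
    have b2: "(b j)\<^sup>2 = p j * (c j)\<^sup>2 / T" if "j < n" for j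
      using p(1)[OF that] T by (simp add: b_def power_mult_distrib power_divide)
    have b1: "(\<Sum>j<n. (b j)\<^sup>2) = 1"
      using T b2 by (simp add: T_def flip: sum_divide_distrib)
    have "?A * ?A\<^sup>\<dagger> = \<rho>"
    proof (rule eq_matI)
      fix a b' assume "a < dim_row \<rho>" "b' < dim_col \<rho>"
      then have ab: "a < d" "b' < d" by (auto simp: \<rho>_eq mat_sum_def)
      have "?A $$ (a, j) * cnj (?A $$ (b', j)) = (complex_of_real (p j) \<cdot>\<^sub>m proj (\<psi> j)) $$ (a, b')" if j: "j < n" for j
      proof -
        have "?A $$ (a, j) * cnj (?A $$ (b', j)) = complex_of_real (sqrt (p j) * sqrt (p j)) * (\<psi> j $ a * cnj (\<psi> j $ b'))"
          using ab j by (simp only: index_mat case_prod_conv of_real_mult complex_cnj_mult complex_cnj_complex_of_real mult_ac)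
        also have "\<dots> = complex_of_real (p j) * (\<psi> j $ a * cnj (\<psi> j $ b'))"
          by (simp only: real_sqrt_mult_self abs_of_nonneg[OF p(1)[OF j]])
        finally show ?thesis
          using ab carrier_matD[OF proj_carrier[OF \<psi>[OF j]]] by (simp add: proj_index[OF \<psi>[OF j]])
      qed
      then show "(?A * ?A\<^sup>\<dagger>) $$ (a, b') = \<rho> $$ (a, b')"
        unfolding gram_index[OF A ab] unfolding \<rho>_eq mat_sum_index[OF ab] by (intro sum.cong) auto
    qed (auto simp: \<rho>_eq mat_sum_def)
    have Bij: "(cmod (?B $$ (i, j)))\<^sup>2 = (b j)\<^sup>2 * (cmod (w j $ i))\<^sup>2" if "i < d" "j < n" for i j
      using that by (simp add: norm_mult norm_divide power_mult_distrib power_divide)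
    have "(\<Sum>j<n. \<Sum>i<d. (cmod (?B $$ (i, j)))\<^sup>2) = (\<Sum>j<n. \<Sum>i<d. (b j)\<^sup>2 * (cmod (w j $ i))\<^sup>2)"
      by (intro sum.cong refl Bij) auto
    also have "\<dots> = (\<Sum>j<n. (b j)\<^sup>2)"
      using cw(2) by (intro sum.cong refl) (simp add: sum_distrib_left[symmetric])
    finally have "?B * ?B\<^sup>\<dagger> \<in> density d"
      using psd_gram[OF B] gram_trace[OF B] b1 by (simp add: density_def)
    moreover have "Re ((?B * ?B\<^sup>\<dagger>) $$ (i, i)) \<le> 1 / real m" if i: "i < d" for i
    proof -
      have "Re ((?B * ?B\<^sup>\<dagger>) $$ (i, i)) = (\<Sum>j<n. (b j)\<^sup>2 * (cmod (w j $ i))\<^sup>2)"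
        unfolding gram_diag_index[OF B i] using i by (simp only: Re_complex_of_real) (intro sum.cong refl Bij, auto)
      also have "\<dots> \<le> (\<Sum>j<n. (b j)\<^sup>2 * (1 / real m))"
        using w(2) i by (intro sum_mono mult_left_mono) auto
      also have "\<dots> = 1 / real m" using b1 by (simp only: sum_distrib_right[symmetric])
      finally show ?thesis .
    qed
    ultimately have M: "?B * ?B\<^sup>\<dagger> \<in> M_tilde d m" by (simp add: M_tilde_iff)
    have "mat_trace (?B\<^sup>\<dagger> * ?A) = (\<Sum>j<n. complex_of_real (p j * (c j)\<^sup>2 / sqrt T))"
      unfolding trace_adjoint_mult[OF A B]
    proof (intro sum.cong refl)
      fix j assume "j \<in> {..<n}"
      then have j: "j < n" by simp
      have "(\<Sum>i<d. ?A $$ (i, j) * cnj (?B $$ (i, j))) = complex_of_real (sqrt (p j) * b j) * (\<psi> j \<bullet>c w j)"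
        unfolding cinner_index[OF \<psi>[OF j] cw(1)[OF j]] sum_distrib_left using j
        by (intro sum.cong) auto
      also have "\<dots> = complex_of_real (sqrt (p j) * b j * c j)" using c(2)[OF j] by simp
      also have "sqrt (p j) * b j * c j = p j * (c j)\<^sup>2 / sqrt T"
        using p(1)[OF j] by (simp add: b_def power2_eq_square)
      finally show "(\<Sum>i<d. ?A $$ (i, j) * cnj (?B $$ (i, j))) = complex_of_real (p j * (c j)\<^sup>2 / sqrt T)" .
    qed
    also have "\<dots> = complex_of_real (T / sqrt T)" by (simp add: T_def sum_divide_distrib)
    also have "T / sqrt T = sqrt T" using T by (simp add: real_div_sqrt)
    finally have "(cmod (mat_trace (?B\<^sup>\<dagger> * ?A)))\<^sup>2 = T" using T by simp
    then have "T \<le> fidelity \<rho> (?B * ?B\<^sup>\<dagger>)"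
      using fidelity_ge_overlap[OF A B] \<open>?A * ?A\<^sup>\<dagger> = \<rho>\<close> by simp
    also have "\<dots> \<le> fidelity_tilde d \<rho> m" by (rule fidelity_le_fidelity_tilde[OF \<rho> M])
    finally show ?thesis using xT by simp
  qed
qed

lemma assisted_fidelity_le_fidelity_tilde:
  assumes "\<rho> \<in> density d" "1 \<le> m" "m \<le> d"
  shows "assisted_fidelity \<O> d \<rho> m \<le> fidelity_tilde d \<rho> m"
  unfolding assisted_fidelity_Sup
  using ensemble_values_nonempty ensemble_value_le_fidelity_tilde assms by (intro cSup_least) auto

lemma assisted_fidelity_upper:
  assumes "\<rho> \<in> density d" "1 \<le> m" "m \<le> d" "x \<in> ensemble_values \<O> d \<rho> m"
  shows "x \<le> assisted_fidelity \<O> d \<rho> m"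
  unfolding assisted_fidelity_Sup
  using assms ensemble_value_le_fidelity_tilde[OF assms(1-3)] by (intro cSup_upper bdd_aboveI) auto

text \<open>The dual operator has trace \<open>d / m\<close>, which bounds its expectation in every
  unit vector, also for \<open>m\<close> above \<open>d\<close>.\<close>

lemma assisted_fidelity_le_ratio:
  assumes \<rho>: "\<rho> \<in> density d" and m: "1 \<le> m"
  shows "assisted_fidelity \<O> d \<rho> m \<le> real d / real m"
  unfolding assisted_fidelity_Sup
proof (rule cSup_least)
  fix x assume "x \<in> ensemble_values \<O> d \<rho> m"
  then obtain n p \<psi> \<Lambda> where dec: "pure_decomposition d \<rho> n p \<psi>" and \<Lambda>: "\<forall>j<n. \<Lambda> j \<in> free_operations \<O> d m"
    and x: "x = ensemble_value m n p \<psi> \<Lambda>"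
    by (auto simp: ensemble_values_def)
  have "Re (flat_value m (\<Lambda> j (proj (\<psi> j)))) \<le> real d / real m" if j: "j < n" for j
  proof -
    obtain M where M: "psd d M" "\<And>i. i < d \<Longrightarrow> M $$ (i, i) = complex_of_real (1 / real m)"
      "\<And>v. v \<in> carrier_vec d \<Longrightarrow> flat_value m (\<Lambda> j (proj v)) = (M *\<^sub>v v) \<bullet>c v"
      using free_operation_dual[of "\<Lambda> j" \<O> d m] \<Lambda> j m by metis
    have \<psi>: "\<psi> j \<in> carrier_vec d" "vnorm (\<psi> j) = 1"
      using dec j by (auto simp: pure_decomposition_def unit_vectors_def)
    show ?thesis
      using psd_form_le_trace[OF M(1) \<psi>] M(2,3) \<psi> psd_carrier[OF M(1)] by (simp add: trace_index)
  qed
  then have "x \<le> (\<Sum>j<n. p j * (real d / real m))"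
    unfolding x ensemble_value_def using dec by (intro sum_mono mult_left_mono) (auto simp: pure_decomposition_def)
  also have "\<dots> = real d / real m"
    using dec by (simp add: pure_decomposition_def flip: sum_distrib_right sum_divide_distrib)
  finally show "x \<le> real d / real m" .
qed (rule ensemble_values_nonempty[OF \<rho> m])

text \<open>For a one-dimensional target the value is the trace of the output. It guarantees that
  the maximum defining the rate ranges over a nonempty set.\<close>

lemma assisted_fidelity_1:
  assumes \<rho>: "\<rho> \<in> density d"
  shows "1 \<le> assisted_fidelity \<O> d \<rho> 1"
proof -
  obtain x where x: "x \<in> ensemble_values \<O> d \<rho> 1" using ensemble_values_nonempty[OF \<rho>] by blast
  then obtain n p \<psi> \<Lambda> where dec: "pure_decomposition d \<rho> n p \<psi>" and \<Lambda>: "\<forall>j<n. \<Lambda> j \<in> free_operations \<O> d 1"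
    and x_eq: "x = ensemble_value 1 n p \<psi> \<Lambda>"
    by (auto simp: ensemble_values_def)
  have "flat_value 1 (\<Lambda> j (proj (\<psi> j))) = 1" if j: "j < n" for j
  proof -
    note ch = free_operation_channel[OF \<Lambda>[rule_format, OF j]]
    have \<psi>: "\<psi> j \<in> carrier_vec d" "vnorm (\<psi> j) = 1"
      using dec j by (auto simp: pure_decomposition_def unit_vectors_def)
    have "mat_trace (\<Lambda> j (proj (\<psi> j))) = 1" using channel_trace[OF ch] \<psi> by (simp add: proj_trace)
    then show ?thesis
      using channel_carrier[OF ch proj_carrier[OF \<psi>(1)]] by (simp add: flat_value_def trace_index)
  qed
  then have "x = 1" unfolding x_eq ensemble_value_def using dec by (simp add: pure_decomposition_def)
  then show ?thesis using assisted_fidelity_upper[OF \<rho> _ _ x] density_dim_pos[OF \<rho>] by simp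
qed

subsection \<open>Equality in dimension at most three\<close>

text \<open>Normalised columns of \<open>B\<close> are flat, hence convertible to the target;
  applying that conversion to the matching column of \<open>A\<close> succeeds at least as well as
  their overlap. Cauchy-Schwarz over the columns, with the weights of \<open>B\<close> summing to 1,
  collects the estimates.\<close>

lemma fidelity_le_ensemble_value:
  assumes \<rho>: "A * A\<^sup>\<dagger> \<in> density d" and A: "A \<in> carrier_mat d n" and B: "B \<in> carrier_mat d n"
    and flat: "\<And>i j. i < d \<Longrightarrow> j < n \<Longrightarrow> (cmod (B $$ (i, j)))\<^sup>2 \<le> (\<Sum>k<d. (cmod (B $$ (k, j)))\<^sup>2) / real m"
    and B1: "(\<Sum>j<n. \<Sum>k<d. (cmod (B $$ (k, j)))\<^sup>2) = 1" and m: "1 \<le> m"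
  obtains x where "x \<in> ensemble_values \<O> d (A * A\<^sup>\<dagger>) m" "(cmod (mat_trace (B\<^sup>\<dagger> * A)))\<^sup>2 \<le> x"
proof -
  have d: "1 \<le> d" using density_dim_pos[OF \<rho>] .
  obtain p \<psi> where dec: "pure_decomposition d (A * A\<^sup>\<dagger>) n p \<psi>"
    and Aij: "\<And>i j. i < d \<Longrightarrow> j < n \<Longrightarrow> A $$ (i, j) = complex_of_real (sqrt (p j)) * \<psi> j $ i"
    using pure_decomposition_gram[OF \<rho> A] by blast
  have p: "\<And>j. j < n \<Longrightarrow> 0 \<le> p j" and \<psi>: "\<And>j. j < n \<Longrightarrow> \<psi> j \<in> carrier_vec d"
    using dec by (auto simp: pure_decomposition_def unit_vectors_def)
  define q where "q = (\<lambda>j. \<Sum>k<d. (cmod (B $$ (k, j)))\<^sup>2)"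
  have q0: "0 \<le> q j" for j by (simp add: q_def sum_nonneg)
  have "\<exists>u\<in>unit_vectors d. \<forall>i<d. B $$ (i, j) = complex_of_real (sqrt (q j)) * u $ i" for j
    using column_normalise[OF d, of "\<lambda>i. B $$ (i, j)"] unfolding q_def by metis
  then obtain \<phi> where \<phi>: "\<And>j. \<phi> j \<in> unit_vectors d"
    "\<And>i j. i < d \<Longrightarrow> B $$ (i, j) = complex_of_real (sqrt (q j)) * \<phi> j $ i" by metis
  have c\<phi>: "\<phi> j \<in> carrier_vec d" "vnorm (\<phi> j) = 1" for j using \<phi>(1)[of j] by (auto simp: unit_vectors_def)
  \<comment> \<open>The factor \<open>q j\<close> on both sides allows any free operation for a zero
    column of \<open>B\<close>, whose direction is arbitrary.\<close>
  have "\<exists>\<Lambda>\<in>free_operations \<O> d m. q j * (cmod (\<psi> j \<bullet>c \<phi> j))\<^sup>2 \<le> q j * Re (flat_value m (\<Lambda> (proj (\<psi> j))))"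
    if j: "j < n" for j
  proof (cases "q j = 0")
    case True
    then show ?thesis using free_operation_exists[OF m d, of \<O>] by auto
  next
    case False
    have "(cmod (\<phi> j $ i))\<^sup>2 \<le> 1 / real m" if i: "i < d" for i
    proof -
      have "(cmod (B $$ (i, j)))\<^sup>2 \<le> q j / real m" using flat[OF i j] by (simp add: q_def)
      then have *: "q j * (cmod (\<phi> j $ i))\<^sup>2 \<le> q j * (1 / real m)"
        using \<phi>(2)[OF i, of j] q0[of j] by (simp add: norm_mult power_mult_distrib)
      have "0 < q j" using False q0[of j] by simp
      then show ?thesis by (rule mult_left_le_imp_le[OF *])
    qed
    then obtain \<Lambda> where "\<Lambda> \<in> free_operations \<O> d m" "(cmod (\<psi> j \<bullet>c \<phi> j))\<^sup>2 \<le> Re (flat_value m (\<Lambda> (proj (\<psi> j))))"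
      using flat_state_conversion[OF c\<phi>(1)[of j] _ c\<phi>(2)[of j] m \<psi>[OF j]] by blast
    then show ?thesis using q0[of j] by (auto intro!: mult_left_mono)
  qed
  then obtain \<Lambda> where \<Lambda>: "\<And>j. j < n \<Longrightarrow> \<Lambda> j \<in> free_operations \<O> d m"
    "\<And>j. j < n \<Longrightarrow> q j * (cmod (\<psi> j \<bullet>c \<phi> j))\<^sup>2 \<le> q j * Re (flat_value m (\<Lambda> j (proj (\<psi> j))))" by metis
  define v where "v = (\<lambda>j. Re (flat_value m (\<Lambda> j (proj (\<psi> j)))))"
  have v0: "0 \<le> v j" if "j < n" for j
    using channel_flat_value(1)[OF free_operation_channel[OF \<Lambda>(1)[OF that]] m \<psi>[OF that]]
    by (simp add: v_def less_eq_complex_def)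
  have ens: "ensemble_value m n p \<psi> \<Lambda> = (\<Sum>j<n. p j * v j)" by (simp add: ensemble_value_def v_def)
  have q1: "(\<Sum>j<n. q j) = 1" using B1 by (simp add: q_def)
  have overlap: "cmod (\<Sum>i<d. A $$ (i, j) * cnj (B $$ (i, j))) \<le> sqrt (q j) * sqrt (p j * v j)" if j: "j < n" for j
  proof -
    have "(\<Sum>i<d. A $$ (i, j) * cnj (B $$ (i, j))) = complex_of_real (sqrt (p j) * sqrt (q j)) * (\<psi> j \<bullet>c \<phi> j)"
      unfolding cinner_index[OF \<psi>[OF j] c\<phi>(1)] sum_distrib_left using j
      by (intro sum.cong) (auto simp: Aij \<phi>(2))
    then have "cmod (\<Sum>i<d. A $$ (i, j) * cnj (B $$ (i, j))) = sqrt (p j) * (sqrt (q j) * cmod (\<psi> j \<bullet>c \<phi> j))"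
      using p[OF j] q0[of j] by (simp add: norm_mult)
    also have "sqrt (q j) * cmod (\<psi> j \<bullet>c \<phi> j) = sqrt (q j * (cmod (\<psi> j \<bullet>c \<phi> j))\<^sup>2)"
      by (simp add: real_sqrt_mult)
    also have "sqrt (p j) * \<dots> \<le> sqrt (p j) * sqrt (q j * v j)"
      using \<Lambda>(2)[OF j] p[OF j] by (intro mult_left_mono) (auto simp: v_def)
    finally show ?thesis by (simp add: real_sqrt_mult algebra_simps)
  qed
  have "cmod (mat_trace (B\<^sup>\<dagger> * A)) \<le> (\<Sum>j<n. \<bar>sqrt (q j)\<bar> * \<bar>sqrt (p j * v j)\<bar>)"
    unfolding trace_adjoint_mult[OF A B]
  proof (rule sum_norm_le)
    fix j assume "j \<in> {..<n}"
    then have j: "j < n" by simp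
    show "cmod (\<Sum>i<d. A $$ (i, j) * cnj (B $$ (i, j))) \<le> \<bar>sqrt (q j)\<bar> * \<bar>sqrt (p j * v j)\<bar>"
      using overlap[OF j] p[OF j] q0[of j] v0[OF j] by simp
  qed
  also have "\<dots> \<le> L2_set (\<lambda>j. sqrt (q j)) {..<n} * L2_set (\<lambda>j. sqrt (p j * v j)) {..<n}"
    by (rule L2_set_mult_ineq)
  also have "\<dots> = sqrt (ensemble_value m n p \<psi> \<Lambda>)"
    using q0 p v0 by (simp add: L2_set_def ens q1)
  finally have "(cmod (mat_trace (B\<^sup>\<dagger> * A)))\<^sup>2 \<le> (sqrt (ensemble_value m n p \<psi> \<Lambda>))\<^sup>2"
    by (intro power_mono) auto
  also have "\<dots> = ensemble_value m n p \<psi> \<Lambda>"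
    unfolding ens using p v0 by (intro real_sqrt_pow2 sum_nonneg mult_nonneg_nonneg) auto
  finally have "(cmod (mat_trace (B\<^sup>\<dagger> * A)))\<^sup>2 \<le> ensemble_value m n p \<psi> \<Lambda>" .
  moreover have "ensemble_value m n p \<psi> \<Lambda> \<in> ensemble_values \<O> d (A * A\<^sup>\<dagger>) m"
    unfolding ensemble_values_def using dec \<Lambda>(1) by blast
  ultimately show thesis using that by blast
qed

text \<open>For \<open>d \<le> 3\<close> the conditions \<open>|B i j|\<^sup>2 = \<omega> i i * (\<Sum>k. |B k j|\<^sup>2)\<close> on a column amount to two real
  equations, i.e. to the vanishing of one complex diagonal form, whose mean over the columns is zero.\<close>

lemma gram_with_proportional_columns:
  assumes \<omega>: "\<omega> \<in> density d" and d: "d \<le> 3"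
  obtains n B where "B \<in> carrier_mat d n" "\<omega> = B * B\<^sup>\<dagger>"
    "\<And>i j. i < d \<Longrightarrow> j < n \<Longrightarrow> (cmod (B $$ (i, j)))\<^sup>2 = Re (\<omega> $$ (i, i)) * (\<Sum>k<d. (cmod (B $$ (k, j)))\<^sup>2)"
proof -
  obtain n E where E: "E \<in> carrier_mat d n" "\<omega> = E * E\<^sup>\<dagger>"
    using psd_gram_exists[OF density_psd[OF \<omega>]] .
  \<comment> \<open>The value 0 beyond the dimension keeps \<open>w 1\<close> meaningful when
    \<open>d = 1\<close>.\<close>
  define w where "w = (\<lambda>i::nat. if i < d then Re (\<omega> $$ (i, i)) else 0)"
  have w1: "(\<Sum>i<d. w i) = 1"
  proof -
    have "mat_trace \<omega> = 1" "\<omega> \<in> carrier_mat d d" using \<omega> by (auto simp: density_def psd_def)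
    then have "Re (\<Sum>i<d. \<omega> $$ (i, i)) = 1" by (simp only: trace_index one_complex.sel)
    then show ?thesis by (simp add: w_def)
  qed
  \<comment> \<open>The real part of the form is the defect of the proportionality condition at
    index 0, the imaginary part the defect at index 1.\<close>
  define \<tau> where "\<tau> = (\<lambda>i::nat. Complex (of_bool (i = 0) - w 0) (of_bool (i = 1) - w 1))"
  have form: "diag_form d \<tau> x = Complex (\<Sum>i<d. (of_bool (i = 0) - w 0) * (cmod (x i))\<^sup>2)
      (\<Sum>i<d. (of_bool (i = 1) - w 1) * (cmod (x i))\<^sup>2)" for x
    unfolding diag_form_def complex_norm_square[symmetric] \<tau>_def by (simp add: complex_eq_iff)
  let ?z = "\<lambda>j i. E $$ (i, j)"
  obtain z where z: "\<And>a b. (\<Sum>j<n. z j a * cnj (z j b)) = (\<Sum>j<n. ?z j a * cnj (?z j b))"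
    "\<And>j. j < n \<Longrightarrow> complex_of_real (real n) * diag_form d \<tau> (z j) = (\<Sum>j<n. diag_form d \<tau> (?z j))"
    using diag_form_equalise[of n ?z d \<tau>] by blast
  have "(\<Sum>j<n. diag_form d \<tau> (?z j)) = (\<Sum>i<d. \<tau> i * (\<Sum>j<n. ?z j i * cnj (?z j i)))"
    unfolding diag_form_def by (subst sum.swap) (simp add: sum_distrib_left)
  also have "\<dots> = (\<Sum>i<d. \<tau> i * complex_of_real (w i))"
  proof (intro sum.cong refl)
    fix i assume "i \<in> {..<d}"
    then have i: "i < d" by simp
    have "(\<Sum>j<n. ?z j i * cnj (?z j i)) = \<omega> $$ (i, i)" unfolding E(2) using gram_index[OF E(1) i i] by simp
    also have "\<dots> = complex_of_real (w i)"
      using \<omega> psd_diag[of d \<omega> i] i by (auto simp: w_def density_def less_eq_complex_def complex_eq_iff)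
    finally show "\<tau> i * (\<Sum>j<n. ?z j i * cnj (?z j i)) = \<tau> i * complex_of_real (w i)" by simp
  qed
  \<comment> \<open>Averaged over the columns both conditions hold: index \<open>k\<close> carries
    total weight \<open>w k\<close>, and the total squared norm is 1.\<close>
  also have "\<dots> = 0"
  proof -
    have "(\<Sum>i<d. (of_bool (i = k) - w k) * w i) = 0" for k
    proof -
      have "(\<Sum>i<d. (of_bool (i = k) - w k) * w i) = (\<Sum>i<d. if i = k then w k else 0) - w k * (\<Sum>i<d. w i)"
        unfolding sum_distrib_left sum_subtractf[symmetric] by (intro sum.cong) (auto simp: algebra_simps)
      then show ?thesis using w1 by (simp add: w_def)
    qed
    then show ?thesis by (simp add: complex_eq_iff \<tau>_def)
  qed
  finally have zero: "diag_form d \<tau> (z j) = 0" if "j < n" for j using z(2)[OF that] that by auto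
  have ratio: "(cmod (z j i))\<^sup>2 = w i * (\<Sum>k<d. (cmod (z j k))\<^sup>2)" if j: "j < n" and i: "i < d" for i j
  proof -
    let ?s = "\<Sum>k<d. (cmod (z j k))\<^sup>2"
    have "(\<Sum>i<d. (of_bool (i = k) - w k) * (cmod (z j i))\<^sup>2) = (cmod (z j k))\<^sup>2 - w k * ?s" if "k < d" for k
    proof -
      have "(\<Sum>i<d. (of_bool (i = k) - w k) * (cmod (z j i))\<^sup>2) =
          (\<Sum>i<d. if i = k then (cmod (z j k))\<^sup>2 else 0) - w k * ?s"
        unfolding sum_distrib_left sum_subtractf[symmetric] by (intro sum.cong) (auto simp: algebra_simps)
      then show ?thesis using that by simp
    qed
    then have 01: "(cmod (z j k))\<^sup>2 = w k * ?s" if "k < d" "k < 2" for k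
      using zero[OF j] that unfolding form complex_eq_iff by (cases "k = 0") (auto simp: less_2_cases_iff)
    show ?thesis
    proof (cases "i < 2")
      case False
      \<comment> \<open>The bound on the dimension enters here: a single index is left, and its
        condition is the difference between the total and the two others.\<close>
      then have d3: "d = 3" "i = 2" using i d by auto
      have "?s = (cmod (z j 0))\<^sup>2 + (cmod (z j 1))\<^sup>2 + (cmod (z j 2))\<^sup>2" "w 0 + w 1 + w 2 = 1"
        using w1 by (simp_all add: d3 eval_nat_numeral)
      moreover have "(cmod (z j 0))\<^sup>2 = w 0 * ?s" "(cmod (z j 1))\<^sup>2 = w 1 * ?s" using 01 d3 by auto
      ultimately have "(cmod (z j 2))\<^sup>2 = (1 - w 0 - w 1) * ?s" by (simp add: algebra_simps)
      also have "1 - w 0 - w 1 = w 2" using \<open>w 0 + w 1 + w 2 = 1\<close> by simp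
      finally show ?thesis by (simp add: d3)
    qed (use 01 i in blast)
  qed
  let ?B = "mat d n (\<lambda>(i, j). z j i)"
  have B: "?B \<in> carrier_mat d n" by simp
  show thesis
  proof (rule that[OF B])
    show "\<omega> = ?B * ?B\<^sup>\<dagger>"
    proof (rule eq_matI)
      fix a b assume "a < dim_row (?B * ?B\<^sup>\<dagger>)" "b < dim_col (?B * ?B\<^sup>\<dagger>)"
      then have ab: "a < d" "b < d" by auto
      then show "\<omega> $$ (a, b) = (?B * ?B\<^sup>\<dagger>) $$ (a, b)"
        unfolding gram_index[OF B ab] unfolding E(2) gram_index[OF E(1) ab] z(1)[of a b, symmetric] by simp
    qed (use E in auto)
    show "(cmod (?B $$ (i, j)))\<^sup>2 = Re (\<omega> $$ (i, i)) * (\<Sum>k<d. (cmod (?B $$ (k, j)))\<^sup>2)" if "i < d" "j < n" for i j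
      using ratio[OF that(2,1)] that by (simp add: w_def)
  qed
qed

text \<open>A factor of \<open>\<omega>\<close> with flat columns is fixed before Uhlmann's theorem
  is applied, so the optimal factor of \<open>\<rho>\<close> is aligned with it column by
  column.\<close>

lemma fidelity_tilde_le_assisted_fidelity:
  assumes \<rho>: "\<rho> \<in> density d" and m: "1 \<le> m" "m \<le> d" and d: "d \<le> 3"
  shows "fidelity_tilde d \<rho> m \<le> assisted_fidelity \<O> d \<rho> m"
  unfolding fidelity_tilde_def
proof (rule cSUP_least)
  show "M_tilde d m \<noteq> {}" using M_tilde_nonempty_iff m by auto
  fix \<omega> assume "\<omega> \<in> M_tilde d m"
  then have \<omega>: "\<omega> \<in> density d" and \<omega>m: "\<And>i. i < d \<Longrightarrow> Re (\<omega> $$ (i, i)) \<le> 1 / real m" by (auto simp: M_tilde_iff)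
  obtain n B where B: "B \<in> carrier_mat d n" "\<omega> = B * B\<^sup>\<dagger>"
    and ratio: "\<And>i j. i < d \<Longrightarrow> j < n \<Longrightarrow> (cmod (B $$ (i, j)))\<^sup>2 = Re (\<omega> $$ (i, i)) * (\<Sum>k<d. (cmod (B $$ (k, j)))\<^sup>2)"
    by (rule gram_with_proportional_columns[OF \<omega> d]) (rule that)
  have "complex_of_real (\<Sum>j<n. \<Sum>i<d. (cmod (B $$ (i, j)))\<^sup>2) = complex_of_real 1"
    using gram_trace[OF B(1)] \<omega> B(2) by (simp add: density_def)
  then have B1: "(\<Sum>j<n. \<Sum>i<d. (cmod (B $$ (i, j)))\<^sup>2) = 1" by (rule of_real_eq_iff[THEN iffD1])
  obtain A r E where A: "A \<in> carrier_mat d n" and E: "E \<in> carrier_mat d r"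
    and \<rho>_eq: "\<rho> = A * A\<^sup>\<dagger> + E * E\<^sup>\<dagger>" and F: "fidelity \<rho> \<omega> = (cmod (mat_trace (B\<^sup>\<dagger> * A)))\<^sup>2"
    using fidelity_attained[OF density_psd[OF \<rho>] B(1), folded B(2)] .
  \<comment> \<open>The remainder of \<open>\<rho>\<close> is appended as columns facing zero
    columns of \<open>?B\<close>, which changes neither the overlap nor flatness.\<close>
  let ?A = "mat d (n + r) (\<lambda>(i, j). if j < n then A $$ (i, j) else E $$ (i, j - n))"
  let ?B = "mat d (n + r) (\<lambda>(i, j). if j < n then B $$ (i, j) else 0)"
  have cA: "?A \<in> carrier_mat d (n + r)" and cB: "?B \<in> carrier_mat d (n + r)" by auto
  have split: "(\<Sum>j<n + r. g j) = (\<Sum>j<n. g j) + (\<Sum>j<r. g (n + j))" for g :: "nat \<Rightarrow> 'a::comm_monoid_add"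
    by (induction r) (simp_all add: add.assoc)
  have AA: "?A * ?A\<^sup>\<dagger> = \<rho>"
  proof (rule eq_matI)
    fix a b assume "a < dim_row \<rho>" "b < dim_col \<rho>"
    then have ab: "a < d" "b < d" using E by (auto simp: \<rho>_eq)
    then have "(?A * ?A\<^sup>\<dagger>) $$ (a, b) = (A * A\<^sup>\<dagger>) $$ (a, b) + (E * E\<^sup>\<dagger>) $$ (a, b)"
      unfolding gram_index[OF cA ab] gram_index[OF A ab] gram_index[OF E ab] split by simp
    also have "\<dots> = \<rho> $$ (a, b)" unfolding \<rho>_eq using A E ab by (simp del: index_mult_mat(1))
    finally show "(?A * ?A\<^sup>\<dagger>) $$ (a, b) = \<rho> $$ (a, b)" .
  qed (use E in \<open>auto simp: \<rho>_eq\<close>)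
  have tr: "mat_trace (?B\<^sup>\<dagger> * ?A) = mat_trace (B\<^sup>\<dagger> * A)"
    unfolding trace_adjoint_mult[OF cA cB] trace_adjoint_mult[OF A B(1)] split by simp
  have flat: "(cmod (?B $$ (i, j)))\<^sup>2 \<le> (\<Sum>k<d. (cmod (?B $$ (k, j)))\<^sup>2) / real m" if "i < d" "j < n + r" for i j
  proof (cases "j < n")
    case True
    have "(cmod (B $$ (i, j)))\<^sup>2 \<le> 1 / real m * (\<Sum>k<d. (cmod (B $$ (k, j)))\<^sup>2)"
      unfolding ratio[OF that(1) True] by (intro mult_right_mono \<omega>m that sum_nonneg) simp
    then show ?thesis using that True by simp
  qed (use that in \<open>simp add: sum_nonneg\<close>)
  have one: "(\<Sum>j<n + r. \<Sum>k<d. (cmod (?B $$ (k, j)))\<^sup>2) = 1"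
    unfolding split using B1 by simp
  have "?A * ?A\<^sup>\<dagger> \<in> density d" unfolding AA by (rule \<rho>)
  then obtain x where "x \<in> ensemble_values \<O> d (?A * ?A\<^sup>\<dagger>) m" "(cmod (mat_trace (?B\<^sup>\<dagger> * ?A)))\<^sup>2 \<le> x"
    using cA cB flat one m(1) by (rule fidelity_le_ensemble_value)
  then have "x \<in> ensemble_values \<O> d \<rho> m" "fidelity \<rho> \<omega> \<le> x" unfolding F AA tr by simp_all
  then show "fidelity \<rho> \<omega> \<le> assisted_fidelity \<O> d \<rho> m"
    using assisted_fidelity_upper[OF \<rho> m] order_trans by blast
qed

section \<open>From fidelities to rates\<close>

theorem corollary5:
  fixes \<O> :: free_class and d :: nat and \<epsilon> :: real and \<rho> :: "complex mat"
  assumes "\<rho> \<in> density d"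
    and "0 \<le> \<epsilon>"
  shows "(\<epsilon> < 1 / (real d + 1) \<longrightarrow>
            assisted_rate \<O> d \<epsilon> \<rho> \<le> rate_tilde d \<epsilon> \<rho> \<and>
            (d \<le> 3 \<longrightarrow> assisted_rate \<O> d \<epsilon> \<rho> = rate_tilde d \<epsilon> \<rho>)) \<and>
         (assisted_rate_within \<O> d \<epsilon> \<rho> \<le> rate_tilde d \<epsilon> \<rho> \<and>
            (d \<le> 3 \<longrightarrow> assisted_rate_within \<O> d \<epsilon> \<rho> = rate_tilde d \<epsilon> \<rho>))"
proof -
  note \<rho> = assms(1)
  have d: "1 \<le> d" using density_dim_pos[OF \<rho>] .
  define T where "T = {m. 1 \<le> m \<and> M_tilde d m \<noteq> {} \<and> 1 - \<epsilon> \<le> fidelity_tilde d \<rho> m}"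
  define W where "W = {m. 1 \<le> m \<and> m \<le> d \<and> 1 - \<epsilon> \<le> assisted_fidelity \<O> d \<rho> m}"
  have T: "T = {m. 1 \<le> m \<and> m \<le> d \<and> 1 - \<epsilon> \<le> fidelity_tilde d \<rho> m}"
    unfolding T_def using M_tilde_nonempty_iff[OF _ d] by blast
  have fin: "finite T" unfolding T by (rule finite_subset[of _ "{..d}"]) auto
  have sub: "W \<subseteq> T"
    unfolding W_def T using assisted_fidelity_le_fidelity_tilde[OF \<rho>] by (auto intro: order_trans)
  \<comment> \<open>The trivial target always qualifies for nonnegative \<open>\<epsilon>\<close>;
    hence both maxima exist and are at least 1, where the logarithm is monotone.\<close>
  have "1 \<in> W" using assisted_fidelity_1[OF \<rho>, of \<O>] d assms(2) by (simp add: W_def)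
  then have ne: "W \<noteq> {}" by blast
  have "Max W \<le> Max T" by (rule Max_mono[OF sub ne fin])
  moreover have "1 \<le> Max W" using \<open>1 \<in> W\<close> finite_subset[OF sub fin] by (rule Max_ge[rotated])
  ultimately have le: "log 2 (real (Max W)) \<le> log 2 (real (Max T))" by simp
  have eq: "W = T" if "d \<le> 3"
    using sub fidelity_tilde_le_assisted_fidelity[OF \<rho> _ _ that, of _ \<O>]
    unfolding W_def T by (auto intro: order_trans)
  \<comment> \<open>Targets of dimension at least \<open>d + 1\<close> reach at most
    \<open>d / (d + 1) = 1 - 1 / (d + 1)\<close>, below the threshold for such
    \<open>\<epsilon>\<close>; the unrestricted set then equals the restricted one.\<close>
  have all: "{m. 1 \<le> m \<and> 1 - \<epsilon> \<le> assisted_fidelity \<O> d \<rho> m} = W" if \<epsilon>: "\<epsilon> < 1 / (real d + 1)"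
  proof -
    have "m \<le> d" if m: "1 \<le> m" "1 - \<epsilon> \<le> assisted_fidelity \<O> d \<rho> m" for m
    proof (rule ccontr)
      assume "\<not> m \<le> d"
      then have "real d + 1 \<le> real m" by simp
      then have "real d / real m \<le> real d / (real d + 1)" by (intro divide_left_mono) auto
      also have "\<dots> = 1 - 1 / (real d + 1)" by (simp add: field_simps)
      also have "\<dots> < 1 - \<epsilon>" using \<epsilon> by simp
      finally show False using assisted_fidelity_le_ratio[OF \<rho> m(1), of \<O>] m(2) by simp
    qed
    then show ?thesis unfolding W_def by blast
  qed
  show ?thesis
    using le eq all
    unfolding assisted_rate_def assisted_rate_within_def rate_tilde_def T_def[symmetric] W_def[symmetric]
    by auto
qed

end
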